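(* Assume that conditions (C1), (C2), (C3) and (C5) listed in the context hold. (a) If $\max_{1\le i\le n}m_i\le M$ for some fixed $M$, then $$\sup_{t\in[a,b]}|\widehat\mu(t)-\mu(t)|=O\bigl(h_\mu^{2}+\{\log n/(nh_\mu)\}^{1/2}\bigr)\quad\text{almost surely.}$$ (b) If $\min_{1\le i\le n}m_i\ge M_n$ for some sequence $M_n$ with $M_n^{-1}\lesssim h_\mu\lesssim(\log n/n)^{1/4}$, then $$\sup_{t\in[a,b]}|\widehat\mu(t)-\mu(t)|=O\bigl(\{\log n/n\}^{1/2}\bigr)\quad\text{almost surely.}$$
   Context: $a_n\lesssim b_n$ means $a_n=O(b_n)$ as $n\to\infty$. Model. $X=\{X(t):t\in[a,b]\}$ is a stochastic process on a fixed interval $[a,b]$ with mean function $\mu(t)=\mathbb{E}\{X(t)\}$ and covariance function $R(s,t)=\operatorname{cov}\{X(s),X(t)\}$, assumed to exist. One observes $Y_{ij}=X_i(T_{ij})+U_{ij}$, $i=1,\dots,n$, $j=1,\dots,m_i$, where the $X_i$ are independent realizations of $X$, the $T_{ij}$ are random points in $[a,b]$ with density $f_T$, and the $U_{ij}$ are identically distributed errors with mean zero and finite variance $\sigma^2$; the $X_i$, $T_{ij}$, $U_{ij}$ are all independent. The numbers $m_i\ge 2$ may depend on $n$ ($m_i=m_{in}$). Notation. $K$ is a kernel and $K_h(t)=(1/h)K(t/h)$. $\gamma_{nk}=\bigl(n^{-1}\sum_{i=1}^n m_i^{-k}\bigr)^{-1}$ for $k=1,2,\dots$. $h_\mu=h_{\mu,n}>0$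 is a bandwidth depending on $n$. Estimator. $\widehat\mu(t)=\widehat a_0$, where $(\widehat a_0,\widehat a_1)$ minimizes over $(a_0,a_1)$ $$\frac1n\sum_{i=1}^n\frac1{m_i}\sum_{j=1}^{m_i}\{Y_{ij}-a_0-a_1(T_{ij}-t)\}^2K_{h_\mu}(T_{ij}-t).$$ Equivalently $\widehat\mu(t)=(R_0S_2-R_1S_1)/(S_0S_2-S_1^2)$ with $S_r=\frac1n\sum_i\frac1{m_i}\sum_j K_{h_\mu}(T_{ij}-t)\{(T_{ij}-t)/h_\mu\}^r$ and $R_r=\frac1n\sum_i\frac1{m_i}\sum_j K_{h_\mu}(T_{ij}-t)\{(T_{ij}-t)/h_\mu\}^rY_{ij}$. Conditions. (C1) For some constants $m_T>0$ and $M_T<\infty$, $m_T\le f_T(t)\le M_T$ for all $t\in[a,b]$; $f_T$ is differentiable with a bounded derivative. (C2) $K$ is a symmetric probability density function on $[-1,1]$ and is of bounded variation on $[-1,1]$. (C3) $\mu$ is twice differentiable and its second derivative is bounded on $[a,b]$. (C5) $\mathbb{E}(|U_{ij}|^{\lambda_\mu})<\infty$ and $\mathbb{E}(\sup_{t\in[a,b]}|X(t)|^{\lambda_\mu})<\infty$ for some $\lambda_\mu\in(2,\infty)$; $h_\mu\to0$ and $(h_\mu^2+h_\mu/\gamma_{n1})^{-1}(\log n/n)^{1-2/\lambda_\mu}\to0$ as $n\to\infty$. *)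

theory Defs
  imports "HOL-Probability.Probability" "HOL-Library.Landau_Symbols"
begin

section \<open>Bounded variation on a real interval\<close>

definition bounded_variation_on :: "(real \<Rightarrow> real) \<Rightarrow> real \<Rightarrow> real \<Rightarrow> bool" where
  "bounded_variation_on f c d \<longleftrightarrow>
     (\<exists>B. \<forall>(x::nat \<Rightarrow> real) N. incseq x \<and> range x \<subseteq> {c..d} \<longrightarrow>
        (\<Sum>k<N. \<bar>f (x (Suc k)) - f (x k)\<bar>) \<le> B)"

section \<open>The sampling model\<close>

definition mean_fun :: "'w measure \<Rightarrow> ('w \<Rightarrow> real \<Rightarrow> real) \<Rightarrow> real \<Rightarrow> real" where
  "mean_fun M X t = (LINT \<omega>|M. X \<omega> t)"

text \<open>Index type of the joint family of all trajectories, observation times and errors, whose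
  members take values in different spaces.\<close>

datatype source = Path nat | Time nat nat | Err nat nat

definition source_events ::
    "'w measure \<Rightarrow> (real \<Rightarrow> real) measure \<Rightarrow> (nat \<Rightarrow> 'w \<Rightarrow> real \<Rightarrow> real) \<Rightarrow>
     (nat \<Rightarrow> nat \<Rightarrow> 'w \<Rightarrow> real) \<Rightarrow> (nat \<Rightarrow> nat \<Rightarrow> 'w \<Rightarrow> real) \<Rightarrow> source \<Rightarrow> 'w set set" where
  "source_events M S Xs T U k =
     (case k of
        Path i \<Rightarrow> {Xs i -` A \<inter> space M |A. A \<in> sets S}
      | Time i j \<Rightarrow> {T i j -` A \<inter> space M |A. A \<in> sets borel}
      | Err i j \<Rightarrow> {U i j -` A \<inter> space M |A. A \<in> sets borel})"

text \<open>A process on the interval from a to b is a random element of a measurable space S of paths,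
  on which evaluation is jointly measurable and the supremum of the absolute value is measurable.
  Joint measurability gives a meaning to a path evaluated at an independent random time: with the
  product sigma-algebra instead, the process that is 1 at an independent uniform time and 0
  elsewhere would be independent of that time.  The space of continuous paths with its Borel sets
  is an example of S.

  Subjects and observations are numbered from 0.  There is one array of trajectories, times and
  errors; at sample size n its entries with i < n and j < m n i are used.\<close>

locale sampling_model = prob_space M
  for M :: "'w measure" +
  fixes a b :: real
    and S :: "(real \<Rightarrow> real) measure"
    and X :: "'w \<Rightarrow> real \<Rightarrow> real"
    and Xs :: "nat \<Rightarrow> 'w \<Rightarrow> real \<Rightarrow> real"
    and T U :: "nat \<Rightarrow> nat \<Rightarrow> 'w \<Rightarrow> real"
    and fT :: "real \<Rightarrow> real"
    and \<sigma> :: real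
    and m :: "nat \<Rightarrow> nat \<Rightarrow> nat"
  assumes interval: "a < b"
    and eval_measurable:
      "(\<lambda>(t, x). x t) \<in> borel_measurable (restrict_space borel {a..b} \<Otimes>\<^sub>M S)"
    and sup_measurable:
      "(\<lambda>x. SUP t\<in>{a..b}. ennreal \<bar>x t\<bar>) \<in> borel_measurable S"
    and X_measurable: "X \<in> measurable M S"
    and X_second_moments: "\<And>t. t \<in> {a..b} \<Longrightarrow> integrable M (\<lambda>\<omega>. (X \<omega> t)\<^sup>2)"
    and Xs_measurable: "\<And>i. Xs i \<in> measurable M S"
    and Xs_copies: "\<And>i. distr M S (Xs i) = distr M S X"
    and T_density: "\<And>i j. distributed M lborel (T i j) (\<lambda>t. ennreal (fT t) * indicator {a..b} t)"
    and U_measurable: "\<And>i j. U i j \<in> borel_measurable M"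
    and U_identical: "\<And>i j i' j'. distr M borel (U i j) = distr M borel (U i' j')"
    and U_integrable: "\<And>i j. integrable M (U i j)"
    and U_mean: "\<And>i j. expectation (U i j) = 0"
    and U_square_integrable: "\<And>i j. integrable M (\<lambda>\<omega>. (U i j \<omega>)\<^sup>2)"
    and U_variance: "\<And>i j. variance (U i j) = \<sigma>\<^sup>2"
    and independence: "indep_sets (source_events M S Xs T U) UNIV"
    and m_ge_2: "\<And>n i. i < n \<Longrightarrow> 2 \<le> m n i"

definition observation ::
    "(nat \<Rightarrow> 'w \<Rightarrow> real \<Rightarrow> real) \<Rightarrow> (nat \<Rightarrow> nat \<Rightarrow> 'w \<Rightarrow> real) \<Rightarrow> (nat \<Rightarrow> nat \<Rightarrow> 'w \<Rightarrow> real) \<Rightarrow>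
     nat \<Rightarrow> nat \<Rightarrow> 'w \<Rightarrow> real" where
  "observation Xs T U i j \<omega> = Xs i \<omega> (T i j \<omega>) + U i j \<omega>"

definition gamma_m :: "(nat \<Rightarrow> nat \<Rightarrow> nat) \<Rightarrow> nat \<Rightarrow> nat \<Rightarrow> real" where
  "gamma_m m n k = inverse ((1 / real n) * (\<Sum>i<n. 1 / real (m n i) ^ k))"

section \<open>The local linear estimator\<close>

definition scaled_kernel :: "(real \<Rightarrow> real) \<Rightarrow> real \<Rightarrow> real \<Rightarrow> real" where
  "scaled_kernel K h t = (1 / h) * K (t / h)"

definition local_linear_loss ::
    "(real \<Rightarrow> real) \<Rightarrow> real \<Rightarrow> nat \<Rightarrow> (nat \<Rightarrow> nat) \<Rightarrow> (nat \<Rightarrow> nat \<Rightarrow> real) \<Rightarrow> (nat \<Rightarrow> nat \<Rightarrow> real) \<Rightarrow>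
     real \<Rightarrow> real \<times> real \<Rightarrow> real" where
  "local_linear_loss K h n l \<tau> y t = (\<lambda>(a0, a1).
     (1 / real n) * (\<Sum>i<n. (1 / real (l i)) *
       (\<Sum>j<l i. (y i j - a0 - a1 * (\<tau> i j - t))\<^sup>2 * scaled_kernel K h (\<tau> i j - t))))"

text \<open>If the minimizer is not unique, \<^const>\<open>arg_min\<close> selects an arbitrary one.\<close>

definition mu_hat ::
    "(real \<Rightarrow> real) \<Rightarrow> (nat \<Rightarrow> real) \<Rightarrow> (nat \<Rightarrow> nat \<Rightarrow> nat) \<Rightarrow> (nat \<Rightarrow> 'w \<Rightarrow> real \<Rightarrow> real) \<Rightarrow>
     (nat \<Rightarrow> nat \<Rightarrow> 'w \<Rightarrow> real) \<Rightarrow> (nat \<Rightarrow> nat \<Rightarrow> 'w \<Rightarrow> real) \<Rightarrow> nat \<Rightarrow> 'w \<Rightarrow> real \<Rightarrow> real" where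
  "mu_hat K h m Xs T U n \<omega> t =
     fst (arg_min (local_linear_loss K (h n) n (m n)
                     (\<lambda>i j. T i j \<omega>) (\<lambda>i j. observation Xs T U i j \<omega>) t) (\<lambda>_. True))"

section \<open>The regularity conditions\<close>

definition condition_C1 :: "real \<Rightarrow> real \<Rightarrow> (real \<Rightarrow> real) \<Rightarrow> bool" where
  "condition_C1 a b fT \<longleftrightarrow>
     (\<exists>mT MT. 0 < mT \<and> (\<forall>t\<in>{a..b}. mT \<le> fT t \<and> fT t \<le> MT)) \<and>
     (\<exists>fT'. (\<forall>t\<in>{a..b}. (fT has_real_derivative fT' t) (at t within {a..b})) \<and>
            bounded (fT' ` {a..b}))"

definition condition_C2 :: "(real \<Rightarrow> real) \<Rightarrow> bool" where
  "condition_C2 K \<longleftrightarrow>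
     (\<forall>x. 0 \<le> K x) \<and> (\<forall>x. x \<notin> {-1..1} \<longrightarrow> K x = 0) \<and>
     K \<in> borel_measurable borel \<and> (\<integral>\<^sup>+x. ennreal (K x) \<partial>lborel) = 1 \<and>
     (\<forall>x. K (- x) = K x) \<and>
     bounded_variation_on K (-1) 1"

definition condition_C3 :: "real \<Rightarrow> real \<Rightarrow> (real \<Rightarrow> real) \<Rightarrow> bool" where
  "condition_C3 a b \<mu> \<longleftrightarrow>
     (\<exists>\<mu>' \<mu>''. (\<forall>t\<in>{a..b}. (\<mu> has_real_derivative \<mu>' t) (at t within {a..b})) \<and>
              (\<forall>t\<in>{a..b}. (\<mu>' has_real_derivative \<mu>'' t) (at t within {a..b})) \<and>
              bounded (\<mu>'' ` {a..b}))"

text \<open>The extended nonnegative supremum makes its finite moment imply that almost all paths are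
  bounded, which the real-valued \<^const>\<open>Sup\<close> would not.\<close>

definition condition_C5 ::
    "'w measure \<Rightarrow> real \<Rightarrow> real \<Rightarrow> ('w \<Rightarrow> real \<Rightarrow> real) \<Rightarrow> (nat \<Rightarrow> nat \<Rightarrow> 'w \<Rightarrow> real) \<Rightarrow>
     (nat \<Rightarrow> nat \<Rightarrow> nat) \<Rightarrow> (nat \<Rightarrow> real) \<Rightarrow> bool" where
  "condition_C5 M a b X U m h \<longleftrightarrow>
     (\<exists>l>2. (\<forall>i j. integrable M (\<lambda>\<omega>. \<bar>U i j \<omega>\<bar> powr l)) \<and>
            (\<integral>\<^sup>+\<omega>. (SUP t\<in>{a..b}. ennreal (\<bar>X \<omega> t\<bar> powr l)) \<partial>M) < \<infinity> \<and>
            h \<longlonglongrightarrow> 0 \<and>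
            (\<lambda>n. inverse ((h n)\<^sup>2 + h n / gamma_m m n 1) * (ln (real n) / real n) powr (1 - 2 / l))
              \<longlonglongrightarrow> 0)"

section \<open>Almost sure uniform rates\<close>

text \<open>The implied constant may depend on the sample point.  The boundedness clause guards
  against the arbitrary value of the real-valued supremum of an unbounded set.\<close>

definition as_uniform_rate ::
    "'w measure \<Rightarrow> real \<Rightarrow> real \<Rightarrow> (nat \<Rightarrow> 'w \<Rightarrow> real \<Rightarrow> real) \<Rightarrow> (nat \<Rightarrow> real) \<Rightarrow> bool" where
  "as_uniform_rate M a b D r \<longleftrightarrow>
     (AE \<omega> in M. (\<forall>\<^sub>F n in sequentially. bdd_above ((\<lambda>t. \<bar>D n \<omega> t\<bar>) ` {a..b})) \<and>
                 (\<lambda>n. SUP t\<in>{a..b}. \<bar>D n \<omega> t\<bar>) \<in> O(r))"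

end

theory Submission
  imports Defs "HOL-Real_Asymp.Real_Asymp"
begin

text \<open>The error of the local linear estimator at t is a ratio whose denominator is the determinant of the
  weighted moments of the design and whose numerator is a bias of order h squared plus a weighted sum
  of the centred noise.  Summation by parts against the kernel, which has bounded variation, reduces
  the numerator to the noise in short intervals, and the denominator is bounded below by the empirical
  mass of short intervals because such a kernel exceeds a positive constant on an interval.  For
  nonnegative clipped variables these sums are monotone in the interval, so a polynomial grid, an exponential
  inequality and the Borel--Cantelli lemma bound them uniformly at the rate
  sqrt ((h^2 + h / gamma) log n / n).

  Trajectories are clipped at a level Q independent of the counts and bounded by subject, which gives
  the term h^2 of the variance; the errors are independent over all pairs and may be clipped at Q m_i.
  This larger level is what makes part (b) work for an array of counts: a strong law for the row
  averages of the l-th powers of the errors can fail when the counts vary with n, but with counts of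
  order at least (n / log n)^(1/4) there are almost surely no errors above the level Q m_i for large n.
  In part (a) only boundedly many errors per subject occur, and the strong law applies to each.\<close>

section \<open>Exponential deviation bounds\<close>

text \<open>The scale \<open>\<theta> n\<close> is the parameter of the exponential inequality, and
  \<open>Q n\<close> is read off from it. A summand of size at most
  \<open>Q n / n = 1 / \<theta> n\<close> is just small enough for the quadratic bound on exp. A
  variance of order \<open>\<beta> n / n\<close> then contributes a multiple of
  \<open>\<theta>^2 * \<beta> / n = ln n\<close> to the exponent, and a deviation of order
  \<open>rate n\<close> a multiple of \<open>\<theta> * rate = ln n\<close>. Both are logarithmic,
  so a large constant times \<open>rate n\<close> beats any polynomial number of intervals. Clipping
  a variable with finite l-th moment at \<open>Q n\<close> loses a mean of order
  \<open>Q n powr (1 - l)\<close>, and (C5) is what bounds this by \<open>rate n\<close>.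

  Positive and negative parts of the noise are treated apart, because only sums of nonnegative terms
  are monotone in the interval.

  The final error is of order \<open>h^2 + rate / h\<close>. Since \<beta> is at most h, this gives
  part (a). The hypotheses of part (b) make \<kappa> at most of order h, hence \<beta> of order h^2,
  and the quotient \<open>rate / h\<close> no longer depends on h.\<close>

lemma exp_le_quadratic:
  fixes x :: real
  assumes "x \<le> 1"
  shows "exp x \<le> 1 + x + x\<^sup>2"
proof (cases "0 \<le> x")
  case True
  with assms show ?thesis by (simp add: exp_bound)
next
  case False
  define y where "y = - x"
  have y: "0 < y" using False by (simp add: y_def)
  have "exp x = 1 / exp y" by (simp add: y_def exp_minus inverse_eq_divide)
  also have "\<dots> \<le> 1 / (1 + y)"
    using y exp_ge_add_one_self[of y] by (intro divide_left_mono) auto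
  also have "\<dots> \<le> 1 - y + y\<^sup>2"
  proof -
    \<comment> \<open>The product equals 1 + y^3.\<close>
    have "1 \<le> (1 - y + y\<^sup>2) * (1 + y)" using y
      by (simp add: algebra_simps power2_eq_square)
    then show ?thesis using y by (simp add: divide_le_eq)
  qed
  finally show ?thesis by (simp add: y_def)
qed

text \<open>The quadratic bound is applied before centring: its linear term cancels against the
  centring factor, and the raw second moment remains in place of the variance. Both signs of
  \<open>l\<close> are allowed so that the upper and the lower tail are served.\<close>

lemma (in prob_space) exp_moment_centred_sum:
  fixes X :: "'i \<Rightarrow> 'a \<Rightarrow> real"
  assumes fin: "finite A"
    and indep: "indep_vars (\<lambda>_. borel) X A"
    and bounds: "\<And>i \<omega>. i \<in> A \<Longrightarrow> 0 \<le> X i \<omega> \<and> X i \<omega> \<le> B"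
    and l: "\<bar>l\<bar> * B \<le> 1"
  shows "(\<integral>\<^sup>+\<omega>. ennreal (exp (l * ((\<Sum>i\<in>A. X i \<omega>) - (\<Sum>i\<in>A. expectation (X i))))) \<partial>M)
          \<le> ennreal (exp (l\<^sup>2 * (\<Sum>i\<in>A. expectation (\<lambda>\<omega>. (X i \<omega>)\<^sup>2))))"
proof -
  have rv[measurable]: "X i \<in> borel_measurable M" if "i \<in> A" for i
    using indep that by (auto simp: indep_vars_def)
  have int: "integrable M (X i)" "integrable M (\<lambda>\<omega>. (X i \<omega>)\<^sup>2)" if "i \<in> A" for i
  proof -
    have "0 \<le> B" using bounds[OF that] by (meson order_trans)
    show "integrable M (X i)"
      using bounds[OF that] rv[OF that] by (intro integrable_const_bound[where B=B]) auto
    show "integrable M (\<lambda>\<omega>. (X i \<omega>)\<^sup>2)"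
      using bounds[OF that] rv[OF that]
      by (intro integrable_const_bound[where B="B\<^sup>2"]) (auto intro!: power_mono)
  qed
  have one: "(\<integral>\<^sup>+\<omega>. ennreal (exp (l * (X i \<omega> - expectation (X i)))) \<partial>M)
      \<le> ennreal (exp (l\<^sup>2 * expectation (\<lambda>\<omega>. (X i \<omega>)\<^sup>2)))" if i: "i \<in> A" for i
  proof -
    let ?e = "expectation (X i)" and ?v = "expectation (\<lambda>\<omega>. (X i \<omega>)\<^sup>2)"
    note [measurable] = rv[OF i]
    have pw: "exp (l * X i \<omega>) \<le> 1 + l * X i \<omega> + l\<^sup>2 * (X i \<omega>)\<^sup>2" for \<omega>
    proof -
      have "l * X i \<omega> \<le> \<bar>l\<bar> * X i \<omega>" using bounds[OF i] by (intro mult_right_mono) auto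
      also have "\<dots> \<le> \<bar>l\<bar> * B" using bounds[OF i] by (intro mult_left_mono) auto
      finally show ?thesis using exp_le_quadratic[of "l * X i \<omega>"] l
        by (simp add: power_mult_distrib)
    qed
    have "(\<integral>\<^sup>+\<omega>. ennreal (exp (l * (X i \<omega> - ?e))) \<partial>M)
        \<le> (\<integral>\<^sup>+\<omega>. ennreal (exp (- l * ?e) * (1 + l * X i \<omega> + l\<^sup>2 * (X i \<omega>)\<^sup>2)) \<partial>M)"
      using pw by (intro nn_integral_mono ennreal_leI)
        (auto simp: right_diff_distrib exp_diff exp_minus divide_simps)
    also have "\<dots> = ennreal (expectation (\<lambda>\<omega>. exp (- l * ?e) * (1 + l * X i \<omega> + l\<^sup>2 * (X i \<omega>)\<^sup>2)))"
    proof (rule nn_integral_eq_integral)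
      show "integrable M (\<lambda>\<omega>. exp (- l * ?e) * (1 + l * X i \<omega> + l\<^sup>2 * (X i \<omega>)\<^sup>2))"
        using int[OF i] by auto
      show "AE \<omega> in M. 0 \<le> exp (- l * ?e) * (1 + l * X i \<omega> + l\<^sup>2 * (X i \<omega>)\<^sup>2)"
        using order_trans[OF exp_ge_zero pw] by (intro AE_I2 mult_nonneg_nonneg) auto
    qed
    also have "expectation (\<lambda>\<omega>. exp (- l * ?e) * (1 + l * X i \<omega> + l\<^sup>2 * (X i \<omega>)\<^sup>2))
        = exp (- l * ?e) * (1 + l * ?e + l\<^sup>2 * ?v)"
      using int[OF i] by (simp add: prob_space)
    also have "\<dots> \<le> exp (- l * ?e) * exp (l * ?e + l\<^sup>2 * ?v)"
      using exp_ge_add_one_self[of "l * ?e + l\<^sup>2 * ?v"] by (intro mult_left_mono) (auto simp: add_ac)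
    also have "\<dots> = exp (l\<^sup>2 * ?v)" by (simp flip: exp_add)
    finally show ?thesis by (simp add: ennreal_leI)
  qed
  have "(\<integral>\<^sup>+\<omega>. ennreal (exp (l * ((\<Sum>i\<in>A. X i \<omega>) - (\<Sum>i\<in>A. expectation (X i))))) \<partial>M)
      = (\<integral>\<^sup>+\<omega>. (\<Prod>i\<in>A. ennreal (exp (l * (X i \<omega> - expectation (X i))))) \<partial>M)"
    by (intro nn_integral_cong)
      (simp add: prod_ennreal sum_distrib_left right_diff_distrib sum_subtractf fin flip: exp_sum)
  also have "\<dots> = (\<Prod>i\<in>A. \<integral>\<^sup>+\<omega>. ennreal (exp (l * (X i \<omega> - expectation (X i)))) \<partial>M)"
    by (intro indep_vars_nn_integral fin indep_vars_compose2[OF indep]) auto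
  also have "\<dots> \<le> (\<Prod>i\<in>A. ennreal (exp (l\<^sup>2 * expectation (\<lambda>\<omega>. (X i \<omega>)\<^sup>2))))"
    by (intro prod_mono_ennreal one)
  also have "\<dots> = ennreal (exp (l\<^sup>2 * (\<Sum>i\<in>A. expectation (\<lambda>\<omega>. (X i \<omega>)\<^sup>2))))"
    by (simp add: prod_ennreal sum_distrib_left fin exp_sum)
  finally show ?thesis .
qed

text \<open>Markov's inequality for the exponential at a fixed parameter \<open>l\<close>. The cap
  \<open>1 / l\<close> on the summands is exactly the restriction under which the quadratic bound
  holds; the caller chooses \<open>l\<close> to balance \<open>l^2 * V\<close> against
  \<open>l * s\<close>.\<close>

lemma (in prob_space) exponential_deviation_bound:
  fixes X :: "'i \<Rightarrow> 'a \<Rightarrow> real"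
  assumes fin: "finite A"
    and indep: "indep_vars (\<lambda>_. borel) X A"
    and bounds: "\<And>i \<omega>. i \<in> A \<Longrightarrow> 0 \<le> X i \<omega> \<and> X i \<omega> \<le> 1 / l"
    and l: "0 < l"
    and var: "(\<Sum>i\<in>A. expectation (\<lambda>\<omega>. (X i \<omega>)\<^sup>2)) \<le> V"
  shows "prob {\<omega> \<in> space M. s \<le> \<bar>(\<Sum>i\<in>A. X i \<omega>) - (\<Sum>i\<in>A. expectation (X i))\<bar>}
          \<le> 2 * exp (l\<^sup>2 * V - l * s)"
proof -
  define D where "D = (\<lambda>\<omega>. (\<Sum>i\<in>A. X i \<omega>) - (\<Sum>i\<in>A. expectation (X i)))"
  have rv[measurable]: "X i \<in> borel_measurable M" if "i \<in> A" for i
    using indep that by (auto simp: indep_vars_def)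
  have Dm[measurable]: "D \<in> borel_measurable M" by (auto simp: D_def)
  have side: "prob {\<omega> \<in> space M. s \<le> c * D \<omega>} \<le> exp (l\<^sup>2 * V - l * s)" if c: "c = 1 \<or> c = -1" for c
  proof -
    have "emeasure M {\<omega> \<in> space M. s \<le> c * D \<omega>}
        \<le> (\<integral>\<^sup>+\<omega>. ennreal (exp (- l * s)) * ennreal (exp (l * c * D \<omega>)) \<partial>M)"
    proof -
      have "emeasure M {\<omega> \<in> space M. s \<le> c * D \<omega>} = (\<integral>\<^sup>+\<omega>. indicator {\<omega> \<in> space M. s \<le> c * D \<omega>} \<omega> \<partial>M)"
        by simp
      also have "\<dots> \<le> (\<integral>\<^sup>+\<omega>. ennreal (exp (- l * s)) * ennreal (exp (l * c * D \<omega>)) \<partial>M)"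
      proof (intro nn_integral_mono)
        fix \<omega>
        show "indicator {\<omega> \<in> space M. s \<le> c * D \<omega>} \<omega> \<le> ennreal (exp (- l * s)) * ennreal (exp (l * c * D \<omega>))"
        proof (cases "s \<le> c * D \<omega>")
          case True
          then have "l * s \<le> l * (c * D \<omega>)" using l by simp
          then have "1 \<le> exp (- l * s) * exp (l * c * D \<omega>)"
            by (simp add: mult.assoc flip: exp_add)
          then show ?thesis by (auto simp: indicator_def simp flip: ennreal_mult'' ennreal_1 intro!: ennreal_leI)
        qed auto
      qed
      finally show ?thesis .
    qed
    also have "\<dots> = ennreal (exp (- l * s)) * (\<integral>\<^sup>+\<omega>. ennreal (exp ((l * c) * D \<omega>)) \<partial>M)"
      by (subst nn_integral_cmult) auto
    also have "\<dots> \<le> ennreal (exp (- l * s)) * ennreal (exp ((l * c)\<^sup>2 * (\<Sum>i\<in>A. expectation (\<lambda>\<omega>. (X i \<omega>)\<^sup>2))))"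
      unfolding D_def using fin indep bounds
      by (intro mult_left_mono exp_moment_centred_sum[where B="1/l"]) (use c l in \<open>auto simp: abs_mult\<close>)
    also have "\<dots> \<le> ennreal (exp (- l * s)) * ennreal (exp (l\<^sup>2 * V))"
      using c var by (intro mult_left_mono ennreal_leI) (auto intro!: mult_left_mono simp: power_mult_distrib)
    also have "\<dots> = ennreal (exp (l\<^sup>2 * V - l * s))"
      by (simp add: exp_diff exp_minus divide_simps flip: ennreal_mult'')
    finally show ?thesis by (simp add: emeasure_eq_measure)
  qed
  have "prob {\<omega> \<in> space M. s \<le> \<bar>D \<omega>\<bar>} \<le> prob ({\<omega> \<in> space M. s \<le> 1 * D \<omega>} \<union> {\<omega> \<in> space M. s \<le> (-1) * D \<omega>})"
    by (intro finite_measure_mono) (auto simp: abs_if split: if_splits)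
  also have "\<dots> \<le> prob {\<omega> \<in> space M. s \<le> 1 * D \<omega>} + prob {\<omega> \<in> space M. s \<le> (-1) * D \<omega>}"
    by (intro measure_Un_le) auto
  also have "\<dots> \<le> 2 * exp (l\<^sup>2 * V - l * s)"
    using side[of 1] side[of "-1"] by simp
  finally show ?thesis by (simp add: D_def)
qed

text \<open>An interval is squeezed between an inner and an outer interval with end points on a grid
  of n cells. Monotonicity then transfers the deviation from the grid at the price of a gap between
  expectations, which \<open>step\<close> bounds. The inner interval may be reversed, so the
  hypotheses on \<xi> are stated without p \<le> q.\<close>

lemma (in prob_space) uniform_interval_deviation:
  fixes \<xi> :: "nat \<Rightarrow> 'i \<Rightarrow> real \<Rightarrow> real \<Rightarrow> 'a \<Rightarrow> real"
  assumes ab: "a < b" and C: "0 \<le> C"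
    and fin: "\<And>n. finite (A n)"
    and indep: "\<And>n p q. indep_vars (\<lambda>_. borel) (\<lambda>i. \<xi> n i p q) (A n)"
    and mono: "\<And>n i p q p' q' \<omega>. \<lbrakk>i \<in> A n; p' \<le> p; q \<le> q'\<rbrakk> \<Longrightarrow> \<xi> n i p q \<omega> \<le> \<xi> n i p' q' \<omega>"
    and \<theta>: "\<forall>\<^sub>F n in sequentially. 0 < \<theta> n"
    and bounds: "\<forall>\<^sub>F n in sequentially. \<forall>i\<in>A n. \<forall>p q \<omega>. 0 \<le> \<xi> n i p q \<omega> \<and> \<xi> n i p q \<omega> \<le> 1 / \<theta> n"
    and var: "\<forall>\<^sub>F n in sequentially. \<forall>p q. q - p \<le> \<rho> n + 2 * (b - a) / real n \<longrightarrow>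
        (\<Sum>i\<in>A n. expectation (\<lambda>\<omega>. (\<xi> n i p q \<omega>)\<^sup>2)) \<le> C * ln (real n) / (\<theta> n)\<^sup>2"
    and step: "\<forall>\<^sub>F n in sequentially. \<forall>p q p' q'. p' \<le> p \<and> q \<le> q' \<and>
        (p - p') + (q' - q) \<le> 2 * (b - a) / real n \<longrightarrow>
        (\<Sum>i\<in>A n. expectation (\<xi> n i p' q')) - (\<Sum>i\<in>A n. expectation (\<xi> n i p q)) \<le> C * ln (real n) / \<theta> n"
  shows "AE \<omega> in M. \<forall>\<^sub>F n in sequentially. \<forall>p q. a \<le> p \<and> p \<le> q \<and> q \<le> b \<and> q - p \<le> \<rho> n \<longrightarrow>
      \<bar>(\<Sum>i\<in>A n. \<xi> n i p q \<omega>) - (\<Sum>i\<in>A n. expectation (\<xi> n i p q))\<bar>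
        \<le> (2 * C + 5) * ln (real n) / \<theta> n"
proof -
  define \<delta> where "\<delta> n = (b - a) / real n" for n
  define g where "g n k = a + real_of_int k * \<delta> n" for n k
  define D where "D n p q \<omega> = (\<Sum>i\<in>A n. \<xi> n i p q \<omega>) - (\<Sum>i\<in>A n. expectation (\<xi> n i p q))" for n p q \<omega>
  \<comment> \<open>The summand \<open>C\<close> absorbs the variance term of the exponent; the 5
    leaves a probability of order n^(-5), summable even after multiplication by the number (n + 3)^2
    of grid pairs.\<close>
  define s where "s n = (C + 5) * ln (real n) / \<theta> n" for n
  \<comment> \<open>The indices run one cell past each end: an inner interval can start at index n +
    1 or end at index -1. An outer interval is longer than \<rho> by at most two cells.\<close>
  define B where "B n = (\<Union>(k, l)\<in>{(k, l) \<in> {-1..int n + 1} \<times> {-1..int n + 1}. g n l - g n k \<le> \<rho> n + 2 * \<delta> n}.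
      {\<omega> \<in> space M. s n \<le> \<bar>D n (g n k) (g n l) \<omega>\<bar>})" for n
  have rv[measurable]: "\<xi> n i p q \<in> borel_measurable M" if "i \<in> A n" for n i p q
    using indep[of n p q] that by (auto simp: indep_vars_def)
  have [measurable]: "D n p q \<in> borel_measurable M" for n p q
    unfolding D_def[abs_def] by (intro borel_measurable_diff borel_measurable_sum rv) auto
  have Bm: "B n \<in> sets M" for n
    unfolding B_def by (rule sets.finite_UN) (auto intro: finite_subset[of _ "{-1..int n + 1} \<times> {-1..int n + 1}"])
  have "\<forall>\<^sub>F n in sequentially. prob (B n) \<le> (real n + 3)\<^sup>2 * (2 * real n powr (-5))"
    using \<theta> bounds var eventually_ge_at_top[of 1]
  proof eventually_elim
    case (elim n)
    let ?I = "{(k, l) \<in> {-1..int n + 1} \<times> {-1..int n + 1}. g n l - g n k \<le> \<rho> n + 2 * \<delta> n}"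
    have finI: "finite ?I" by (rule finite_subset[of _ "{-1..int n + 1} \<times> {-1..int n + 1}"]) auto
    have "card ?I \<le> card ({-1..int n + 1} \<times> {-1..int n + 1})" by (intro card_mono) auto
    also have "\<dots> = (n + 3)\<^sup>2" 
    proof -
      have "card {-1..int n + 1} = n + 3" unfolding card_atLeastAtMost_int by linarith
      then show ?thesis by (simp only: card_cartesian_product power2_eq_square)
    qed
    finally have "real (card ?I) \<le> real ((n + 3)\<^sup>2)" by (simp only: of_nat_le_iff)
    then have card: "real (card ?I) \<le> (real n + 3)\<^sup>2" by simp
    have each: "prob {\<omega> \<in> space M. s n \<le> \<bar>D n (g n k) (g n l) \<omega>\<bar>} \<le> 2 * real n powr (-5)"
      if "(k, l) \<in> ?I" for k l
    proof -
      have "prob {\<omega> \<in> space M. s n \<le> \<bar>D n (g n k) (g n l) \<omega>\<bar>}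
         \<le> 2 * exp ((\<theta> n)\<^sup>2 * (C * ln (real n) / (\<theta> n)\<^sup>2) - \<theta> n * s n)"
        unfolding D_def using elim that
        by (intro exponential_deviation_bound fin indep) (auto simp: \<delta>_def)
      also have "(\<theta> n)\<^sup>2 * (C * ln (real n) / (\<theta> n)\<^sup>2) - \<theta> n * s n = - 5 * ln (real n)"
        using elim by (simp add: s_def field_simps)
      also have "exp (- 5 * ln (real n)) = real n powr (-5)" using elim by (simp add: powr_def)
      finally show ?thesis .
    qed
    have "prob (B n) \<le> (\<Sum>(k, l)\<in>?I. prob {\<omega> \<in> space M. s n \<le> \<bar>D n (g n k) (g n l) \<omega>\<bar>})"
      unfolding B_def case_prod_unfold by (rule measure_UNION_le) (use finI in \<open>auto simp: case_prod_unfold\<close>)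
    also have "\<dots> \<le> (\<Sum>(k, l)\<in>?I. 2 * real n powr (-5))"
      using each by (intro sum_mono) auto
    also have "\<dots> = real (card ?I) * (2 * real n powr (-5))" by (simp add: case_prod_unfold)
    also have "\<dots> \<le> (real n + 3)\<^sup>2 * (2 * real n powr (-5))"
      by (intro mult_right_mono card) auto
    finally show ?case .
  qed
  moreover have "summable (\<lambda>n. (real n + 3)\<^sup>2 * (2 * real n powr (-5)))"
  proof (rule summable_comparison_test_ev)
    show "\<forall>\<^sub>F n in sequentially. norm ((real n + 3)\<^sup>2 * (2 * real n powr (-5))) \<le> real n powr (-2)"
      unfolding real_norm_def by real_asymp
    show "summable (\<lambda>n. real n powr (-2))" by (simp add: summable_real_powr_iff)
  qed
  ultimately have "summable (\<lambda>n. prob (B n))"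
    by (intro summable_comparison_test_ev[where f="\<lambda>n. prob (B n)"]) (auto elim!: eventually_mono)
  then have "AE \<omega> in M. \<forall>\<^sub>F n in sequentially. \<omega> \<in> space M - B n"
    by (intro borel_cantelli_AE1 Bm) (auto simp: emeasure_eq_measure)
  then show ?thesis
  proof eventually_elim
    case (elim \<omega>)
    then show ?case using \<theta> bounds step eventually_ge_at_top[of 1]
    proof eventually_elim
      case (elim n)
      have \<delta>: "0 < \<delta> n" "real n * \<delta> n = b - a" using ab elim by (auto simp: \<delta>_def)
      have good: "\<bar>D n (g n k) (g n l) \<omega>\<bar> < s n"
        if "k \<in> {-1..int n + 1}" "l \<in> {-1..int n + 1}" "g n l - g n k \<le> \<rho> n + 2 * \<delta> n" for k l
      proof (rule ccontr)
        assume c: "\<not> ?thesis"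
        have "\<omega> \<in> B n" unfolding B_def
          by (rule UN_I[of "(k, l)"]) (use c elim(1) that in simp_all)
        then show False using elim(1) by simp
      qed
      have emono: "(\<Sum>i\<in>A n. expectation (\<xi> n i p q)) \<le> (\<Sum>i\<in>A n. expectation (\<xi> n i p' q'))"
        if "p' \<le> p" "q \<le> q'" for p q p' q'
      proof (intro sum_mono integral_mono)
        fix i assume i: "i \<in> A n"
        have "integrable M (\<xi> n i p q)" for p q
          using elim i by (intro integrable_const_bound[where B="1 / \<theta> n"]) auto
        then show "integrable M (\<xi> n i p q)" "integrable M (\<xi> n i p' q')" by auto
      qed (use mono that in auto)
      show ?case
      proof (intro allI impI, elim conjE)
        fix p q assume pq: "a \<le> p" "p \<le> q" "q \<le> b" "q - p \<le> \<rho> n"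
        \<comment> \<open>Rounding outwards gives the outer interval from k to l; the inner one runs
          from k + 1 to l - 1.\<close>
        define k where "k = \<lfloor>(p - a) / \<delta> n\<rfloor>"
        define l where "l = \<lceil>(q - a) / \<delta> n\<rceil>"
        have k1: "g n k \<le> p" "p < g n (k + 1)"
        proof -
          have "real_of_int k \<le> (p - a) / \<delta> n" "(p - a) / \<delta> n < real_of_int k + 1"
            by (auto simp: k_def)
          then show "g n k \<le> p" "p < g n (k + 1)" using \<delta> by (auto simp: g_def field_simps)
        qed
        have l1: "q \<le> g n l" "g n (l - 1) < q"
        proof -
          have "(q - a) / \<delta> n \<le> real_of_int l" "real_of_int l - 1 < (q - a) / \<delta> n"
            unfolding l_def by linarith+
          then show "q \<le> g n l" "g n (l - 1) < q" using \<delta> by (auto simp: g_def field_simps)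
        qed
        have "0 \<le> (p - a) / \<delta> n" "(q - a) / \<delta> n \<le> real n" "0 \<le> (q - a) / \<delta> n" "(p - a) / \<delta> n \<le> real n"
          using pq \<delta> by (auto simp: field_simps)
        then have range: "0 \<le> k" "k \<le> int n" "0 \<le> l" "l \<le> int n"
          unfolding k_def l_def by (simp_all add: le_floor_iff floor_le_iff ceiling_le_iff zero_le_ceiling)
        have shift: "g n (k + 1) = g n k + \<delta> n" "g n (l - 1) = g n l - \<delta> n"
          by (auto simp: g_def algebra_simps)
        have outer: "\<bar>D n (g n k) (g n l) \<omega>\<bar> < s n"
          using range k1 l1 pq shift by (intro good) auto
        have inner: "\<bar>D n (g n (k+1)) (g n (l-1)) \<omega>\<bar> < s n"
          using range k1 l1 pq shift \<delta> by (intro good) auto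
        have gap: "(\<Sum>i\<in>A n. expectation (\<xi> n i (g n k) (g n l)))
            - (\<Sum>i\<in>A n. expectation (\<xi> n i (g n (k+1)) (g n (l-1)))) \<le> C * ln (real n) / \<theta> n"
          using elim(4) k1 l1 shift \<delta> by (auto simp: \<delta>_def)
        have sum1: "(\<Sum>i\<in>A n. \<xi> n i p q \<omega>) \<le> (\<Sum>i\<in>A n. \<xi> n i (g n k) (g n l) \<omega>)"
          and sum2: "(\<Sum>i\<in>A n. \<xi> n i (g n (k+1)) (g n (l-1)) \<omega>) \<le> (\<Sum>i\<in>A n. \<xi> n i p q \<omega>)"
          using k1 l1 by (auto intro!: sum_mono mono)
        note e = emono[of "g n k" p q "g n l"] emono[of p "g n (k+1)" "g n (l-1)" q]
        \<comment> \<open>The outer sum bounds from above, the inner sum from below, and their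
          expectations differ by at most the gap.\<close>
        have "\<bar>D n p q \<omega>\<bar> \<le> s n + C * ln (real n) / \<theta> n"
          using outer inner gap sum1 sum2 e k1 l1 unfolding D_def by linarith
        also have "\<dots> = (2 * C + 5) * ln (real n) / \<theta> n"
          unfolding s_def add_divide_distrib[symmetric] by (simp add: algebra_simps)
        finally show "\<bar>(\<Sum>i\<in>A n. \<xi> n i p q \<omega>) - (\<Sum>i\<in>A n. expectation (\<xi> n i p q))\<bar>
          \<le> (2 * C + 5) * ln (real n) / \<theta> n" by (simp add: D_def)
      qed
    qed
  qed
qed

section \<open>Averages of independent copies\<close>

text \<open>By independence the off-diagonal products have expectations that the squared mean
  cancels.\<close>

lemma (in prob_space) variance_sum_le:
  fixes Y :: "'i \<Rightarrow> 'a \<Rightarrow> real"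
  assumes fin: "finite A" and indep: "indep_vars (\<lambda>_. borel) Y A"
    and nonneg: "\<And>i \<omega>. 0 \<le> Y i \<omega>" and sq: "\<And>i. i \<in> A \<Longrightarrow> integrable M (\<lambda>\<omega>. (Y i \<omega>)\<^sup>2)"
  shows "integrable M (\<lambda>\<omega>. (\<Sum>i\<in>A. Y i \<omega>)\<^sup>2)"
    and "variance (\<lambda>\<omega>. \<Sum>i\<in>A. Y i \<omega>) \<le> (\<Sum>i\<in>A. expectation (\<lambda>\<omega>. (Y i \<omega>)\<^sup>2))"
proof -
  have rv[measurable]: "Y i \<in> borel_measurable M" if "i \<in> A" for i
    using indep that by (auto simp: indep_vars_def)
  have int: "integrable M (Y i)" if "i \<in> A" for i
    using square_integrable_imp_integrable[OF rv sq] that by auto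
  have prod: "integrable M (\<lambda>\<omega>. Y i \<omega> * Y j \<omega>)
      \<and> expectation (\<lambda>\<omega>. Y i \<omega> * Y j \<omega>)
        \<le> (if i = j then expectation (\<lambda>\<omega>. (Y i \<omega>)\<^sup>2) else 0) + expectation (Y i) * expectation (Y j)"
    if "i \<in> A" "j \<in> A" for i j
  proof (cases "i = j")
    case True
    then show ?thesis using sq[OF that(1)] by (simp add: power2_eq_square)
  next
    case False
    have sub: "indep_vars (\<lambda>_. borel) Y {i, j}"
      using indep_vars_subset[OF indep, of "{i, j}"] that by auto
    have "integrable M (\<lambda>\<omega>. \<Prod>k\<in>{i, j}. Y k \<omega>)"
      "(\<integral>\<omega>. (\<Prod>k\<in>{i, j}. Y k \<omega>) \<partial>M) = (\<Prod>k\<in>{i, j}. expectation (Y k))"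
      using that int by (auto intro!: indep_vars_integrable indep_vars_lebesgue_integral sub)
    then show ?thesis using False by simp
  qed
  have eq: "(\<Sum>i\<in>A. Y i \<omega>)\<^sup>2 = (\<Sum>i\<in>A. \<Sum>j\<in>A. Y i \<omega> * Y j \<omega>)" for \<omega>
    by (simp add: power2_eq_square sum_product)
  show int2: "integrable M (\<lambda>\<omega>. (\<Sum>i\<in>A. Y i \<omega>)\<^sup>2)"
    unfolding eq using prod by auto
  have "expectation (\<lambda>\<omega>. (\<Sum>i\<in>A. Y i \<omega>)\<^sup>2) = (\<Sum>i\<in>A. \<Sum>j\<in>A. expectation (\<lambda>\<omega>. Y i \<omega> * Y j \<omega>))"
    unfolding eq using prod by (simp add: Bochner_Integration.integral_sum Bochner_Integration.integrable_sum)
  also have "\<dots> \<le> (\<Sum>i\<in>A. \<Sum>j\<in>A. (if i = j then expectation (\<lambda>\<omega>. (Y i \<omega>)\<^sup>2) else 0)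
      + expectation (Y i) * expectation (Y j))"
    using prod by (intro sum_mono) auto
  also have "\<dots> = (\<Sum>i\<in>A. expectation (\<lambda>\<omega>. (Y i \<omega>)\<^sup>2)) + (expectation (\<lambda>\<omega>. \<Sum>i\<in>A. Y i \<omega>))\<^sup>2"
    using fin int by (simp add: sum.distrib sum_product power2_eq_square)
  finally have "expectation (\<lambda>\<omega>. (\<Sum>i\<in>A. Y i \<omega>)\<^sup>2) - (expectation (\<lambda>\<omega>. \<Sum>i\<in>A. Y i \<omega>))\<^sup>2
      \<le> (\<Sum>i\<in>A. expectation (\<lambda>\<omega>. (Y i \<omega>)\<^sup>2))" by simp
  then show "variance (\<lambda>\<omega>. \<Sum>i\<in>A. Y i \<omega>) \<le> (\<Sum>i\<in>A. expectation (\<lambda>\<omega>. (Y i \<omega>)\<^sup>2))"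
    using int int2 by (subst variance_eq) auto
qed

text \<open>The geometric series starts at the first scale 2^q above w and is at most 2 * w^2 / 2^q,
  hence at most 2 * w. This is how truncated second moments become summable over dyadic scales from
  a first moment alone.\<close>

lemma dyadic_truncated_sum_le:
  fixes w :: real
  assumes "0 \<le> w"
  shows "(\<Sum>p<N. (1/2) ^ p * (if w \<le> 2 ^ p then w\<^sup>2 else 0)) \<le> 2 * w"
proof (cases "\<exists>p<N. w \<le> 2 ^ p")
  case False
  then show ?thesis using assms by (simp add: sum_nonneg_0 sum.neutral)
next
  case True
  define q where "q = (LEAST p. w \<le> 2 ^ p)"
  have q: "w \<le> 2 ^ q" using True unfolding q_def by (metis (mono_tags, lifting) LeastI)
  have "(\<Sum>p<N. (1/2) ^ p * (if w \<le> 2 ^ p then w\<^sup>2 else 0)) \<le> (\<Sum>p\<in>{q..<N}. (1/2) ^ p * w\<^sup>2)"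
  proof -
    have "(\<Sum>p<N. (1/2) ^ p * (if w \<le> 2 ^ p then w\<^sup>2 else 0)) = (\<Sum>p\<in>{p\<in>{..<N}. w \<le> 2 ^ p}. (1/2) ^ p * w\<^sup>2)"
      by (auto intro!: sum.mono_neutral_cong_right split: if_splits)
    also have "\<dots> \<le> (\<Sum>p\<in>{q..<N}. (1/2) ^ p * w\<^sup>2)"
      by (intro sum_mono2) (auto simp: q_def intro: Least_le)
    finally show ?thesis .
  qed
  also have "\<dots> = (\<Sum>p\<in>{q..<N}. (1/2) ^ p) * w\<^sup>2" by (simp add: sum_distrib_right)
  also have "\<dots> \<le> (2 * (1/2) ^ q) * w\<^sup>2"
  proof (intro mult_right_mono)
    have "(\<Sum>p\<in>{q..<N}. (1/2::real) ^ p) = (if q \<le> N then 2 * (1/2) ^ q - 2 * (1/2) ^ N else 0)"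
      by (induction N) (auto simp: le_Suc_eq)
    then show "(\<Sum>p\<in>{q..<N}. (1/2::real) ^ p) \<le> 2 * (1/2) ^ q" by simp
  qed auto
  also have "\<dots> = 2 * w * (w * (1/2) ^ q)" by (simp add: power2_eq_square)
  also have "\<dots> \<le> 2 * w * 1"
    using q assms by (intro mult_left_mono) (auto simp: power_divide)
  finally show ?thesis by simp
qed

text \<open>A boundedness form of the strong law, for variables with a first moment only; it is
  applied to l-th powers, which have no more. Chebyshev's inequality along n = 2^p suffices:
  nonnegativity makes the partial sums monotone, and passing to the next power of two costs a
  constant factor.\<close>

lemma (in prob_space) iid_averages_bounded:
  fixes W :: "nat \<Rightarrow> 'a \<Rightarrow> real"
  assumes indep: "indep_vars (\<lambda>_. borel) W UNIV"
    and nonneg: "\<And>i \<omega>. 0 \<le> W i \<omega>"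
    and ident: "\<And>i. distr M borel (W i) = distr M borel (W 0)"
    and int: "integrable M (W 0)"
  shows "AE \<omega> in M. \<exists>C. \<forall>n. (\<Sum>i<n. W i \<omega>) \<le> C * real n"
proof -
  have rv[measurable]: "W i \<in> borel_measurable M" for i
    using indep by (auto simp: indep_vars_def)
  have transfer: "expectation (\<lambda>\<omega>. f (W i \<omega>)) = expectation (\<lambda>\<omega>. f (W 0 \<omega>))"
    if [measurable]: "f \<in> borel_measurable borel" for f :: "real \<Rightarrow> real" and i
  proof -
    have "expectation (\<lambda>\<omega>. f (W i \<omega>)) = (\<integral>x. f x \<partial>distr M borel (W i))" by (simp add: integral_distr)
    also have "\<dots> = expectation (\<lambda>\<omega>. f (W 0 \<omega>))" unfolding ident[of i] by (simp add: integral_distr)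
    finally show ?thesis .
  qed
  define Y where "Y i \<omega> = (if W i \<omega> \<le> real (Suc i) then W i \<omega> else 0)" for i \<omega>
  have [measurable]: "Y i \<in> borel_measurable M" for i unfolding Y_def[abs_def] by measurable
  have Y: "0 \<le> Y i \<omega>" "Y i \<omega> \<le> W i \<omega>" "Y i \<omega> \<le> real (Suc i)" for i \<omega>
    using nonneg by (auto simp: Y_def)
  have Yind: "indep_vars (\<lambda>_. borel) Y UNIV"
    using indep_vars_compose2[OF indep, of "\<lambda>i x. if x \<le> real (Suc i) then x else 0" "\<lambda>_. borel"]
    by (simp add: Y_def[abs_def])
  have Yint: "integrable M (Y i)" "integrable M (\<lambda>\<omega>. (Y i \<omega>)\<^sup>2)" for i
  proof -
    show "integrable M (Y i)"
      by (rule integrable_const_bound[where B="real (Suc i)"]) (use Y[of i] in auto)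
    show "integrable M (\<lambda>\<omega>. (Y i \<omega>)\<^sup>2)"
      by (rule integrable_const_bound[where B="(real (Suc i))\<^sup>2"]) (use Y[of i] in \<open>auto intro!: power_mono\<close>)
  qed
  have Yexp: "expectation (Y i) \<le> expectation (W 0)" for i
  proof -
    have "expectation (Y i) = expectation (\<lambda>\<omega>. if W 0 \<omega> \<le> real (Suc i) then W 0 \<omega> else 0)"
      unfolding Y_def[abs_def] by (rule transfer) measurable
    also have "\<dots> \<le> expectation (W 0)"
      using nonneg int by (intro integral_mono') auto
    finally show ?thesis .
  qed
  \<comment> \<open>The number of levels i + 1 below w is at most w, so the first moment makes the
    truncation act on almost surely finitely many indices.\<close>
  have bd1: "(\<Sum>i<N. prob {\<omega>\<in>space M. real (Suc i) < W i \<omega>}) \<le> expectation (W 0)" for N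
  proof -
    have "prob {\<omega>\<in>space M. real (Suc i) < W i \<omega>} = expectation (\<lambda>\<omega>. indicator {real (Suc i)<..} (W 0 \<omega>))" for i
    proof -
      have "prob {\<omega>\<in>space M. real (Suc i) < W i \<omega>} = expectation (indicator {\<omega>\<in>space M. real (Suc i) < W i \<omega>})"
        by simp
      also have "\<dots> = expectation (\<lambda>\<omega>. indicator {real (Suc i)<..} (W i \<omega>))"
        by (intro Bochner_Integration.integral_cong) (auto simp: indicator_def)
      also have "\<dots> = expectation (\<lambda>\<omega>. indicator {real (Suc i)<..} (W 0 \<omega>))"
        by (rule transfer) measurable
      finally show ?thesis .
    qed
    then have "(\<Sum>i<N. prob {\<omega>\<in>space M. real (Suc i) < W i \<omega>})
        = expectation (\<lambda>\<omega>. \<Sum>i<N. indicator {real (Suc i)<..} (W 0 \<omega>))"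
      by (subst Bochner_Integration.integral_sum) (auto intro!: integrable_const_bound[where B=1])
    also have "\<dots> \<le> expectation (W 0)"
    proof (intro integral_mono int)
      show "(\<Sum>i<N. indicator {real (Suc i)<..} (W 0 \<omega>)) \<le> W 0 \<omega>" for \<omega>
      proof -
        \<comment> \<open>The bound by N is carried along for the induction step: when w exceeds N +
          1, the earlier terms number at most N and one more still stays below w.\<close>
        have "(\<Sum>i<N. indicator {real (Suc i)<..} w) \<le> w \<and>
              (\<Sum>i<N. indicator {real (Suc i)<..} w) \<le> real N" if "0 \<le> w" for w :: real
          using that by (induction N) (auto simp: indicator_def split: if_splits)
        then show ?thesis using nonneg by blast
      qed
      show "integrable M (\<lambda>\<omega>. \<Sum>i<N. indicator {real (Suc i)<..} (W 0 \<omega>) :: real)"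
        by (intro Bochner_Integration.integrable_sum integrable_const_bound[where B=1]) auto
    qed
    finally show ?thesis .
  qed
  have "summable (\<lambda>i. prob {\<omega>\<in>space M. real (Suc i) < W i \<omega>})"
    by (rule bounded_imp_summable[of _ "expectation (W 0)"]) (use bd1[of "Suc _"] in \<open>auto simp: lessThan_Suc_atMost\<close>)
  then have ev1: "AE \<omega> in M. \<forall>\<^sub>F i in sequentially. \<omega> \<in> space M - {\<omega>\<in>space M. real (Suc i) < W i \<omega>}"
    by (intro borel_cantelli_AE1) (auto simp: emeasure_eq_measure)
  define S where "S p \<omega> = (\<Sum>i<(2::nat)^p. Y i \<omega>)" for p \<omega>
  have [measurable]: "S p \<in> borel_measurable M" for p unfolding S_def[abs_def] by measurable
  \<comment> \<open>By Chebyshev a deviation of 2^p has probability at most 2^p * t p / 4^p, and the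
    dyadic lemma sums these bounds.\<close>
  define G where "G p = {\<omega>\<in>space M. 2 ^ p \<le> \<bar>S p \<omega> - expectation (S p)\<bar>}" for p
  define t where "t p = expectation (\<lambda>\<omega>. if W 0 \<omega> \<le> 2 ^ p then (W 0 \<omega>)\<^sup>2 else 0)" for p :: nat
  have tint: "integrable M (\<lambda>\<omega>. if W 0 \<omega> \<le> 2 ^ p then (W 0 \<omega>)\<^sup>2 else 0)" for p :: nat
    using nonneg by (intro integrable_const_bound[where B="(2^p)\<^sup>2"]) (auto intro!: power_mono)
  have PG: "prob (G p) \<le> (1/2) ^ p * t p" for p
  proof -
    have i2: "integrable M (\<lambda>\<omega>. (S p \<omega>)\<^sup>2)"
      and v: "variance (S p) \<le> (\<Sum>i<(2::nat)^p. expectation (\<lambda>\<omega>. (Y i \<omega>)\<^sup>2))"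
      using variance_sum_le[OF _ indep_vars_subset[OF Yind], of "{..<2^p}"] Y Yint unfolding S_def by auto
    have each: "expectation (\<lambda>\<omega>. (Y i \<omega>)\<^sup>2) \<le> t p" if "i < 2 ^ p" for i
    proof -
      have "expectation (\<lambda>\<omega>. (Y i \<omega>)\<^sup>2) = expectation (\<lambda>\<omega>. (if W i \<omega> \<le> real (Suc i) then W i \<omega> else 0)\<^sup>2)"
        by (simp add: Y_def)
      also have "\<dots> = expectation (\<lambda>\<omega>. (if W 0 \<omega> \<le> real (Suc i) then W 0 \<omega> else 0)\<^sup>2)"
        by (rule transfer) measurable
      also have "\<dots> \<le> t p" unfolding t_def
      proof (rule integral_mono')
        have "real (Suc i) \<le> 2 ^ p" using that by (metis Suc_leI of_nat_le_iff of_nat_numeral of_nat_power)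
        then show "(if W 0 \<omega> \<le> real (Suc i) then W 0 \<omega> else 0)\<^sup>2 \<le> (if W 0 \<omega> \<le> 2 ^ p then (W 0 \<omega>)\<^sup>2 else 0)" for \<omega>
          by auto
      qed (use tint in auto)
      finally show ?thesis .
    qed
    have "prob (G p) \<le> variance (S p) / (2 ^ p)\<^sup>2"
      unfolding G_def by (rule Chebyshev_inequality) (use i2 in auto)
    also have "\<dots> \<le> (\<Sum>i<(2::nat)^p. t p) / (2 ^ p)\<^sup>2"
      using v each by (intro divide_right_mono order_trans[OF v] sum_mono) auto
    also have "\<dots> = (1/2) ^ p * t p" by (simp add: power2_eq_square power_divide)
    finally show ?thesis .
  qed
  have bd2: "(\<Sum>p<N. prob (G p)) \<le> 2 * expectation (W 0)" for N
  proof -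
    have "(\<Sum>p<N. prob (G p)) \<le> (\<Sum>p<N. (1/2) ^ p * t p)" by (intro sum_mono PG)
    also have "\<dots> = expectation (\<lambda>\<omega>. \<Sum>p<N. (1/2) ^ p * (if W 0 \<omega> \<le> 2 ^ p then (W 0 \<omega>)\<^sup>2 else 0))"
      unfolding t_def using tint by (subst Bochner_Integration.integral_sum) auto
    also have "\<dots> \<le> expectation (\<lambda>\<omega>. 2 * W 0 \<omega>)"
      by (intro integral_mono' dyadic_truncated_sum_le nonneg) (use int nonneg in auto)
    finally show ?thesis by simp
  qed
  have "summable (\<lambda>p. prob (G p))"
    by (rule bounded_imp_summable[of _ "2 * expectation (W 0)"]) (use bd2[of "Suc _"] in \<open>auto simp: lessThan_Suc_atMost\<close>)
  then have ev2: "AE \<omega> in M. \<forall>\<^sub>F p in sequentially. \<omega> \<in> space M - G p"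
    by (intro borel_cantelli_AE1) (auto simp: emeasure_eq_measure G_def)
  show ?thesis using ev1 ev2
  proof eventually_elim
    case (elim \<omega>)
    from elim(1) obtain n0 where
      "\<forall>i\<ge>n0. \<omega> \<in> space M - {\<omega>\<in>space M. real (Suc i) < W i \<omega>}"
      unfolding eventually_sequentially by blast
    then have sp: "\<omega> \<in> space M" and n0: "W i \<omega> = Y i \<omega>" if "i \<ge> n0" for i
      using that by (auto simp: Y_def not_less)
    from elim(2) obtain p0 where "\<forall>p\<ge>p0. \<omega> \<in> space M - G p"
      unfolding eventually_sequentially by blast
    then have p0: "\<bar>S p \<omega> - expectation (S p)\<bar> < 2 ^ p" if "p \<ge> p0" for p
      using that by (auto simp: G_def not_le)
    define e where "e = expectation (W 0)"
    have e0: "0 \<le> e" unfolding e_def using nonneg by (simp add: Bochner_Integration.integral_nonneg)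
    have ES: "expectation (S p) \<le> e * 2 ^ p" for p
    proof -
      have "expectation (S p) = (\<Sum>i<(2::nat)^p. expectation (Y i))"
        unfolding S_def using Yint by (subst Bochner_Integration.integral_sum) auto
      also have "\<dots> \<le> (\<Sum>i<(2::nat)^p. e)" by (intro sum_mono) (simp add: Yexp e_def)
      finally show ?thesis by (simp add: mult.commute)
    qed
    \<comment> \<open>Only indices below \<open>n0\<close> can differ from their truncation;
      \<open>R\<close> pays for them.\<close>
    define R where "R = (\<Sum>i<n0. W i \<omega>)"
    have R0: "0 \<le> R" unfolding R_def using nonneg by (intro sum_nonneg) auto
    have WY: "(\<Sum>i<n. W i \<omega>) \<le> R + (\<Sum>i<n. Y i \<omega>)" for n
    proof -
      have "(\<Sum>i<n. W i \<omega>) - (\<Sum>i<n. Y i \<omega>) = (\<Sum>i<n. W i \<omega> - Y i \<omega>)" by (simp add: sum_subtractf)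
      also have "\<dots> = (\<Sum>i\<in>{..<n} \<inter> {..<n0}. W i \<omega> - Y i \<omega>)"
        using n0 by (intro sum.mono_neutral_right) (auto, meson not_le_imp_less)
      also have "\<dots> \<le> (\<Sum>i<n0. W i \<omega>)"
      proof (rule order_trans[OF sum_mono])
        show "\<And>i. i \<in> {..<n} \<inter> {..<n0} \<Longrightarrow> W i \<omega> - Y i \<omega> \<le> W i \<omega>" using Y by auto
        show "(\<Sum>i\<in>{..<n} \<inter> {..<n0}. W i \<omega>) \<le> (\<Sum>i<n0. W i \<omega>)" by (intro sum_mono2) (auto simp: nonneg)
      qed
      finally show ?thesis by (simp add: R_def)
    qed
    have SB: "S p \<omega> \<le> (e + 1) * 2 ^ p" if "p \<ge> p0" for p
      using p0[OF that] ES[of p] by (simp add: algebra_simps)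
    have bound: "(\<Sum>i<n. W i \<omega>) \<le> (R + (e + 1) * 2 ^ (p0 + 1)) * real n" if n: "n \<ge> 1" for n
    proof -
      obtain q where q: "2 ^ q \<le> n" "n < 2 ^ Suc q" using ex_power_ivl1[of 2 n] n by auto
      \<comment> \<open>A power of two above n, raised if necessary to the index from which the
        Chebyshev bound holds; the excess over n is at most the factor 2^(p0 + 1).\<close>
      define p where "p = max p0 (Suc q)"
      have "n \<le> 2 ^ p" using q(2) power_increasing[of "Suc q" p "2::nat"] by (simp add: p_def)
      then have "(\<Sum>i<n. Y i \<omega>) \<le> S p \<omega>" unfolding S_def using Y by (intro sum_mono2) auto
      also have "\<dots> \<le> (e + 1) * 2 ^ p" by (rule SB) (simp add: p_def)
      also have "\<dots> \<le> (e + 1) * (2 ^ (p0 + 1) * real n)"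
      proof (intro mult_left_mono)
        have "(2::real) ^ p \<le> 2 ^ (p0 + 1 + q)" unfolding p_def by (intro power_increasing) auto
        also have "\<dots> = 2 ^ (p0 + 1) * 2 ^ q" by (simp add: power_add)
        also have "\<dots> \<le> 2 ^ (p0 + 1) * real n"
          using q(1) by (intro mult_left_mono) (metis of_nat_le_iff of_nat_numeral of_nat_power, simp)
        finally show "(2::real) ^ p \<le> 2 ^ (p0 + 1) * real n" .
      qed (use e0 in auto)
      finally have "(\<Sum>i<n. W i \<omega>) \<le> R * 1 + (e + 1) * (2 ^ (p0 + 1) * real n)" using WY[of n] by simp
      also have "\<dots> \<le> R * real n + (e + 1) * (2 ^ (p0 + 1) * real n)"
        using n R0 by (intro add_right_mono mult_left_mono) auto
      finally show ?thesis by (simp add: algebra_simps)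
    qed
    show ?case
    proof (intro exI allI)
      show "(\<Sum>i<n. W i \<omega>) \<le> (R + (e + 1) * 2 ^ (p0 + 1)) * real n" for n
        using bound[of n] by (cases "n = 0") auto
    qed
  qed
qed

section \<open>Kernels of bounded variation\<close>

text \<open>Abel summation over the distinct values of u: a boundary term, at most
  \<open>G * e\<close>, and increments of g weighted by partial sums of c, at most
  \<open>B * e\<close>. The partial sums run over the indices with u i \<le> v, so only sums over
  intervals have to be controlled.\<close>

lemma weighted_sum_le_variation:
  fixes g :: "real \<Rightarrow> real" and c u :: "'i \<Rightarrow> real"
  assumes fin: "finite A"
    and u: "\<And>i. i \<in> A \<Longrightarrow> u i \<in> {-1..1}"
    and var: "\<And>x N. incseq x \<Longrightarrow> range x \<subseteq> {-1..1} \<Longrightarrow> (\<Sum>k<N. \<bar>g (x (Suc k)) - g (x k)\<bar>) \<le> B"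
    and bound: "\<And>v. v \<in> {-1..1} \<Longrightarrow> \<bar>g v\<bar> \<le> G"
    and partial: "\<And>v. v \<in> {-1..1} \<Longrightarrow> \<bar>\<Sum>i\<in>{i\<in>A. u i \<le> v}. c i\<bar> \<le> e"
  shows "\<bar>\<Sum>i\<in>A. c i * g (u i)\<bar> \<le> (G + B) * e"
proof (cases "A = {}")
  case True
  have "0 \<le> G" using order_trans[OF abs_ge_zero bound[of 0]] by simp
  moreover have "0 \<le> B" using var[of "\<lambda>_. 0" 0] by (simp add: incseq_const)
  moreover have "0 \<le> e" using order_trans[OF abs_ge_zero partial[of 0]] by simp
  ultimately show ?thesis using True by simp
next
  case False
  define xs where "xs = sorted_list_of_set (u ` A)"
  define N where "N = length xs - 1"
  \<comment> \<open>Continued constantly past the last value, because variation is measured along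
    infinite increasing sequences.\<close>
  define x where "x k = xs ! min k N" for k
  have setxs: "set xs = u ` A" and sorted: "sorted_wrt (<) xs"
    using fin by (auto simp: xs_def)
  have len: "length xs = Suc N"
    using False setxs by (cases xs) (auto simp: N_def)
  have inc: "incseq x"
    using sorted len by (auto simp: incseq_def x_def intro!: sorted_nth_mono strict_sorted_imp_sorted)
  have strict: "x j < x k" if "j < k" "k \<le> N" for j k
    using sorted len that by (auto simp: x_def sorted_wrt_iff_nth_less)
  have xA: "x k \<in> u ` A" for k using len setxs by (metis min.cobounded2 le_imp_less_Suc nth_mem x_def)
  have Ax: "\<exists>k\<le>N. u i = x k" if "i \<in> A" for i
    using that setxs len by (metis image_eqI in_set_conv_nth less_Suc_eq_le min.absorb1 x_def)
  have xr: "x k \<in> {-1..1}" for k using xA[of k] u by auto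
  define C where "C v = (\<Sum>i\<in>{i\<in>A. u i \<le> v}. c i)" for v
  have parts: "(\<Sum>i\<in>{i\<in>A. u i \<le> x k}. c i * g (u i))
      = C (x k) * g (x k) - (\<Sum>j<k. C (x j) * (g (x (Suc j)) - g (x j)))" if "k \<le> N" for k
    using that
  proof (induction k)
    case 0
    have "{i\<in>A. u i \<le> x 0} = {i\<in>A. u i = x 0}"
    proof -
      have "x 0 \<le> u i" if "i \<in> A" for i using Ax[OF that] inc by (auto simp: incseq_def)
      then show ?thesis by (auto intro: antisym)
    qed
    moreover have "(\<Sum>i\<in>{i\<in>A. u i = x 0}. c i * g (u i)) = (\<Sum>i\<in>{i\<in>A. u i = x 0}. c i) * g (x 0)"
      by (simp add: sum_distrib_right)
    ultimately show ?case by (simp add: C_def)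
  next
    case (Suc k)
    let ?E = "{i\<in>A. u i = x (Suc k)}" and ?L = "{i\<in>A. u i \<le> x k}"
    have split: "{i\<in>A. u i \<le> x (Suc k)} = ?L \<union> ?E"
    proof -
      have "u i \<le> x k" if "i \<in> A" "u i \<le> x (Suc k)" "u i \<noteq> x (Suc k)" for i
      proof -
        obtain j where j: "j \<le> N" "u i = x j" using Ax \<open>i \<in> A\<close> by blast
        have "j < Suc k"
        proof (rule ccontr)
          assume "\<not> j < Suc k"
          then have "x (Suc k) \<le> x j" using inc by (auto simp: incseq_def)
          then show False using j that by simp
        qed
        then show ?thesis using inc j by (auto simp: incseq_def)
      qed
      moreover have "x k \<le> x (Suc k)" using inc by (auto simp: incseq_def)
      ultimately show ?thesis by auto
    qed
    have disj: "?L \<inter> ?E = {}" using strict[of k "Suc k"] Suc.prems by auto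
    have "(\<Sum>i\<in>?L \<union> ?E. c i * g (u i)) = (\<Sum>i\<in>?L. c i * g (u i)) + (\<Sum>i\<in>?E. c i) * g (x (Suc k))"
      using fin disj by (subst sum.union_disjoint) (auto simp: sum_distrib_right)
    moreover have "(\<Sum>i\<in>?E. c i) = C (x (Suc k)) - C (x k)"
      unfolding C_def split using fin disj by (subst sum.union_disjoint) auto
    ultimately show ?case using Suc by (simp add: split algebra_simps)
  qed
  have all: "{i\<in>A. u i \<le> x N} = A" using Ax inc by (auto simp: incseq_def) metis
  have e: "\<bar>C (x k)\<bar> \<le> e" for k unfolding C_def by (rule partial[OF xr])
  have e0: "0 \<le> e" using e[of 0] by linarith
  have "(\<Sum>i\<in>A. c i * g (u i)) = C (x N) * g (x N) - (\<Sum>j<N. C (x j) * (g (x (Suc j)) - g (x j)))"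
    using parts[of N] all by simp
  also have "\<bar>\<dots>\<bar> \<le> \<bar>C (x N) * g (x N)\<bar> + (\<Sum>j<N. \<bar>C (x j) * (g (x (Suc j)) - g (x j))\<bar>)"
    by (rule order_trans[OF abs_triangle_ineq4]) (auto intro: sum_abs)
  also have "\<dots> \<le> e * G + (\<Sum>j<N. e * \<bar>g (x (Suc j)) - g (x j)\<bar>)"
    using e bound[OF xr] e0 by (auto intro!: add_mono sum_mono mult_mono simp: abs_mult mult_right_mono)
  also have "\<dots> \<le> e * G + e * B"
    using var[OF inc image_subsetI, of N] xr e0 by (simp flip: sum_distrib_left add: mult_left_mono)
  finally show ?thesis by (simp add: algebra_simps)
qed

lemma bounded_variation_imp_bounded:
  fixes g :: "real \<Rightarrow> real"
  assumes var: "\<And>x N. incseq x \<Longrightarrow> range x \<subseteq> {-1..1} \<Longrightarrow> (\<Sum>k<N. \<bar>g (x (Suc k)) - g (x k)\<bar>) \<le> B"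
    and v: "v \<in> {-1..1::real}"
  shows "\<bar>g v\<bar> \<le> \<bar>g (-1)\<bar> + B"
proof -
  define x where "x k = (if k = 0 then -1 else v)" for k :: nat
  have "incseq x" using v by (auto simp: x_def incseq_def)
  moreover have "range x \<subseteq> {-1..1}" using v by (auto simp: x_def)
  ultimately have "\<bar>g v - g (-1)\<bar> \<le> B"
    using var[of x 1] by (simp add: x_def)
  then show ?thesis by linarith
qed

text \<open>The numerator of the fit carries the weights K(u) and K(u) * u. The product rule for
  increments adds to the variation of g its bound times 2, the variation of the identity on
  [-1, 1].\<close>

lemma variation_times_id:
  fixes g :: "real \<Rightarrow> real"
  assumes var: "\<And>x N. incseq x \<Longrightarrow> range x \<subseteq> {-1..1} \<Longrightarrow> (\<Sum>k<N. \<bar>g (x (Suc k)) - g (x k)\<bar>) \<le> B"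
    and bound: "\<And>v. v \<in> {-1..1::real} \<Longrightarrow> \<bar>g v\<bar> \<le> G"
    and x: "incseq x" "range x \<subseteq> {-1..1}"
  shows "(\<Sum>k<N. \<bar>g (x (Suc k)) * x (Suc k) - g (x k) * x k\<bar>) \<le> B + 2 * G"
proof -
  have xr: "x k \<in> {-1..1}" for k by (rule range_subsetD[OF x(2)])
  have G0: "0 \<le> G" using bound[OF xr[of 0]] by linarith
  have "(\<Sum>k<N. \<bar>g (x (Suc k)) * x (Suc k) - g (x k) * x k\<bar>)
      \<le> (\<Sum>k<N. \<bar>g (x (Suc k)) - g (x k)\<bar> + G * (x (Suc k) - x k))"
  proof (intro sum_mono)
    fix k
    have m: "x k \<le> x (Suc k)" using x(1) by (auto simp: incseq_def)
    have "g (x (Suc k)) * x (Suc k) - g (x k) * x k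
        = (g (x (Suc k)) - g (x k)) * x (Suc k) + g (x k) * (x (Suc k) - x k)"
      by (simp add: algebra_simps)
    also have "\<bar>\<dots>\<bar> \<le> \<bar>g (x (Suc k)) - g (x k)\<bar> * \<bar>x (Suc k)\<bar> + \<bar>g (x k)\<bar> * \<bar>x (Suc k) - x k\<bar>"
      by (rule order_trans[OF abs_triangle_ineq]) (simp add: abs_mult)
    also have "\<dots> \<le> \<bar>g (x (Suc k)) - g (x k)\<bar> * 1 + G * (x (Suc k) - x k)"
      using xr[of "Suc k"] m bound[OF xr[of k]] by (intro add_mono mult_left_mono mult_mono) auto
    finally show "\<bar>g (x (Suc k)) * x (Suc k) - g (x k) * x k\<bar>
        \<le> \<bar>g (x (Suc k)) - g (x k)\<bar> + G * (x (Suc k) - x k)" by simp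
  qed
  also have "\<dots> = (\<Sum>k<N. \<bar>g (x (Suc k)) - g (x k)\<bar>) + G * (x N - x 0)"
    by (simp add: sum.distrib sum_lessThan_telescope flip: sum_distrib_left)
  also have "\<dots> \<le> B + G * 2"
    using var[OF x] xr[of N] xr[of 0] G0 by (intro add_mono mult_left_mono) auto
  finally show ?thesis by simp
qed

text \<open>If K dips below every level c on every subinterval of [0, 1], then either it vanishes
  almost everywhere or it oscillates by c too often for its variation. The interval is sought in
  [0, 1] so that it and its mirror image serve the left and the right half of [a, b].\<close>

lemma kernel_bounded_below_on_interval:
  assumes C2: "condition_C2 K"
  shows "\<exists>p q c. 0 \<le> p \<and> p < q \<and> q \<le> 1 \<and> 0 < c \<and> (\<forall>u\<in>{p..q}. c \<le> K u)"
proof (rule ccontr)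
  assume none: "\<not> ?thesis"
  have low: "\<exists>u. p \<le> u \<and> u \<le> q \<and> K u < c" if "0 \<le> p" "p < q" "q \<le> 1" "0 < c" for p q c
    using none that by (meson atLeastAtMost_iff not_le)
  have K0: "\<And>x. 0 \<le> K x" and supp: "\<And>x. x \<notin> {-1..1} \<Longrightarrow> K x = 0" and sym: "\<And>x. K (- x) = K x"
    and int1: "(\<integral>\<^sup>+x. ennreal (K x) \<partial>lborel) = 1" and bv: "bounded_variation_on K (-1) 1"
    using C2 by (auto simp: condition_C2_def)
  obtain B where B: "\<And>x N. incseq x \<Longrightarrow> range x \<subseteq> {-1..1} \<Longrightarrow> (\<Sum>k<N. \<bar>K (x (Suc k)) - K (x k)\<bar>) \<le> B"
    using bv unfolding bounded_variation_on_def by blast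
  \<comment> \<open>Otherwise every superlevel set in (0, 1) is finite, and by symmetry K vanishes
    outside a countable set, against its unit integral.\<close>
  have "\<exists>c>0. infinite {x\<in>{0<..<1}. 2 * c < K x}"
  proof (rule ccontr)
    assume "\<not> ?thesis"
    then have fin: "finite {x\<in>{0<..<1}. 2 * c < K x}" if "0 < c" for c using that by blast
    define P where "P = (\<Union>n. {x\<in>{0<..<1}. 2 * (1 / real (Suc n)) < K x})"
    have "countable P" unfolding P_def by (rule countable_UN, simp) (rule countable_finite, rule fin, simp)
    moreover have "{x. K x \<noteq> 0} \<subseteq> P \<union> uminus ` P \<union> {-1, 0, 1}"
    proof
      fix x assume "x \<in> {x. K x \<noteq> 0}"
      then have "K x \<noteq> 0" by simp
      have x: "0 < K x" using K0[of x] \<open>K x \<noteq> 0\<close> by linarith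
      have x': "x \<in> {-1..1}" using supp[of x] \<open>K x \<noteq> 0\<close> by blast
      have pos: "y \<in> P" if y: "0 < K y" "y \<in> {0<..<1}" for y
      proof -
        obtain n where "inverse (real (Suc n)) < K y / 2" using reals_Archimedean[of "K y / 2"] y by auto
        then show ?thesis using y unfolding P_def by (auto simp: inverse_eq_divide)
      qed
      show "x \<in> P \<union> uminus ` P \<union> {-1, 0, 1}"
      proof (cases "x \<in> {-1, 0, 1}")
        case False
        then consider "x \<in> {0<..<1}" | "- x \<in> {0<..<1}" using x' by force
        then show ?thesis
        proof cases
          case 2
          then have "- x \<in> P" using pos[of "- x"] x sym by simp
          then have "x \<in> uminus ` P" by force
          then show ?thesis by blast
        qed (use pos x in blast)
      qed blast
    qed
    ultimately have "countable {x. K x \<noteq> 0}"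
      by (meson countable_Un countable_finite countable_image countable_subset finite.intros)
    then have "{x. K x \<noteq> 0} \<in> null_sets lborel" by (rule countable_imp_null_set_lborel)
    then have "AE x in lborel. K x = 0" by (auto dest: AE_not_in)
    then have "(\<integral>\<^sup>+x. ennreal (K x) \<partial>lborel) = (\<integral>\<^sup>+(x::real). 0 \<partial>lborel)"
      by (intro nn_integral_cong_AE) auto
    then show False using int1 by simp
  qed
  then obtain c where c: "0 < c" and inf: "infinite {x\<in>{0<..<1}. 2 * c < K x}" by blast
  \<comment> \<open>More than B / c drops of height c exceed the variation bound B.\<close>
  define N where "N = nat \<lceil>B / c\<rceil> + 1"
  obtain F where F: "F \<subseteq> {x\<in>{0<..<1}. 2 * c < K x}" "finite F" "card F = Suc N"
    using infinite_arbitrarily_large[OF inf, of "Suc N"] by blast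
  define xs where "xs = sorted_list_of_set F"
  have xs: "set xs = F" "length xs = Suc N" "sorted_wrt (<) xs" using F by (auto simp: xs_def)
  have xsF: "0 < xs ! min k N \<and> xs ! min k N < 1 \<and> 2 * c < K (xs ! min k N)" for k
  proof -
    have "xs ! min k N \<in> F" using xs by (metis le_imp_less_Suc min.cobounded2 nth_mem)
    then show ?thesis using F(1) by auto
  qed
  have "\<exists>y. xs ! k \<le> y \<and> y \<le> xs ! (Suc k) \<and> K y < c" if "k < N" for k
  proof (rule low)
    show "xs ! k < xs ! Suc k" using xs that by (simp add: sorted_wrt_iff_nth_less)
    show "0 \<le> xs ! k" "xs ! Suc k \<le> 1"
      using xsF[of k] xsF[of "Suc k"] that by (auto simp: min_def)
  qed fact
  then obtain y where y: "\<And>k. k < N \<Longrightarrow> xs ! k \<le> y k \<and> y k \<le> xs ! (Suc k) \<and> K (y k) < c" by metis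
  \<comment> \<open>Even indices visit the points with K > 2 * c, odd indices the low points between
    consecutive ones; from index 2 * N on the sequence rests at the last high point.\<close>
  define x where "x k = (if even k \<or> N \<le> k div 2 then xs ! min (k div 2) N else y (k div 2))" for k
  have inc: "incseq x"
  proof (rule incseq_SucI)
    fix k show "x k \<le> x (Suc k)"
    proof (cases "even k")
      case True
      then obtain j where "k = 2 * j" by blast
      then show ?thesis using y[of j] by (auto simp: x_def)
    next
      case False
      then obtain j where "k = 2 * j + 1" by (rule oddE)
      then show ?thesis using y[of j] by (auto simp: x_def min_def not_le)
    qed
  qed
  have "x k \<in> {0..1}" for k
  proof (cases "even k \<or> N \<le> k div 2")
    case True
    then show ?thesis using xsF[of "k div 2"] by (auto simp: x_def)
  next
    case False
    then show ?thesis using y[of "k div 2"] xsF[of "k div 2"] xsF[of "Suc (k div 2)"]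
      by (auto simp: x_def min_def not_le)
  qed
  then have "- 1 \<le> x k \<and> x k \<le> 1" for k by (meson atLeastAtMost_iff order_trans neg_le_0_iff_le zero_le_one)
  then have "range x \<subseteq> {-1..1}" by auto
  then have "(\<Sum>k<2 * N. \<bar>K (x (Suc k)) - K (x k)\<bar>) \<le> B" by (rule B[OF inc])
  moreover have "real j * c \<le> (\<Sum>k<2 * j. \<bar>K (x (Suc k)) - K (x k)\<bar>)" if "j \<le> N" for j
    using that
  proof (induction j)
    case (Suc j)
    have "K (x (Suc (2 * j))) < c" using y[of j] Suc.prems by (simp add: x_def)
    moreover have "2 * c < K (x (2 * j))" using xsF[of j] by (simp add: x_def)
    ultimately have "c \<le> \<bar>K (x (Suc (2 * j))) - K (x (2 * j))\<bar>" by linarith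
    then show ?case using Suc by (simp add: algebra_simps)
  qed simp
  ultimately have "real N * c \<le> B" by (meson order_refl order_trans)
  moreover have "B / c < real N" unfolding N_def by linarith
  ultimately show False using c by (simp add: field_simps)
qed

section \<open>The local linear fit\<close>

text \<open>Since \<open>arg_min\<close> is a choice, all minimizers must be shown to share their
  first coordinate. Completing the square at the solution of the normal equations leaves a quadratic
  form in the displacement, and the positive determinant makes it definite.\<close>

lemma weighted_least_squares_minimizer:
  fixes w y u :: "'i \<Rightarrow> real"
  assumes w: "\<And>i. i \<in> I \<Longrightarrow> 0 \<le> w i" and h: "h \<noteq> 0"
    and s: "s0 = (\<Sum>i\<in>I. w i)" "s1 = (\<Sum>i\<in>I. w i * u i)" "s2 = (\<Sum>i\<in>I. w i * (u i)\<^sup>2)"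
    and r: "r0 = (\<Sum>i\<in>I. w i * y i)" "r1 = (\<Sum>i\<in>I. w i * u i * y i)"
    and D: "0 < s0 * s2 - s1\<^sup>2"
  shows "fst (arg_min (\<lambda>(a0, a1). \<Sum>i\<in>I. w i * (y i - a0 - a1 * (h * u i))\<^sup>2) (\<lambda>_. True))
          = (r0 * s2 - r1 * s1) / (s0 * s2 - s1\<^sup>2)"
proof -
  define f where "f = (\<lambda>(a0, a1). \<Sum>i\<in>I. w i * (y i - a0 - a1 * (h * u i))\<^sup>2)"
  define \<Delta> where "\<Delta> = s0 * s2 - s1\<^sup>2"
  define b0 where "b0 = (r0 * s2 - r1 * s1) / \<Delta>"
  define b1 where "b1 = (r1 * s0 - r0 * s1) / \<Delta>"
  have \<Delta>: "0 < \<Delta>" using D by (simp add: \<Delta>_def)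
  have n0: "r0 = b0 * s0 + b1 * s1" and n1: "r1 = b0 * s1 + b1 * s2"
    using \<Delta> unfolding b0_def b1_def
    by (simp_all add: field_simps) (simp_all add: \<Delta>_def power2_eq_square algebra_simps)
  have expand: "f (a0, a1) = f (b0, b1 / h) + (\<Sum>i\<in>I. w i * ((a0 - b0) + (a1 * h - b1) * u i)\<^sup>2)" for a0 a1
  proof -
    define c0 where "c0 = a0 - b0"
    define c1 where "c1 = a1 * h - b1"
    have "f (a0, a1) = (\<Sum>i\<in>I. w i * (y i - b0 - b1 * u i)\<^sup>2 + w i * (c0 + c1 * u i)\<^sup>2
        - 2 * (c0 * (w i * y i) + c1 * (w i * u i * y i) - b0 * c0 * w i - (b0 * c1 + b1 * c0) * (w i * u i)
               - b1 * c1 * (w i * (u i)\<^sup>2)))"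
      unfolding f_def c0_def c1_def by (auto intro!: sum.cong simp: power2_eq_square algebra_simps)
    also have "\<dots> = (\<Sum>i\<in>I. w i * (y i - b0 - b1 * u i)\<^sup>2) + (\<Sum>i\<in>I. w i * (c0 + c1 * u i)\<^sup>2)
        - 2 * (c0 * r0 + c1 * r1 - b0 * c0 * s0 - (b0 * c1 + b1 * c0) * s1 - b1 * c1 * s2)"
      by (simp add: sum.distrib sum_subtractf s r flip: sum_distrib_left)
    \<comment> \<open>The cross term vanishes by the normal equations.\<close>
    also have "c0 * r0 + c1 * r1 - b0 * c0 * s0 - (b0 * c1 + b1 * c0) * s1 - b1 * c1 * s2 = 0"
      unfolding n0 n1 by (simp add: algebra_simps)
    finally show ?thesis using h by (simp add: f_def c0_def c1_def)
  qed
  have min: "f (b0, b1 / h) \<le> f p" for p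
    using expand[of "fst p" "snd p"] w by (simp add: sum_nonneg)
  have "is_arg_min f (\<lambda>_. True) (b0, b1 / h)" using min by (auto simp: is_arg_min_def not_less)
  then have am: "is_arg_min f (\<lambda>_. True) (arg_min f (\<lambda>_. True))" unfolding arg_min_def by (rule someI)
  obtain q0 q1 where q: "arg_min f (\<lambda>_. True) = (q0, q1)" by fastforce
  define c0 where "c0 = q0 - b0"
  define c1 where "c1 = q1 * h - b1"
  have "f (q0, q1) \<le> f (b0, b1 / h)" using am by (auto simp: is_arg_min_def q not_less)
  then have "(\<Sum>i\<in>I. w i * (c0 + c1 * u i)\<^sup>2) \<le> 0" using expand[of q0 q1] by (simp add: c0_def c1_def)
  moreover have "(\<Sum>i\<in>I. w i * (c0 + c1 * u i)\<^sup>2) = (\<Sum>i\<in>I. c0\<^sup>2 * w i + 2 * c0 * c1 * (w i * u i) + c1\<^sup>2 * (w i * (u i)\<^sup>2))"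
    by (auto intro!: sum.cong simp: power2_eq_square algebra_simps)
  ultimately have quad: "c0\<^sup>2 * s0 + 2 * c0 * c1 * s1 + c1\<^sup>2 * s2 \<le> 0"
    by (simp add: sum.distrib s flip: sum_distrib_left)
  have s2: "0 \<le> s2" unfolding s using w by (intro sum_nonneg) auto
  \<comment> \<open>Multiplication by \<open>s2\<close> completes the square without a division and
    isolates \<open>c0\<close>.\<close>
  have "s2 * (c0\<^sup>2 * s0 + 2 * c0 * c1 * s1 + c1\<^sup>2 * s2) = (c1 * s2 + c0 * s1)\<^sup>2 + c0\<^sup>2 * \<Delta>"
    by (simp add: \<Delta>_def power2_eq_square algebra_simps)
  then have "c0\<^sup>2 * \<Delta> \<le> 0"
    using mult_nonneg_nonpos[OF s2 quad] zero_le_power2[of "c1 * s2 + c0 * s1"] by linarith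
  then have "c0 = 0" using \<Delta> by (simp add: mult_le_0_iff not_le)
  then show ?thesis using q by (simp add: f_def c0_def b0_def \<Delta>_def)
qed

text \<open>Lagrange's identity: twice the determinant is the sum of w i * w j * (u i - u j)^2 over
  all ordered pairs. The pairs between two separated groups alone give the bound.\<close>

lemma weighted_moment_determinant_lower_bound:
  fixes w u :: "'i \<Rightarrow> real"
  assumes fin: "finite I" and w: "\<And>i. i \<in> I \<Longrightarrow> 0 \<le> w i"
    and sub: "A \<subseteq> I" "B \<subseteq> I" and gap: "\<And>i j. i \<in> A \<Longrightarrow> j \<in> B \<Longrightarrow> d \<le> \<bar>u i - u j\<bar>" and d: "0 < d"
  shows "d\<^sup>2 * (\<Sum>i\<in>A. w i) * (\<Sum>i\<in>B. w i)
          \<le> (\<Sum>i\<in>I. w i) * (\<Sum>i\<in>I. w i * (u i)\<^sup>2) - (\<Sum>i\<in>I. w i * u i)\<^sup>2"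
proof -
  have AB: "A \<inter> B = {}" using gap d by fastforce
  have S: "(\<Sum>i\<in>I. \<Sum>j\<in>I. w i * (w j * (u j)\<^sup>2) + w i * (u i)\<^sup>2 * w j - 2 * ((w i * u i) * (w j * u j)))
      = 2 * ((\<Sum>i\<in>I. w i) * (\<Sum>i\<in>I. w i * (u i)\<^sup>2) - (\<Sum>i\<in>I. w i * u i)\<^sup>2)"
  proof -
    define S0 where "S0 = (\<Sum>i\<in>I. w i)"
    define S1 where "S1 = (\<Sum>i\<in>I. w i * u i)"
    define S2 where "S2 = (\<Sum>i\<in>I. w i * (u i)\<^sup>2)"
    have "(\<Sum>i\<in>I. \<Sum>j\<in>I. w i * (w j * (u j)\<^sup>2) + w i * (u i)\<^sup>2 * w j - 2 * ((w i * u i) * (w j * u j)))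
        = S0 * S2 + S2 * S0 - 2 * (S1 * S1)"
      unfolding S0_def S1_def S2_def by (simp only: sum.distrib sum_subtractf sum_product) (simp only: sum_distrib_left)
    also have "\<dots> = 2 * (S0 * S2 - S1\<^sup>2)" by (simp add: power2_eq_square)
    finally show ?thesis by (simp only: S0_def S1_def S2_def)
  qed
  let ?q = "\<lambda>(i, j). w i * w j * (u i - u j)\<^sup>2"
  have q0: "0 \<le> ?q ij" if "ij \<in> I \<times> I" for ij using w that by auto
  have half: "d\<^sup>2 * (\<Sum>i\<in>A. w i) * (\<Sum>i\<in>B. w i) \<le> (\<Sum>ij\<in>P \<times> Q. ?q ij)"
    if "(P, Q) = (A, B) \<or> (P, Q) = (B, A)" for P Q
  proof -
    have PQ: "P \<subseteq> I" "Q \<subseteq> I" using that sub by auto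
    have PQgap: "d \<le> \<bar>u i - u j\<bar>" if "i \<in> P" "j \<in> Q" for i j
      using \<open>(P, Q) = (A, B) \<or> (P, Q) = (B, A)\<close> that gap[of i j] gap[of j i]
      by (auto simp: abs_minus_commute)
    have "d\<^sup>2 * (\<Sum>i\<in>A. w i) * (\<Sum>i\<in>B. w i) = d\<^sup>2 * ((\<Sum>i\<in>P. w i) * (\<Sum>i\<in>Q. w i))" using that by auto
    also have "\<dots> = d\<^sup>2 * (\<Sum>(i, j)\<in>P \<times> Q. w i * w j)"
      by (simp only: sum_product sum.cartesian_product)
    also have "\<dots> = (\<Sum>(i, j)\<in>P \<times> Q. d\<^sup>2 * (w i * w j))"
      by (simp add: sum_distrib_left case_prod_unfold)
    also have "\<dots> \<le> (\<Sum>ij\<in>P \<times> Q. ?q ij)"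
    proof (rule sum_mono, clarsimp)
      fix i j assume ij: "i \<in> P" "j \<in> Q"
      have "d\<^sup>2 \<le> (u i - u j)\<^sup>2" using PQgap[OF ij] d by (metis abs_ge_zero less_imp_le power2_abs power_mono)
      moreover have "0 \<le> w i * w j" using PQ ij w by (intro mult_nonneg_nonneg) auto
      ultimately show "d\<^sup>2 * (w i * w j) \<le> w i * w j * (u i - u j)\<^sup>2"
        by (metis mult.commute mult_left_mono)
    qed
    finally show ?thesis .
  qed
  have "2 * (d\<^sup>2 * (\<Sum>i\<in>A. w i) * (\<Sum>i\<in>B. w i)) \<le> (\<Sum>ij\<in>A \<times> B. ?q ij) + (\<Sum>ij\<in>B \<times> A. ?q ij)"
    using half[of A B] half[of B A] by simp
  also have "\<dots> = (\<Sum>ij\<in>A \<times> B \<union> B \<times> A. ?q ij)"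
    using fin sub AB by (subst sum.union_disjoint) (auto intro: finite_subset)
  also have "\<dots> \<le> (\<Sum>ij\<in>I \<times> I. ?q ij)"
    using fin sub q0 by (intro sum_mono2) auto
  also have "\<dots> = (\<Sum>i\<in>I. \<Sum>j\<in>I. w i * (w j * (u j)\<^sup>2) + w i * (u i)\<^sup>2 * w j - 2 * ((w i * u i) * (w j * u j)))"
    unfolding sum.cartesian_product[symmetric] by (intro sum.cong) (auto simp: power2_eq_square algebra_simps)
  also have "\<dots> = 2 * ((\<Sum>i\<in>I. w i) * (\<Sum>i\<in>I. w i * (u i)\<^sup>2) - (\<Sum>i\<in>I. w i * u i)\<^sup>2)"
    by (simp only: S)
  finally show ?thesis by simp
qed

text \<open>The second derivative is bounded but possibly discontinuous, so the mean value
  inequality is used twice: for the first derivative, and for \<mu> minus its linear part at t on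
  the segment from t to x. The remainder constant is twice the classical one.\<close>

lemma condition_C3_taylor:
  assumes ab: "a < b" and C3: "condition_C3 a b \<mu>"
  shows "\<exists>\<mu>' C. 0 \<le> C \<and> (\<forall>t\<in>{a..b}. \<forall>x\<in>{a..b}. \<bar>\<mu> x - \<mu> t - \<mu>' t * (x - t)\<bar> \<le> C * (x - t)\<^sup>2)"
    and "continuous_on {a..b} \<mu>"
proof -
  obtain \<mu>' \<mu>'' where d1: "\<And>t. t \<in> {a..b} \<Longrightarrow> (\<mu> has_real_derivative \<mu>' t) (at t within {a..b})"
    and d2: "\<And>t. t \<in> {a..b} \<Longrightarrow> (\<mu>' has_real_derivative \<mu>'' t) (at t within {a..b})"
    and bd: "bounded (\<mu>'' ` {a..b})"
    using C3 unfolding condition_C3_def by blast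
  obtain C where C: "0 < C" "\<And>t. t \<in> {a..b} \<Longrightarrow> norm (\<mu>'' t) \<le> C"
    using bd unfolding bounded_pos by auto
  show "continuous_on {a..b} \<mu>" using d1 by (rule DERIV_continuous_on)
  have lip: "\<bar>\<mu>' x - \<mu>' t\<bar> \<le> C * \<bar>x - t\<bar>" if "x \<in> {a..b}" "t \<in> {a..b}" for x t
    using field_differentiable_bound[of "{a..b}" \<mu>' \<mu>'' C x t] d2 C that by auto
  have "\<bar>\<mu> x - \<mu> t - \<mu>' t * (x - t)\<bar> \<le> C * (x - t)\<^sup>2" if xt: "t \<in> {a..b}" "x \<in> {a..b}" for x t
  proof -
    define J where "J = closed_segment t x"
    have J: "J \<subseteq> {a..b}" unfolding J_def using xt by (simp add: closed_segment_subset)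
    define g where "g y = \<mu> y - \<mu>' t * (y - t)" for y
    have "(g has_real_derivative \<mu>' y - \<mu>' t) (at y within J)" if "y \<in> J" for y
      unfolding g_def using DERIV_subset[OF d1 J] that J by (auto intro!: derivative_eq_intros)
    moreover have "norm (\<mu>' y - \<mu>' t) \<le> C * \<bar>x - t\<bar>" if y: "y \<in> J" for y
    proof -
      have "\<bar>y - t\<bar> \<le> \<bar>x - t\<bar>" using y by (auto simp: J_def closed_segment_eq_real_ivl split: if_splits)
      then have "C * \<bar>y - t\<bar> \<le> C * \<bar>x - t\<bar>" using C by simp
      then show ?thesis using lip[of y t] y J xt by (auto simp: subset_iff)
    qed
    ultimately have "norm (g x - g t) \<le> (C * \<bar>x - t\<bar>) * norm (x - t)"
      by (intro field_differentiable_bound[of J g]) (auto simp: J_def)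
    then show ?thesis by (simp add: g_def power2_eq_square mult.assoc algebra_simps flip: abs_mult)
  qed
  then show "\<exists>\<mu>' C. 0 \<le> C \<and> (\<forall>t\<in>{a..b}. \<forall>x\<in>{a..b}. \<bar>\<mu> x - \<mu> t - \<mu>' t * (x - t)\<bar> \<le> C * (x - t)\<^sup>2)"
    using C(1) by (intro exI[of _ \<mu>'] exI[of _ C]) auto
qed

lemma sum_indicator_restrict:
  fixes f :: "'i \<Rightarrow> real"
  assumes "finite I"
  shows "(\<Sum>k\<in>I. f k * indicator A (x k)) = (\<Sum>k\<in>{k\<in>I. x k \<in> A}. f k)"
  unfolding sum.inter_filter[OF assms] by (rule sum.cong) (auto simp: indicator_def)

text \<open>The deterministic half of the argument. The fit reproduces affine functions exactly, so
  only the residual from the tangent line enters, split into a bias of size R and the noise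
  \<epsilon>. The kernel weights turn N into N / h. The length d is a third of the interval on which
  K is at least c: its two outer thirds provide the separated groups for the determinant.\<close>

lemma local_linear_error_bound:
  fixes \<rho> \<tau> y \<epsilon> :: "'i \<Rightarrow> real" and K :: "real \<Rightarrow> real"
  assumes fin: "finite I" and \<rho>: "\<And>k. k \<in> I \<Longrightarrow> 0 \<le> \<rho> k" and \<tau>: "\<And>k. k \<in> I \<Longrightarrow> \<tau> k \<in> {a..b}"
    and h: "0 < h" "2 * h \<le> b - a" and t: "t \<in> {a..b}"
    and K0: "\<And>x. 0 \<le> K x" and Ksupp: "\<And>x. x \<notin> {-1..1} \<Longrightarrow> K x = 0" and Ksym: "\<And>x. K (- x) = K x"
    and var: "\<And>x N. incseq x \<Longrightarrow> range x \<subseteq> {-1..1} \<Longrightarrow> (\<Sum>k<N. \<bar>K (x (Suc k)) - K (x k)\<bar>) \<le> B"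
    and KG: "\<And>v. v \<in> {-1..1} \<Longrightarrow> \<bar>K v\<bar> \<le> G"
    and bump: "0 \<le> p" "q \<le> 1" "p + 3 * d = q" "0 < d" "0 < c" "\<And>u. u \<in> {p..q} \<Longrightarrow> c \<le> K u"
    and pos: "0 < mT" "0 < MT"
    and mass: "\<And>x z. a \<le> x \<Longrightarrow> x \<le> z \<Longrightarrow> z \<le> b \<Longrightarrow> z - x \<le> 2 * h \<Longrightarrow>
        mT * (z - x) - \<delta> \<le> (\<Sum>k\<in>I. \<rho> k * indicator {x..z} (\<tau> k)) \<and>
        (\<Sum>k\<in>I. \<rho> k * indicator {x..z} (\<tau> k)) \<le> MT * (z - x) + \<delta>"
    and \<delta>: "\<delta> \<le> h" "\<delta> \<le> mT * d / 2 * h"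
    and noise: "\<And>x z. a \<le> x \<Longrightarrow> x \<le> z \<Longrightarrow> z \<le> b \<Longrightarrow> z - x \<le> 2 * h \<Longrightarrow>
        \<bar>\<Sum>k\<in>I. \<rho> k * \<epsilon> k * indicator {x..z} (\<tau> k)\<bar> \<le> N"
    and y: "\<And>k. k \<in> I \<Longrightarrow> \<bar>\<tau> k - t\<bar> \<le> h \<Longrightarrow> \<bar>y k - (\<mu>0 + \<mu>1 * (\<tau> k - t)) - \<epsilon> k\<bar> \<le> R"
    and N: "0 \<le> N" and R: "0 \<le> R"
  defines "C \<equiv> 2 * (G * (2 * MT + 1)) * (G * (2 * MT + 1) + 3 * G + B) / (d\<^sup>2 * (c * mT * d / 2)\<^sup>2)"
  shows "\<bar>fst (arg_min (\<lambda>(a0, a1). \<Sum>k\<in>I. \<rho> k * ((1 / h) * K ((\<tau> k - t) / h)) * (y k - a0 - a1 * (\<tau> k - t))\<^sup>2) (\<lambda>_. True)) - \<mu>0\<bar>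
          \<le> C * (R + N / h)"
proof -
  define u where "u k = (\<tau> k - t) / h" for k
  define w where "w k = \<rho> k * ((1 / h) * K (u k))" for k
  have hu: "\<tau> k - t = h * u k" for k using h by (simp add: u_def)
  have G0: "0 \<le> G" using order_trans[OF abs_ge_zero KG[of 0]] by simp
  have B0: "0 \<le> B" using var[of "\<lambda>_. 0" 0] by (simp add: incseq_const)
  have w0: "0 \<le> w k" if "k \<in> I" for k using \<rho>[OF that] K0 h by (simp add: w_def)
  define J where "J = {k\<in>I. u k \<in> {-1..1}}"
  have J: "J \<subseteq> I" "finite J" using fin by (auto simp: J_def)
  have wJ: "w k = 0" if "k \<notin> J" "k \<in> I" for k using that Ksupp[of "u k"] by (auto simp: J_def w_def)
  have u1: "\<bar>u k\<bar> \<le> 1" if "k \<in> J" for k using that by (auto simp: J_def)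
  have u_iff: "u k \<in> {\<alpha>..\<gamma>} \<longleftrightarrow> \<tau> k \<in> {t + h * \<alpha>..t + h * \<gamma>}" for k \<alpha> \<gamma>
    using h by (auto simp: u_def field_simps)
  define s0 where "s0 = (\<Sum>k\<in>I. w k)"
  define s1 where "s1 = (\<Sum>k\<in>I. w k * u k)"
  define s2 where "s2 = (\<Sum>k\<in>I. w k * (u k)\<^sup>2)"
  have sJ: "(\<Sum>k\<in>I. w k * f k) = (\<Sum>k\<in>J. w k * f k)" for f
    by (rule sum.mono_neutral_right) (use J fin wJ in auto)
  \<comment> \<open>A window of length 2 * h has mass at most \<open>(2 * MT + 1) * h\<close>, as
    \<delta> \<le> h, and a weight is at most G / h times its mass. The bound covers all three
    moments because |u| \<le> 1 in the window.\<close>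
  define Sb where "Sb = G * (2 * MT + 1)"
  have Sb0: "0 \<le> Sb" using G0 pos by (simp add: Sb_def)
  have s0_le: "s0 \<le> Sb"
  proof -
    have len: "min b (t + h) - max a (t - h) \<le> 2 * h" by linarith
    have ord: "max a (t - h) \<le> min b (t + h)" using t h by auto
    have "(\<Sum>k\<in>J. \<rho> k) = (\<Sum>k\<in>{k\<in>I. \<tau> k \<in> {max a (t - h)..min b (t + h)}}. \<rho> k)"
      by (rule sum.cong) (use u_iff[of _ "-1" 1] \<tau> in \<open>auto simp: J_def\<close>)
    also have "\<dots> \<le> MT * (min b (t + h) - max a (t - h)) + \<delta>"
      using mass[OF _ ord _ len] fin by (simp add: sum_indicator_restrict)
    also have "\<dots> \<le> MT * (2 * h) + h" using len pos \<delta> by (intro add_mono mult_left_mono) auto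
    finally have J\<rho>: "(\<Sum>k\<in>J. \<rho> k) \<le> (2 * MT + 1) * h" by (simp add: algebra_simps)
    have "s0 = (\<Sum>k\<in>J. w k)" using sJ[of "\<lambda>_. 1"] by (simp add: s0_def)
    also have "\<dots> \<le> (\<Sum>k\<in>J. \<rho> k * ((1 / h) * G))"
      unfolding w_def using KG \<rho> h by (intro sum_mono mult_left_mono) (auto simp: J_def abs_le_iff)
    also have "\<dots> = (\<Sum>k\<in>J. \<rho> k) * ((1 / h) * G)" by (simp only: sum_distrib_right)
    also have "\<dots> \<le> ((2 * MT + 1) * h) * ((1 / h) * G)" using G0 h J\<rho> by (intro mult_right_mono) auto
    also have "\<dots> = Sb" using h by (simp add: Sb_def)
    finally show ?thesis .
  qed
  have s1_le: "\<bar>s1\<bar> \<le> Sb"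
  proof -
    have "\<bar>s1\<bar> \<le> (\<Sum>k\<in>J. \<bar>w k * u k\<bar>)" unfolding s1_def sJ by (rule sum_abs)
    also have "\<dots> \<le> (\<Sum>k\<in>J. w k * 1)"
      unfolding abs_mult using w0 u1 J by (intro sum_mono mult_mono) auto
    also have "\<dots> = s0" unfolding s0_def using sJ[of "\<lambda>_. 1"] by simp
    finally show ?thesis using s0_le by simp
  qed
  have s2_le: "\<bar>s2\<bar> \<le> Sb"
  proof -
    have "\<bar>s2\<bar> \<le> (\<Sum>k\<in>J. \<bar>w k * (u k)\<^sup>2\<bar>)" unfolding s2_def sJ by (rule sum_abs)
    also have "\<dots> \<le> (\<Sum>k\<in>J. w k * 1)"
      unfolding abs_mult using w0 u1 J by (intro sum_mono mult_mono) (auto simp: abs_square_le_1)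
    also have "\<dots> = s0" unfolding s0_def using sJ[of "\<lambda>_. 1"] by simp
    finally show ?thesis using s0_le by simp
  qed
  \<comment> \<open>The bound on \<delta> costs at most half of \<open>mT * (h * d)\<close>, the
    guaranteed mass of a window of length h * d, and the kernel contributes at least c / h.\<close>
  have local_mass: "c * mT * d / 2 \<le> (\<Sum>k\<in>{k\<in>I. u k \<in> {\<alpha>..\<alpha> + d}}. w k)"
    if \<alpha>: "a \<le> t + h * \<alpha>" "t + h * (\<alpha> + d) \<le> b" "d \<le> 2" "\<And>v. v \<in> {\<alpha>..\<alpha> + d} \<Longrightarrow> c \<le> K v" for \<alpha>
  proof -
    have len: "(t + h * (\<alpha> + d)) - (t + h * \<alpha>) = h * d" by (simp add: algebra_simps)
    have "h * d \<le> h * 2" "0 \<le> h * d" using \<alpha>(3) h bump(4) by auto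
    then have "mT * (h * d) - \<delta> \<le> (\<Sum>k\<in>I. \<rho> k * indicator {t + h * \<alpha>..t + h * (\<alpha> + d)} (\<tau> k))"
      using mass[of "t + h * \<alpha>" "t + h * (\<alpha> + d)"] \<alpha> len by auto
    then have "mT * (h * d) - \<delta> \<le> (\<Sum>k\<in>{k\<in>I. u k \<in> {\<alpha>..\<alpha> + d}}. \<rho> k)"
      unfolding u_iff sum_indicator_restrict[OF fin] .
    then have m: "mT * d / 2 * h \<le> (\<Sum>k\<in>{k\<in>I. u k \<in> {\<alpha>..\<alpha> + d}}. \<rho> k)"
      using \<delta> by (simp add: algebra_simps)
    have "c * mT * d / 2 = (mT * d / 2 * h) * ((1 / h) * c)" using h by simp
    also have "\<dots> \<le> (\<Sum>k\<in>{k\<in>I. u k \<in> {\<alpha>..\<alpha> + d}}. \<rho> k) * ((1 / h) * c)"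
      using m h bump(5) by (intro mult_right_mono) auto
    also have "\<dots> = (\<Sum>k\<in>{k\<in>I. u k \<in> {\<alpha>..\<alpha> + d}}. \<rho> k * ((1 / h) * c))" by (simp only: sum_distrib_right)
    also have "\<dots> \<le> (\<Sum>k\<in>{k\<in>I. u k \<in> {\<alpha>..\<alpha> + d}}. w k)"
      unfolding w_def using \<rho> \<alpha>(4) h by (intro sum_mono mult_left_mono) auto
    finally show ?thesis .
  qed
  \<comment> \<open>The design point lies in one half of the interval, and on the other side of it there is room
    for a full half-window.\<close>
  have "\<exists>\<alpha> \<gamma>. (c * mT * d / 2 \<le> (\<Sum>k\<in>{k\<in>I. u k \<in> {\<alpha>..\<alpha> + d}}. w k)) \<and>
      (c * mT * d / 2 \<le> (\<Sum>k\<in>{k\<in>I. u k \<in> {\<gamma>..\<gamma> + d}}. w k)) \<and> \<alpha> + d + d \<le> \<gamma>"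
  proof (cases "t \<le> (a + b) / 2")
    case True
    have inb: "a \<le> t + h * v" "t + h * v \<le> b" if "0 \<le> v" "v \<le> 1" for v
    proof -
      have "h * v \<le> h" "0 \<le> h * v" "a \<le> t" using that h t by auto
      with True h show "a \<le> t + h * v" by linarith
      from True h \<open>h * v \<le> h\<close> show "t + h * v \<le> b" by argo
    qed
    \<comment> \<open>The outer thirds of [p, q], at distance d from each other.\<close>
    show ?thesis
      by (rule exI[of _ p], rule exI[of _ "p + 2 * d"], intro conjI local_mass inb bump(6)) (use bump in auto)
  next
    case False
    have inb: "a \<le> t + h * v" "t + h * v \<le> b" if "- 1 \<le> v" "v \<le> 0" for v
    proof -
      have "h * (- 1) \<le> h * v" using that h by (intro mult_left_mono) auto
      moreover have "h * v \<le> 0" "t \<le> b" using that h t by (auto simp: mult_le_0_iff)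
      moreover have "h * (- 1) = - h" by simp
      ultimately have v: "- h \<le> h * v" "h * v \<le> 0" "t \<le> b" by simp_all
      from False h v show "a \<le> t + h * v" by argo
      from v show "t + h * v \<le> b" by linarith
    qed
    have low: "c \<le> K v" if "- v \<in> {p..q}" for v using bump(6)[OF that] Ksym[of v] by simp
    \<comment> \<open>The outer thirds of the mirrored interval, where K is large by
      symmetry.\<close>
    show ?thesis
      by (rule exI[of _ "- q"], rule exI[of _ "- q + 2 * d"], intro conjI local_mass inb low) (use bump in auto)
  qed
  then obtain \<alpha> \<gamma> where ab: "c * mT * d / 2 \<le> (\<Sum>k\<in>{k\<in>I. u k \<in> {\<alpha>..\<alpha> + d}}. w k)"
      "c * mT * d / 2 \<le> (\<Sum>k\<in>{k\<in>I. u k \<in> {\<gamma>..\<gamma> + d}}. w k)" "\<alpha> + d + d \<le> \<gamma>" by blast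
  define D where "D = s0 * s2 - s1\<^sup>2"
  define D0 where "D0 = d\<^sup>2 * (c * mT * d / 2)\<^sup>2"
  have D0: "0 < D0" using bump pos by (simp add: D0_def)
  have "D0 = d\<^sup>2 * (c * mT * d / 2) * (c * mT * d / 2)" by (simp add: D0_def power2_eq_square)
  also have "\<dots> \<le> d\<^sup>2 * (\<Sum>k\<in>{k\<in>I. u k \<in> {\<alpha>..\<alpha> + d}}. w k) * (\<Sum>k\<in>{k\<in>I. u k \<in> {\<gamma>..\<gamma> + d}}. w k)"
    using ab bump pos w0 by (intro mult_mono mult_left_mono) (auto intro!: mult_nonneg_nonneg sum_nonneg)
  also have "\<dots> \<le> D" unfolding D_def s0_def s1_def s2_def
    by (rule weighted_moment_determinant_lower_bound) (use fin w0 bump ab in auto)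
  finally have D: "D0 \<le> D" .
  define r0 where "r0 = (\<Sum>k\<in>I. w k * y k)"
  define r1 where "r1 = (\<Sum>k\<in>I. w k * u k * y k)"
  have arg: "fst (arg_min (\<lambda>(a0, a1). \<Sum>k\<in>I. \<rho> k * ((1 / h) * K ((\<tau> k - t) / h)) * (y k - a0 - a1 * (\<tau> k - t))\<^sup>2) (\<lambda>_. True))
      = (r0 * s2 - r1 * s1) / D"
    unfolding hu u_def[symmetric] w_def[symmetric] D_def
  proof -
    have "h * u k / h = u k" for k using h by simp
    then show "fst (arg_min (\<lambda>(a0, a1). \<Sum>k\<in>I. \<rho> k * ((1 / h) * K (h * u k / h)) * (y k - a0 - a1 * (h * u k))\<^sup>2) (\<lambda>_. True))
        = (r0 * s2 - r1 * s1) / (s0 * s2 - s1\<^sup>2)"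
      using weighted_least_squares_minimizer[where I=I and w=w and h=h and u=u and y=y and ?s0.0=s0 and ?s1.0=s1 and ?s2.0=s2 and ?r0.0=r0 and ?r1.0=r1] w0 h D D0
      by (simp add: s0_def s1_def s2_def r0_def r1_def D_def w_def)
  qed
  define e where "e k = y k - (\<mu>0 + \<mu>1 * (\<tau> k - t))" for k
  define e0 where "e0 = (\<Sum>k\<in>I. w k * e k)"
  define e1 where "e1 = (\<Sum>k\<in>I. w k * (u k * e k))"
  have yk: "y k = \<mu>0 + \<mu>1 * h * u k + e k" for k by (simp add: e_def hu)
  have r0_eq: "r0 = \<mu>0 * s0 + \<mu>1 * h * s1 + e0"
    unfolding r0_def s0_def s1_def e0_def yk
    by (simp add: sum_distrib_left sum.distrib[symmetric] algebra_simps)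
  have r1_eq: "r1 = \<mu>0 * s1 + \<mu>1 * h * s2 + e1"
    unfolding r1_def s1_def s2_def e1_def yk
    by (simp add: sum_distrib_left sum.distrib[symmetric] algebra_simps power2_eq_square)
  \<comment> \<open>The coefficient of \<mu>0 is D / D, and that of the slope is s1 * s2 - s2 *
    s1.\<close>
  have diff: "(r0 * s2 - r1 * s1) / D - \<mu>0 = (e0 * s2 - e1 * s1) / D"
    using D D0 unfolding r0_eq r1_eq by (simp add: field_simps D_def power2_eq_square)
  define E where "E = Sb * R + (3 * G + B) * (N / h)"
  \<comment> \<open>Restricting u to [-1, v] restricts the times to an interval of length at most 2
    * h; it is cut to [a, b], where \<open>noise\<close> applies, and may become empty.\<close>
  have partial: "\<bar>\<Sum>k\<in>{k\<in>J. u k \<le> v}. \<rho> k * \<epsilon> k\<bar> \<le> N" if v: "v \<in> {-1..1}" for v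
  proof -
    have eq: "{k\<in>J. u k \<le> v} = {k\<in>I. \<tau> k \<in> {max a (t - h)..min b (t + h * v)}}"
    proof -
      have "{k\<in>J. u k \<le> v} = {k\<in>I. u k \<in> {-1..v}}" using v by (auto simp: J_def)
      also have "\<dots> = {k\<in>I. \<tau> k \<in> {max a (t - h)..min b (t + h * v)}}" unfolding u_iff using \<tau> by auto
      finally show ?thesis .
    qed
    show ?thesis
    proof (cases "max a (t - h) \<le> min b (t + h * v)")
      case True
      have "h * v \<le> h * 1" using v h by (intro mult_left_mono) auto
      then have "min b (t + h * v) - max a (t - h) \<le> 2 * h" by linarith
      then have "\<bar>\<Sum>k\<in>I. \<rho> k * \<epsilon> k * indicator {max a (t - h)..min b (t + h * v)} (\<tau> k)\<bar> \<le> N"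
        by (intro noise True) auto
      then show ?thesis unfolding eq sum_indicator_restrict[OF fin] .
    next
      case False
      then have "{k\<in>I. \<tau> k \<in> {max a (t - h)..min b (t + h * v)}} = {}" by auto
      with N show ?thesis unfolding eq by (simp only: sum.empty abs_zero)
    qed
  qed
  \<comment> \<open>Used with g = 1 for \<open>e0\<close> and with the identity for
    \<open>e1\<close>. The constant 3 * G + B is the bound G on K * g plus its variation bound B + 2
    * G.\<close>
  have main: "\<bar>\<Sum>k\<in>I. w k * (f k * e k)\<bar> \<le> E"
    if f: "\<And>k. f k = g (u k)" "\<And>v. v \<in> {-1..1} \<Longrightarrow> \<bar>g v\<bar> \<le> 1"
      and V: "\<And>x N. incseq x \<Longrightarrow> range x \<subseteq> {-1..1} \<Longrightarrow>
        (\<Sum>k<N. \<bar>K (x (Suc k)) * g (x (Suc k)) - K (x k) * g (x k)\<bar>) \<le> B + 2 * G" for f g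
  proof -
    have bias: "\<bar>\<Sum>k\<in>J. w k * (f k * (e k - \<epsilon> k))\<bar> \<le> Sb * R"
    proof -
      have "\<bar>\<Sum>k\<in>J. w k * (f k * (e k - \<epsilon> k))\<bar> \<le> (\<Sum>k\<in>J. w k * (1 * R))"
      proof (intro order_trans[OF sum_abs] sum_mono)
        fix k assume k: "k \<in> J"
        have "\<bar>\<tau> k - t\<bar> = h * \<bar>u k\<bar>" using h by (simp add: hu abs_mult)
        also have "\<dots> \<le> h * 1" using u1[OF k] h by (intro mult_left_mono) auto
        finally have "\<bar>e k - \<epsilon> k\<bar> \<le> R" using y[of k] k J by (auto simp: e_def)
        moreover have "\<bar>f k\<bar> \<le> 1" using f k by (auto simp: J_def)
        ultimately have "\<bar>f k\<bar> * \<bar>e k - \<epsilon> k\<bar> \<le> 1 * R" using R by (intro mult_mono) auto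
        then show "\<bar>w k * (f k * (e k - \<epsilon> k))\<bar> \<le> w k * (1 * R)"
          using w0[of k] k J by (auto simp: abs_mult intro!: mult_left_mono)
      qed
      also have "\<dots> = s0 * R" using sJ[of "\<lambda>_. 1"] by (simp add: s0_def sum_distrib_right)
      also have "\<dots> \<le> Sb * R" using s0_le R by (intro mult_right_mono) auto
      finally show ?thesis .
    qed
    have "\<bar>\<Sum>k\<in>J. (\<rho> k * \<epsilon> k) * (K (u k) * g (u k))\<bar> \<le> (G + (B + 2 * G)) * N"
    proof (rule weighted_sum_le_variation[OF J(2) _ V _ partial])
      show "\<bar>K v * g v\<bar> \<le> G" if "v \<in> {-1..1}" for v
        using mult_mono[OF KG[OF that] f(2)[OF that]] G0 by (simp add: abs_mult)
    qed (auto simp: J_def)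
    then have "(1 / h) * \<bar>\<Sum>k\<in>J. (\<rho> k * \<epsilon> k) * (K (u k) * g (u k))\<bar> \<le> (1 / h) * ((G + (B + 2 * G)) * N)"
      using h by (intro mult_left_mono) auto
    moreover have "(\<Sum>k\<in>J. w k * (f k * \<epsilon> k)) = (1 / h) * (\<Sum>k\<in>J. (\<rho> k * \<epsilon> k) * (K (u k) * g (u k)))"
      unfolding sum_distrib_left by (intro sum.cong) (auto simp: w_def f(1))
    ultimately have var: "\<bar>\<Sum>k\<in>J. w k * (f k * \<epsilon> k)\<bar> \<le> (3 * G + B) * (N / h)"
      using h by (simp add: abs_mult algebra_simps add_divide_distrib)
    have "(\<Sum>k\<in>I. w k * (f k * e k)) = (\<Sum>k\<in>J. w k * (f k * (e k - \<epsilon> k))) + (\<Sum>k\<in>J. w k * (f k * \<epsilon> k))"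
      unfolding sJ sum.distrib[symmetric] by (intro sum.cong) (auto simp: algebra_simps)
    then show ?thesis using bias var unfolding E_def by linarith
  qed
  have e0_le: "\<bar>e0\<bar> \<le> E"
  proof -
    have "\<bar>\<Sum>k\<in>I. w k * (1 * e k)\<bar> \<le> E"
    proof (rule main[of "\<lambda>_. 1" "\<lambda>_. 1"])
      fix x N assume "incseq (x :: nat \<Rightarrow> real)" "range x \<subseteq> {-1..1}"
      then show "(\<Sum>k<N. \<bar>K (x (Suc k)) * 1 - K (x k) * 1\<bar>) \<le> B + 2 * G"
        using var[of x N] G0 by simp
    qed auto
    then show ?thesis by (simp add: e0_def)
  qed
  have e1_le: "\<bar>e1\<bar> \<le> E"
    unfolding e1_def
  proof (rule main[of u "\<lambda>v. v"])
    fix x N assume x: "incseq (x :: nat \<Rightarrow> real)" "range x \<subseteq> {-1..1}"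
    show "(\<Sum>k<N. \<bar>K (x (Suc k)) * x (Suc k) - K (x k) * x k\<bar>) \<le> B + 2 * G"
      by (rule variation_times_id[of K B G x N]) (use var KG x in auto)
  qed auto
  have E0: "0 \<le> E" using e0_le by linarith
  have "\<bar>e0 * s2 - e1 * s1\<bar> \<le> \<bar>e0\<bar> * \<bar>s2\<bar> + \<bar>e1\<bar> * \<bar>s1\<bar>"
    by (rule order_trans[OF abs_triangle_ineq4]) (simp add: abs_mult)
  also have "\<dots> \<le> E * Sb + E * Sb" using e0_le e1_le s1_le s2_le E0 by (intro add_mono mult_mono) auto
  finally have num: "\<bar>e0 * s2 - e1 * s1\<bar> \<le> 2 * Sb * E" by (simp add: mult_ac)
  have "\<bar>(e0 * s2 - e1 * s1) / D\<bar> = \<bar>e0 * s2 - e1 * s1\<bar> / D" using D D0 by (simp add: abs_divide)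
  also have "\<dots> \<le> 2 * Sb * E / D0"
    using num D D0 Sb0 E0 by (intro frac_le) auto
  also have "\<dots> \<le> 2 * Sb * ((Sb + 3 * G + B) * (R + N / h)) / D0"
  proof (intro divide_right_mono mult_left_mono)
    have "0 \<le> Sb * (N / h)" "0 \<le> (3 * G + B) * R" using Sb0 N h G0 B0 R by auto
    then show "E \<le> (Sb + 3 * G + B) * (R + N / h)" unfolding E_def by (simp add: algebra_simps)
  qed (use Sb0 D0 in auto)
  also have "\<dots> = C * (R + N / h)" by (simp add: C_def Sb_def D0_def)
  finally show ?thesis unfolding arg diff .
qed

section \<open>The sampling model under the regularity conditions\<close>

lemma Int_stable_vimages: "Int_stable {f -` A \<inter> \<Omega> |A. A \<in> sets N}"
proof (rule Int_stableI)
  fix P R assume "P \<in> {f -` A \<inter> \<Omega> |A. A \<in> sets N}" "R \<in> {f -` A \<inter> \<Omega> |A. A \<in> sets N}"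
  then obtain A B where "A \<in> sets N" "B \<in> sets N" "P = f -` A \<inter> \<Omega>" "R = f -` B \<inter> \<Omega>" by auto
  then show "P \<inter> R \<in> {f -` A \<inter> \<Omega> |A. A \<in> sets N}"
    by (intro CollectI exI[of _ "A \<inter> B"]) auto
qed

text \<open>Fixes the constants that (C1) and (C5) only assert to exist, so that the scales below
  can be defined from them.\<close>

locale regular_sampling = sampling_model M a b S X Xs T U fT \<sigma> m
  for M :: "'w measure" and a b :: real and S :: "(real \<Rightarrow> real) measure"
    and X :: "'w \<Rightarrow> real \<Rightarrow> real" and Xs :: "nat \<Rightarrow> 'w \<Rightarrow> real \<Rightarrow> real"
    and T U :: "nat \<Rightarrow> nat \<Rightarrow> 'w \<Rightarrow> real" and fT :: "real \<Rightarrow> real" and \<sigma> :: real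
    and m :: "nat \<Rightarrow> nat \<Rightarrow> nat" +
  fixes h :: "nat \<Rightarrow> real" and mT MT l :: real
  assumes h_pos: "0 < h n"
    and mT_pos: "0 < mT"
    and fT_bounds: "t \<in> {a..b} \<Longrightarrow> mT \<le> fT t \<and> fT t \<le> MT"
    and C3: "condition_C3 a b (mean_fun M X)"
    and l_gt_2: "2 < l"
    and U_moment: "integrable M (\<lambda>\<omega>. \<bar>U i j \<omega>\<bar> powr l)"
    and X_moment: "(\<integral>\<^sup>+\<omega>. (SUP t\<in>{a..b}. ennreal (\<bar>X \<omega> t\<bar> powr l)) \<partial>M) < \<infinity>"
    and h_tendsto_0: "h \<longlonglongrightarrow> 0"
    and h_lower: "(\<lambda>n. inverse ((h n)\<^sup>2 + h n / gamma_m m n 1) * (ln (real n) / real n) powr (1 - 2 / l))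
              \<longlonglongrightarrow> 0"
begin

text \<open>The reciprocal of \<open>gamma_m m n 1\<close>.\<close>

definition \<kappa> :: "nat \<Rightarrow> real" where "\<kappa> n = (1 / real n) * (\<Sum>i<n. 1 / real (m n i))"
text \<open>Up to constants, n times the variance bound for a weighted sum over a window: h^2 comes
  from the dependence within a subject, h * \<kappa> from hits counted one at a time. It is also the
  quantity inverted in (C5).\<close>

definition \<beta> :: "nat \<Rightarrow> real" where "\<beta> n = (h n)\<^sup>2 + h n * \<kappa> n"
definition rate :: "nat \<Rightarrow> real" where "rate n = sqrt (\<beta> n * ln (real n) / real n)"
definition \<theta> :: "nat \<Rightarrow> real" where "\<theta> n = ln (real n) / rate n"
definition Q :: "nat \<Rightarrow> real" where "Q n = real n / \<theta> n"

section \<open>Orders of magnitude of the scales\<close>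

lemma m_pos: "i < n \<Longrightarrow> 0 < real (m n i)"
  using m_ge_2[of i n] by simp

lemma \<kappa>_bounds: "0 \<le> \<kappa> n" "\<kappa> n \<le> 1 / 2"
proof -
  show "0 \<le> \<kappa> n" unfolding \<kappa>_def by (intro mult_nonneg_nonneg sum_nonneg) auto
  have "(\<Sum>i<n. 1 / real (m n i)) \<le> (\<Sum>i<n. 1 / 2)"
  proof (rule sum_mono)
    fix i assume "i \<in> {..<n}"
    then have "2 \<le> real (m n i)" using m_ge_2[of i n] by simp
    then show "1 / real (m n i) \<le> 1 / 2" by (intro divide_left_mono) auto
  qed
  then have "\<kappa> n \<le> (1 / real n) * (real n * (1 / 2))"
    unfolding \<kappa>_def by (intro mult_left_mono) auto
  then show "\<kappa> n \<le> 1 / 2" by (cases "n = 0") auto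
qed

lemma \<beta>_eq: "(h n)\<^sup>2 + h n / gamma_m m n 1 = \<beta> n"
  by (simp add: \<beta>_def \<kappa>_def gamma_m_def divide_inverse)

lemma \<beta>_pos: "0 < \<beta> n"
  using h_pos[of n] \<kappa>_bounds(1)[of n] by (simp add: \<beta>_def add_pos_nonneg)

lemma \<beta>_lower: "\<forall>\<^sub>F n in sequentially. (ln (real n) / real n) powr (1 - 2 / l) \<le> \<beta> n"
proof -
  have "\<forall>\<^sub>F n in sequentially. inverse (\<beta> n) * (ln (real n) / real n) powr (1 - 2 / l) < 1"
    using order_tendstoD(2)[OF h_lower, of 1] unfolding \<beta>_eq by simp
  then show ?thesis
  proof eventually_elim
    case (elim n)
    then show ?case using \<beta>_pos[of n] by (simp add: field_simps)
  qed
qed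

lemma log_ratio_le_1: "\<forall>\<^sub>F n in sequentially. 0 < ln (real n) \<and> 1 \<le> ln (real n) \<and> ln (real n) / real n \<le> 1"
proof -
  have "\<forall>\<^sub>F n in sequentially. 1 \<le> ln (real n)" "\<forall>\<^sub>F n in sequentially. ln (real n) / real n \<le> 1"
    by real_asymp+
  then show ?thesis by eventually_elim auto
qed

text \<open>(C5) forces \<beta>, and with it the larger h, above ln n / n. A grid cell can therefore
  be absorbed into the bandwidth.\<close>

lemma h_ge: "\<forall>\<^sub>F n in sequentially. 1 / real n \<le> h n"
proof -
  have "\<forall>\<^sub>F n in sequentially. h n < 1 / 2" using order_tendstoD(2)[OF h_tendsto_0, of "1/2"] by simp
  then show ?thesis using \<beta>_lower log_ratio_le_1 eventually_gt_at_top[of 0]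
  proof eventually_elim
    case (elim n)
    have "1 / real n \<le> ln (real n) / real n" using elim by (simp add: divide_right_mono)
    also have "\<dots> \<le> (ln (real n) / real n) powr (1 - 2 / l)"
      using powr_mono'[of "1 - 2 / l" 1 "ln (real n) / real n"] elim l_gt_2 by simp
    also have "\<dots> \<le> \<beta> n" by fact
    also have "\<beta> n = h n * (h n + \<kappa> n)" by (simp add: \<beta>_def power2_eq_square algebra_simps)
    also have "\<dots> \<le> h n * 1" using elim \<kappa>_bounds(2)[of n] h_pos[of n] by (intro mult_left_mono) auto
    finally show ?case by simp
  qed
qed

lemma rate_pos: "\<forall>\<^sub>F n in sequentially. 0 < rate n"
  using log_ratio_le_1 eventually_gt_at_top[of 0]
  by eventually_elim (simp add: rate_def \<beta>_pos)

lemma \<theta>_pos: "\<forall>\<^sub>F n in sequentially. 0 < \<theta> n"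
  using rate_pos log_ratio_le_1 by eventually_elim (simp add: \<theta>_def)

lemma Q_pos: "\<forall>\<^sub>F n in sequentially. 0 < Q n"
  using \<theta>_pos eventually_gt_at_top[of 0] by eventually_elim (simp add: Q_def)

lemma ln_div_\<theta>: "\<forall>\<^sub>F n in sequentially. ln (real n) / \<theta> n = rate n \<and> ln (real n) / (\<theta> n)\<^sup>2 = \<beta> n / real n"
  using rate_pos log_ratio_le_1 eventually_gt_at_top[of 0]
proof eventually_elim
  case (elim n)
  have "(rate n)\<^sup>2 = \<beta> n * ln (real n) / real n"
    unfolding rate_def using elim \<beta>_pos[of n] by (intro real_sqrt_pow2) auto
  then show ?case using elim by (simp add: \<theta>_def power_divide field_simps power2_eq_square)
qed

text \<open>Window expectations change by order 1 / n across a grid cell; this makes the change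
  negligible.\<close>

lemma rate_ge: "\<forall>\<^sub>F n in sequentially. 1 / real n \<le> rate n"
  using \<beta>_lower log_ratio_le_1 eventually_gt_at_top[of 0]
proof eventually_elim
  case (elim n)
  have "1 / real n \<le> ln (real n) / real n" using elim by (simp add: divide_right_mono)
  also have "\<dots> \<le> (ln (real n) / real n) powr (1 - 2 / l)"
    using powr_mono'[of "1 - 2 / l" 1 "ln (real n) / real n"] elim l_gt_2 by simp
  also have "\<dots> \<le> \<beta> n" by fact
  finally have "1 \<le> \<beta> n * real n" using elim by (simp add: field_simps)
  then have "1 * 1 \<le> (\<beta> n * real n) * ln (real n)" using elim by (intro mult_mono) auto
  then have "(1 / real n)\<^sup>2 \<le> \<beta> n * ln (real n) / real n"
    using elim by (simp add: power2_eq_square field_simps)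
  then show ?case unfolding rate_def by (rule real_le_rsqrt)
qed

text \<open>Writing L = n / ln n, one has Q^2 = L * \<beta>, and (C5) gives \<beta> \<ge> L^(2/l -
  1), hence Q^l \<ge> L. Then Q^(1 - l) = Q / Q^l is at most Q / L, which is the rate.\<close>

lemma Q_powr: "\<forall>\<^sub>F n in sequentially. real n / ln (real n) \<le> Q n powr l \<and> Q n powr (1 - l) \<le> rate n"
  using \<beta>_lower log_ratio_le_1 eventually_gt_at_top[of 0] rate_pos ln_div_\<theta> Q_pos \<theta>_pos
proof eventually_elim
  case (elim n)
  define L where "L = real n / ln (real n)"
  have L: "0 < L" "ln (real n) / real n = 1 / L" using elim by (auto simp: L_def)
  have ln0: "ln (real n) \<noteq> 0" using elim by auto
  have "(Q n)\<^sup>2 = (real n)\<^sup>2 / ln (real n) * (ln (real n) / (\<theta> n)\<^sup>2)" using ln0 by (simp add: Q_def power_divide)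
  also have "\<dots> = L * \<beta> n" using elim by (simp add: L_def power2_eq_square)
  finally have Q2: "(Q n)\<^sup>2 = L * \<beta> n" .
  have "L powr (2 / l) = L * (1 / L) powr (1 - 2 / l)"
    using L by (simp add: powr_divide powr_diff)
  also have "\<dots> \<le> L * \<beta> n" using elim L by (intro mult_left_mono) auto
  finally have "L powr (2 / l) \<le> (Q n) powr 2" using Q2 elim by simp
  then have "(L powr (2 / l)) powr (l / 2) \<le> (Q n powr 2) powr (l / 2)"
    using l_gt_2 by (intro powr_mono2) auto
  then have Ql: "L \<le> Q n powr l" using l_gt_2 L by (simp add: powr_powr)
  have "Q n powr (1 - l) = Q n / Q n powr l" using elim by (simp add: powr_diff)
  also have "\<dots> \<le> Q n / L" using Ql L elim by (intro divide_left_mono) auto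
  also have "\<dots> = rate n" using elim by (simp add: L_def Q_def field_simps)
  finally show ?case using Ql by (simp add: L_def)
qed

lemma Q_at_top: "filterlim Q at_top sequentially"
proof -
  have "filterlim (\<lambda>n. (real n / ln (real n)) powr (1 / l)) at_top sequentially"
    using l_gt_2 by real_asymp
  then show ?thesis
  proof (rule filterlim_at_top_mono)
    show "\<forall>\<^sub>F n in sequentially. (real n / ln (real n)) powr (1 / l) \<le> Q n"
      using Q_powr Q_pos log_ratio_le_1 eventually_gt_at_top[of 0]
    proof eventually_elim
      case (elim n)
      have "(real n / ln (real n)) powr (1 / l) \<le> (Q n powr l) powr (1 / l)"
        using elim l_gt_2 by (intro powr_mono2) auto
      then show ?case using elim l_gt_2 by (simp add: powr_powr)
    qed
  qed
qed

text \<open>The information in the sources from \<open>B\<close>, encoded as a measure space so that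
  ordinary measurability statements express which sources a function depends on.\<close>

definition block :: "source set \<Rightarrow> 'w measure" where
  "block B = sigma (space M) (\<Union>s\<in>B. source_events M S Xs T U s)"

text \<open>The times lie in [a, b] only almost surely, whereas evaluation is measurable only over
  times in [a, b]. Clamping makes the range condition hold at every sample point and changes nothing
  almost surely.\<close>

definition Tc :: "nat \<Rightarrow> nat \<Rightarrow> 'w \<Rightarrow> real" where
  "Tc i j \<omega> = max a (min b (T i j \<omega>))"

lemma Tc_range: "a \<le> Tc i j \<omega>" "Tc i j \<omega> \<le> b"
  using interval by (auto simp: Tc_def)

lemma T_measurable [measurable]: "T i j \<in> borel_measurable M"
  using distributed_measurable[OF T_density[of i j]] by simp

lemma Tc_measurable [measurable]: "Tc i j \<in> borel_measurable M"
  unfolding Tc_def[abs_def] by measurable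

lemmas U_measurable' [measurable] = U_measurable
lemmas Xs_measurable' [measurable] = Xs_measurable

lemma source_events_subset: "source_events M S Xs T U s \<subseteq> events"
  using Xs_measurable T_measurable U_measurable
  by (auto simp: source_events_def intro: measurable_sets split: source.splits)

lemma space_block [simp]: "space (block B) = space M"
  by (simp add: block_def space_measure_of_conv)

lemma sets_block: "sets (block B) = sigma_sets (space M) (\<Union>s\<in>B. source_events M S Xs T U s)"
  unfolding block_def
  by (rule sets_measure_of) (use source_events_subset sets.sets_into_space in blast)

lemma block_Xs: "Path i \<in> B \<Longrightarrow> Xs i \<in> measurable (block B) S"
proof (rule measurableI)
  fix A assume B: "Path i \<in> B" and A: "A \<in> sets S"
  have "Xs i -` A \<inter> space M \<in> source_events M S Xs T U (Path i)"
    unfolding source_events_def source.case by (rule CollectI, rule exI[of _ A]) (simp add: A)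
  then show "Xs i -` A \<inter> space (block B) \<in> sets (block B)"
    unfolding sets_block space_block using B by (blast intro: sigma_sets.Basic)
qed (use measurable_space[OF Xs_measurable] in simp)

lemma block_T: "Time i j \<in> B \<Longrightarrow> T i j \<in> borel_measurable (block B)"
proof (rule measurableI)
  fix A :: "real set" assume B: "Time i j \<in> B" and A: "A \<in> sets borel"
  have "T i j -` A \<inter> space M \<in> source_events M S Xs T U (Time i j)"
    unfolding source_events_def source.case by (rule CollectI, rule exI[of _ A]) (simp add: A)
  then show "T i j -` A \<inter> space (block B) \<in> sets (block B)"
    unfolding sets_block space_block using B by (blast intro: sigma_sets.Basic)
qed simp

lemma block_U: "Err i j \<in> B \<Longrightarrow> U i j \<in> borel_measurable (block B)"
proof (rule measurableI)
  fix A :: "real set" assume B: "Err i j \<in> B" and A: "A \<in> sets borel"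
  have "U i j -` A \<inter> space M \<in> source_events M S Xs T U (Err i j)"
    unfolding source_events_def source.case by (rule CollectI, rule exI[of _ A]) (simp add: A)
  then show "U i j -` A \<inter> space (block B) \<in> sets (block B)"
    unfolding sets_block space_block using B by (blast intro: sigma_sets.Basic)
qed simp

lemma block_Tc: "Time i j \<in> B \<Longrightarrow> Tc i j \<in> borel_measurable (block B)"
  unfolding Tc_def[abs_def] by (intro borel_measurable_max borel_measurable_min block_T) auto

lemma block_eval:
  assumes "Path i \<in> B" "Time i j \<in> B"
  shows "(\<lambda>\<omega>. Xs i \<omega> (Tc i j \<omega>)) \<in> borel_measurable (block B)"
proof -
  have "(\<lambda>\<omega>. (Tc i j \<omega>, Xs i \<omega>)) \<in> block B \<rightarrow>\<^sub>M restrict_space borel {a..b} \<Otimes>\<^sub>M S"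
    using assms Tc_range by (intro measurable_Pair measurable_restrict_space2 block_Tc block_Xs) auto
  from measurable_compose[OF this eval_measurable] show ?thesis by simp
qed

lemma measurable_from_block: "f \<in> measurable (block B) N \<Longrightarrow> f \<in> measurable M N"
  using source_events_subset
  by (intro measurable_from_subalg[of M "block B"]) (auto simp: subalgebra_def sets_block intro!: sets.sigma_sets_subset)

lemma eval_measurable' [measurable]: "(\<lambda>\<omega>. Xs i \<omega> (Tc i j \<omega>)) \<in> borel_measurable M"
  by (rule measurable_from_block[OF block_eval[of i UNIV]]) auto

lemma Int_stable_source_events: "Int_stable (source_events M S Xs T U s)"
  by (cases s) (auto simp: source_events_def Int_stable_vimages)

text \<open>The generating events of each source are stable under intersection, so independence
  passes to the sigma-algebras generated by disjoint groups of sources.\<close>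

lemma indep_blocks:
  assumes disj: "disjoint_family_on I J"
    and f: "\<And>k. k \<in> J \<Longrightarrow> f k \<in> measurable (block (I k)) (N k)"
  shows "indep_vars N f J"
  unfolding indep_vars_def2
proof (intro conjI ballI)
  fix k assume "k \<in> J"
  then show "f k \<in> measurable M (N k)" by (rule measurable_from_block[OF f])
next
  have "indep_sets (\<lambda>k. sigma_sets (space M) (\<Union>s\<in>I k. source_events M S Xs T U s)) J"
    by (rule indep_sets_collect_sigma)
      (use indep_sets_mono_index[OF _ independence] disj Int_stable_source_events in auto)
  then show "indep_sets (\<lambda>k. {f k -` A \<inter> space M |A. A \<in> sets (N k)}) J"
  proof (rule indep_sets_mono_sets)
    fix k assume "k \<in> J"
    then show "{f k -` A \<inter> space M |A. A \<in> sets (N k)} \<subseteq> sigma_sets (space M) (\<Union>s\<in>I k. source_events M S Xs T U s)"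
      using measurable_sets[OF f, of k] by (auto simp: sets_block)
  qed
qed

lemma indep_blocks2:
  assumes "B \<inter> C = {}" "f \<in> borel_measurable (block B)" "g \<in> borel_measurable (block C)"
  shows "indep_var borel f borel g"
  unfolding indep_var_def
  by (rule indep_blocks[where I="case_bool B C"])
    (use assms in \<open>auto simp: disjoint_family_on_def split: bool.splits\<close>)

section \<open>Law of the observation times\<close>

lemma T_in_interval: "AE \<omega> in M. \<forall>i j. T i j \<omega> \<in> {a..b}"
proof -
  have "AE \<omega> in M. T i j \<omega> \<in> {a..b}" for i j
  proof -
    have "emeasure M (T i j -` (- {a..b}) \<inter> space M)
        = (\<integral>\<^sup>+x. ennreal (fT x) * indicator {a..b} x * indicator (- {a..b}) x \<partial>lborel)"
      by (rule distributed_emeasure[OF T_density]) simp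
    also have "\<dots> = (\<integral>\<^sup>+(x::real). 0 \<partial>lborel)" by (intro nn_integral_cong) (auto simp: indicator_def)
    finally have "T i j -` (- {a..b}) \<inter> space M \<in> null_sets M"
      by (auto simp: null_sets_def intro!: measurable_sets[OF T_measurable])
    then show ?thesis by (rule AE_I') auto
  qed
  then show ?thesis by (simp add: AE_all_countable)
qed

lemma Tc_eq_T: "AE \<omega> in M. \<forall>i j. Tc i j \<omega> = T i j \<omega>"
  using T_in_interval by eventually_elim (auto simp: Tc_def)

lemma prob_Tc:
  "emeasure M {\<omega>\<in>space M. Tc i j \<omega> \<in> {p..q}}
     = (\<integral>\<^sup>+x. ennreal (fT x) * indicator {a..b} x * indicator {p..q} x \<partial>lborel)"
proof -
  have "emeasure M {\<omega>\<in>space M. Tc i j \<omega> \<in> {p..q}} = emeasure M (T i j -` {p..q} \<inter> space M)"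
    by (rule emeasure_eq_AE) (use Tc_eq_T in \<open>auto elim!: eventually_mono\<close>)
  also have "\<dots> = (\<integral>\<^sup>+x. ennreal (fT x) * indicator {a..b} x * indicator {p..q} x \<partial>lborel)"
    by (rule distributed_emeasure[OF T_density]) simp
  finally show ?thesis .
qed

lemma MT_pos: "0 < MT"
  using fT_bounds[of a] mT_pos interval by simp

text \<open>The maximum with 0 covers reversed intervals, which occur as inner grid
  intervals.\<close>

lemma prob_Tc_le: "prob {\<omega>\<in>space M. Tc i j \<omega> \<in> {p..q}} \<le> MT * max 0 (q - p)"
proof -
  have "emeasure M {\<omega>\<in>space M. Tc i j \<omega> \<in> {p..q}} \<le> (\<integral>\<^sup>+x. ennreal MT * indicator {p..q} x \<partial>lborel)"
    unfolding prob_Tc using fT_bounds by (intro nn_integral_mono) (auto simp: indicator_def intro!: ennreal_leI)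
  also have "\<dots> = ennreal MT * emeasure lborel {p..q}" by (simp add: nn_integral_cmult_indicator)
  also have "\<dots> = ennreal (MT * max 0 (q - p))"
    using MT_pos by (cases "p \<le> q") (auto simp: ennreal_mult'')
  finally show ?thesis using MT_pos by (simp add: emeasure_eq_measure)
qed

lemma prob_Tc_ge:
  assumes "a \<le> p" "p \<le> q" "q \<le> b"
  shows "mT * (q - p) \<le> prob {\<omega>\<in>space M. Tc i j \<omega> \<in> {p..q}}"
proof -
  have "ennreal (mT * (q - p)) = ennreal mT * emeasure lborel {p..q}"
    using assms mT_pos by (simp add: ennreal_mult'')
  also have "\<dots> = (\<integral>\<^sup>+x. ennreal mT * indicator {p..q} x \<partial>lborel)" by (simp add: nn_integral_cmult_indicator)
  also have "\<dots> \<le> emeasure M {\<omega>\<in>space M. Tc i j \<omega> \<in> {p..q}}"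
    unfolding prob_Tc using fT_bounds assms by (intro nn_integral_mono) (auto simp: indicator_def intro!: ennreal_leI)
  finally show ?thesis by (simp add: emeasure_eq_measure)
qed

end

section \<open>Uniform deviations of the errors\<close>

lemma indicator_interval_diff_le:
  fixes p q p' q' x :: real
  assumes "p' \<le> p" "q \<le> q'"
  shows "indicator {p'..q'} x - indicator {p..q} x \<le> (indicator {p'..p} x + indicator {q..q'} x :: real)"
  using assms by (auto simp: indicator_def)

context regular_sampling
begin

abbreviation hit :: "real \<Rightarrow> real \<Rightarrow> nat \<Rightarrow> nat \<Rightarrow> 'w \<Rightarrow> real" where
  "hit p q i j \<omega> \<equiv> indicator {p..q} (Tc i j \<omega>)"

text \<open>The length bound is the width of the kernel window.\<close>

abbreviation short :: "nat \<Rightarrow> real \<Rightarrow> real \<Rightarrow> bool" where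
  "short n p q \<equiv> a \<le> p \<and> p \<le> q \<and> q \<le> b \<and> q - p \<le> 2 * h n"

definition pairs :: "nat \<Rightarrow> (nat \<times> nat) set" where
  "pairs n = Sigma {..<n} (\<lambda>i. {..<m n i})"

definition wt :: "nat \<Rightarrow> nat \<Rightarrow> real" where
  "wt n i = 1 / (real n * real (m n i))"

lemma finite_pairs [simp]: "finite (pairs n)"
  by (simp add: pairs_def)

lemma wt_nonneg [simp]: "0 \<le> wt n i"
  by (simp add: wt_def)

lemma sum_pairs: "(\<Sum>(i, j)\<in>pairs n. f i j) = (\<Sum>i<n. \<Sum>j<m n i. f i j)"
  by (simp add: pairs_def sum.Sigma)

lemma wt_m: "i < n \<Longrightarrow> real (m n i) * wt n i = 1 / real n"
  using m_pos[of i n] by (simp add: wt_def)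

lemma sum_wt: "0 < n \<Longrightarrow> (\<Sum>(i, j)\<in>pairs n. wt n i) = 1"
  using wt_m[of _ n] by (simp add: sum_pairs)

text \<open>This is how \<gamma> enters the rate: with independent errors, the variance over a
  window is of this order times the probability h of a hit.\<close>

lemma sum_wt_squared: "(\<Sum>(i, j)\<in>pairs n. (wt n i)\<^sup>2) = \<kappa> n / real n"
proof -
  have "(\<Sum>(i, j)\<in>pairs n. (wt n i)\<^sup>2) = (\<Sum>i<n. (1 / (real n)\<^sup>2) * (1 / real (m n i)))"
    unfolding sum_pairs using m_pos[of _ n]
    by (intro sum.cong) (auto simp: wt_def power2_eq_square field_simps)
  also have "\<dots> = \<kappa> n / real n"
    unfolding sum_distrib_left[symmetric] by (simp add: \<kappa>_def power2_eq_square)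
  finally show ?thesis .
qed

lemma expectation_indicator_Tc: "expectation (\<lambda>\<omega>. hit p q i j \<omega>) = prob {\<omega>\<in>space M. Tc i j \<omega> \<in> {p..q}}"
proof -
  have "expectation (\<lambda>\<omega>. hit p q i j \<omega>) = expectation (indicat_real {\<omega>\<in>space M. Tc i j \<omega> \<in> {p..q}})"
    by (intro Bochner_Integration.integral_cong) (auto simp: indicator_def)
  then show ?thesis by simp
qed

lemma integrable_indicator_Tc [simp]: "integrable M (\<lambda>\<omega>. hit p q i j \<omega>)"
  by (rule integrable_const_bound[where B=1]) auto

text \<open>A hit is independent of everything that does not involve its own time, so its
  probability, of order h, factors out.\<close>

lemma expectation_mult_indicator_Tc:
  assumes f: "f \<in> borel_measurable (block B)" "Time i j \<notin> B" "integrable M f"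
  shows "integrable M (\<lambda>\<omega>. f \<omega> * hit p q i j \<omega>)"
    and "expectation (\<lambda>\<omega>. f \<omega> * hit p q i j \<omega>)
      = expectation f * prob {\<omega>\<in>space M. Tc i j \<omega> \<in> {p..q}}"
proof -
  have "(\<lambda>\<omega>. hit p q i j \<omega>) \<in> borel_measurable (block {Time i j})"
    by (rule measurable_compose[OF block_Tc]) auto
  then have ind: "indep_var borel f borel (\<lambda>\<omega>. hit p q i j \<omega>)"
    using f by (intro indep_blocks2[of B "{Time i j}"]) auto
  show "integrable M (\<lambda>\<omega>. f \<omega> * hit p q i j \<omega>)"
    by (rule indep_var_integrable[OF ind f(3)]) simp
  show "expectation (\<lambda>\<omega>. f \<omega> * hit p q i j \<omega>)
      = expectation f * prob {\<omega>\<in>space M. Tc i j \<omega> \<in> {p..q}}"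
    using indep_var_lebesgue_integral[OF ind f(3)] by (simp add: expectation_indicator_Tc)
qed

text \<open>An outer grid interval exceeds the window by two cells, each at most a multiple of
  h.\<close>

lemma max_length_le:
  assumes "1 / real n \<le> h n" "q - p \<le> 2 * h n + 2 * (b - a) / real n"
  shows "max 0 (q - p) \<le> (2 + 2 * (b - a)) * h n"
proof -
  have "2 * (b - a) / real n = 2 * (b - a) * (1 / real n)" by simp
  also have "\<dots> \<le> 2 * (b - a) * h n" using assms interval by (intro mult_left_mono) auto
  finally have "q - p \<le> (2 + 2 * (b - a)) * h n" using assms by (simp add: algebra_simps)
  moreover have "0 \<le> (2 + 2 * (b - a)) * h n" using interval h_pos[of n] by (intro mult_nonneg_nonneg) auto
  ultimately show ?thesis by simp
qed

text \<open>The grid bound in the scales of the model. The independent units \<open>k\<close>, each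
  with its own block \<open>B k\<close>, are single pairs for the errors and whole subjects for the
  trajectories; the caller supplies the cap, the variance and a Lipschitz bound for the
  expectations.\<close>

lemma clipped_deviation:
  fixes \<xi> :: "nat \<Rightarrow> 'i \<Rightarrow> real \<Rightarrow> real \<Rightarrow> 'w \<Rightarrow> real"
  assumes C: "0 \<le> C" and fin: "\<And>n. finite (A n)"
    and disj: "\<And>n. disjoint_family_on B (A n)"
    and meas: "\<And>n k p q. k \<in> A n \<Longrightarrow> \<xi> n k p q \<in> borel_measurable (block (B k))"
    and mono: "\<And>n k p q p' q' \<omega>. \<lbrakk>k \<in> A n; 0 < Q n; p' \<le> p; q \<le> q'\<rbrakk> \<Longrightarrow> \<xi> n k p q \<omega> \<le> \<xi> n k p' q' \<omega>"
    and bounds: "\<And>n k p q \<omega>. \<lbrakk>k \<in> A n; 0 < Q n; 0 < n\<rbrakk> \<Longrightarrow> 0 \<le> \<xi> n k p q \<omega> \<and> \<xi> n k p q \<omega> \<le> Q n / real n"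
    and var: "\<And>n p q. \<lbrakk>0 < Q n; 0 < n; max 0 (q - p) \<le> (2 + 2 * (b - a)) * h n\<rbrakk> \<Longrightarrow>
        (\<Sum>k\<in>A n. expectation (\<lambda>\<omega>. (\<xi> n k p q \<omega>)\<^sup>2)) \<le> C * (\<beta> n / real n)"
    and step: "\<And>n p q p' q'. \<lbrakk>0 < Q n; 0 < n; p' \<le> p; q \<le> q'\<rbrakk> \<Longrightarrow>
        (\<Sum>k\<in>A n. expectation (\<xi> n k p' q') - expectation (\<xi> n k p q)) \<le> C * ((p - p') + (q' - q))"
  shows "\<exists>C. AE \<omega> in M. \<forall>\<^sub>F n in sequentially. \<forall>p q. short n p q \<longrightarrow>
      \<bar>(\<Sum>k\<in>A n. \<xi> n k p q \<omega>) - (\<Sum>k\<in>A n. expectation (\<xi> n k p q))\<bar> \<le> C * rate n"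
proof -
  \<comment> \<open>One constant for both the variance and the change of expectation across two grid
    cells.\<close>
  define C' where "C' = C + C * (2 * (b - a))"
  have C': "0 \<le> C'" "C \<le> C'" "C * (2 * (b - a)) \<le> C'"
    using C interval by (auto simp: C'_def)
  \<comment> \<open>A negative clipping level, possible for finitely many n, would destroy monotonicity in the
    interval.\<close>
  define \<xi>' where "\<xi>' n k p q \<omega> = (if 0 < Q n then \<xi> n k p q \<omega> else 0)" for n k p q \<omega>
  have same: "\<xi>' n k p q = \<xi> n k p q" if "0 < Q n" for n k p q
    using that by (auto simp: \<xi>'_def)
  have "AE \<omega> in M. \<forall>\<^sub>F n in sequentially. \<forall>p q. short n p q \<longrightarrow>
      \<bar>(\<Sum>k\<in>A n. \<xi>' n k p q \<omega>) - (\<Sum>k\<in>A n. expectation (\<xi>' n k p q))\<bar>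
        \<le> (2 * C' + 5) * ln (real n) / \<theta> n"
  proof (rule uniform_interval_deviation[OF interval C'(1) fin _ _ \<theta>_pos])
    show "indep_vars (\<lambda>_. borel) (\<lambda>k. \<xi>' n k p q) (A n)" for n p q
    proof (rule indep_blocks[OF disj])
      fix k assume "k \<in> A n"
      then show "\<xi>' n k p q \<in> borel_measurable (block (B k))"
        using meas by (cases "0 < Q n") (auto simp: \<xi>'_def[abs_def])
    qed
    show "\<xi>' n k p q \<omega> \<le> \<xi>' n k p' q' \<omega>" if "k \<in> A n" "p' \<le> p" "q \<le> q'" for n k p q p' q' \<omega>
      using mono that by (simp add: \<xi>'_def)
    show "\<forall>\<^sub>F n in sequentially. \<forall>k\<in>A n. \<forall>p q \<omega>. 0 \<le> \<xi>' n k p q \<omega> \<and> \<xi>' n k p q \<omega> \<le> 1 / \<theta> n"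
      using Q_pos eventually_gt_at_top[of 0]
    proof eventually_elim
      case (elim n)
      then have "Q n / real n = 1 / \<theta> n" by (simp add: Q_def)
      then show ?case unfolding same[OF elim(1)] using bounds elim by metis
    qed
    show "\<forall>\<^sub>F n in sequentially. \<forall>p q. q - p \<le> 2 * h n + 2 * (b - a) / real n \<longrightarrow>
        (\<Sum>k\<in>A n. expectation (\<lambda>\<omega>. (\<xi>' n k p q \<omega>)\<^sup>2)) \<le> C' * ln (real n) / (\<theta> n)\<^sup>2"
      using Q_pos h_ge ln_div_\<theta> eventually_gt_at_top[of 0]
    proof eventually_elim
      case (elim n)
      show ?case
      proof (intro allI impI)
        fix p q assume "q - p \<le> 2 * h n + 2 * (b - a) / real n"
        with elim have "(\<Sum>k\<in>A n. expectation (\<lambda>\<omega>. (\<xi> n k p q \<omega>)\<^sup>2)) \<le> C * (\<beta> n / real n)"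
          by (intro var max_length_le) auto
        also have "\<dots> \<le> C' * (\<beta> n / real n)" using C'(2) \<beta>_pos[of n] by (intro mult_right_mono) auto
        also have "\<dots> = C' * ln (real n) / (\<theta> n)\<^sup>2" using elim by (metis times_divide_eq_right)
        finally show "(\<Sum>k\<in>A n. expectation (\<lambda>\<omega>. (\<xi>' n k p q \<omega>)\<^sup>2)) \<le> C' * ln (real n) / (\<theta> n)\<^sup>2"
          using elim by (simp add: same)
      qed
    qed
    show "\<forall>\<^sub>F n in sequentially. \<forall>p q p' q'. p' \<le> p \<and> q \<le> q' \<and>
        (p - p') + (q' - q) \<le> 2 * (b - a) / real n \<longrightarrow>
        (\<Sum>k\<in>A n. expectation (\<xi>' n k p' q')) - (\<Sum>k\<in>A n. expectation (\<xi>' n k p q)) \<le> C' * ln (real n) / \<theta> n"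
      using Q_pos rate_ge ln_div_\<theta> eventually_gt_at_top[of 0]
    proof eventually_elim
      case (elim n)
      show ?case
      proof (intro allI impI, elim conjE)
        fix p q p' q' assume pq: "p' \<le> p" "q \<le> q'" "(p - p') + (q' - q) \<le> 2 * (b - a) / real n"
        have "(\<Sum>k\<in>A n. expectation (\<xi> n k p' q')) - (\<Sum>k\<in>A n. expectation (\<xi> n k p q)) \<le> C * ((p - p') + (q' - q))"
          using step[of n p' p q q'] elim pq by (simp add: sum_subtractf)
        also have "\<dots> \<le> C * (2 * (b - a) / real n)" using pq C by (intro mult_left_mono)
        also have "\<dots> = C * (2 * (b - a)) * (1 / real n)" by simp
        also have "\<dots> \<le> C' * rate n" using C' elim by (intro mult_mono) auto
        also have "\<dots> = C' * ln (real n) / \<theta> n" using elim by (metis times_divide_eq_right)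
        finally show "(\<Sum>k\<in>A n. expectation (\<xi>' n k p' q')) - (\<Sum>k\<in>A n. expectation (\<xi>' n k p q))
            \<le> C' * ln (real n) / \<theta> n" using elim by (simp add: same)
      qed
    qed
  qed
  then have "AE \<omega> in M. \<forall>\<^sub>F n in sequentially. \<forall>p q. short n p q \<longrightarrow>
      \<bar>(\<Sum>k\<in>A n. \<xi> n k p q \<omega>) - (\<Sum>k\<in>A n. expectation (\<xi> n k p q))\<bar> \<le> (2 * C' + 5) * rate n"
  proof eventually_elim
    case (elim \<omega>)
    then show ?case using Q_pos ln_div_\<theta>
    proof eventually_elim
      case (elim n)
      then have "(2 * C' + 5) * ln (real n) / \<theta> n = (2 * C' + 5) * rate n" by (metis times_divide_eq_right)
      then show ?case using elim by (simp add: same)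
    qed
  qed
  then show ?thesis by blast
qed

text \<open>Clipping destroys centring. Since \<open>r\<close> has mean zero, the mean of \<xi> -
  \<eta> is minus the mean of the clipping error; so that error must be of order \<open>rate\<close>
  twice, in expectation (\<open>mean\<close>) and almost surely (\<open>tail\<close>).\<close>

lemma noise_bound_from_clipped_parts:
  fixes \<xi> \<eta> r :: "nat \<Rightarrow> 'i \<Rightarrow> real \<Rightarrow> real \<Rightarrow> 'w \<Rightarrow> real" and e :: "nat \<Rightarrow> 'i \<Rightarrow> 'w \<Rightarrow> real"
  assumes dev: "AE \<omega> in M. \<forall>\<^sub>F n in sequentially. \<forall>p q. short n p q \<longrightarrow>
        \<bar>(\<Sum>k\<in>A n. \<xi> n k p q \<omega>) - (\<Sum>k\<in>A n. expectation (\<xi> n k p q))\<bar> \<le> C1 * rate n"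
      "AE \<omega> in M. \<forall>\<^sub>F n in sequentially. \<forall>p q. short n p q \<longrightarrow>
        \<bar>(\<Sum>k\<in>A n. \<eta> n k p q \<omega>) - (\<Sum>k\<in>A n. expectation (\<eta> n k p q))\<bar> \<le> C2 * rate n"
    and int: "\<And>n k p q. \<lbrakk>k \<in> A n; 0 < Q n\<rbrakk> \<Longrightarrow> integrable M (\<xi> n k p q) \<and> integrable M (\<eta> n k p q)"
    and r: "\<And>n k p q. k \<in> A n \<Longrightarrow> integrable M (r n k p q) \<and> expectation (r n k p q) = 0"
    and e: "AE \<omega> in M. \<forall>n k p q. k \<in> A n \<longrightarrow> 0 < Q n \<longrightarrow>
        \<bar>r n k p q \<omega> - (\<xi> n k p q \<omega> - \<eta> n k p q \<omega>)\<bar> \<le> e n k \<omega>"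
    and e_int: "\<And>n k. \<lbrakk>k \<in> A n; 0 < Q n\<rbrakk> \<Longrightarrow> integrable M (e n k)"
    and mean: "\<forall>\<^sub>F n in sequentially. (\<Sum>k\<in>A n. expectation (e n k)) \<le> C3 * rate n"
    and tail: "AE \<omega> in M. \<exists>C. \<forall>\<^sub>F n in sequentially. (\<Sum>k\<in>A n. e n k \<omega>) \<le> C * rate n"
  shows "AE \<omega> in M. \<exists>C. \<forall>\<^sub>F n in sequentially. \<forall>p q. short n p q \<longrightarrow>
      \<bar>\<Sum>k\<in>A n. r n k p q \<omega>\<bar> \<le> C * rate n"
proof -
  have each: "\<bar>expectation (\<xi> n k p q) - expectation (\<eta> n k p q)\<bar> \<le> expectation (e n k)"
    if k: "k \<in> A n" and Q: "0 < Q n" for n k p q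
  proof -
    define g where "g \<omega> = r n k p q \<omega> - (\<xi> n k p q \<omega> - \<eta> n k p q \<omega>)" for \<omega>
    have g: "integrable M g"
      unfolding g_def[abs_def] using int[OF k Q] r[OF k] by (intro Bochner_Integration.integrable_diff) auto
    have "expectation g = - (expectation (\<xi> n k p q) - expectation (\<eta> n k p q))"
      unfolding g_def using int[OF k Q, of p q] r[OF k, of p q] by simp
    then have "\<bar>expectation (\<xi> n k p q) - expectation (\<eta> n k p q)\<bar> = \<bar>expectation g\<bar>" by simp
    also have "\<bar>expectation g\<bar> \<le> expectation (\<lambda>\<omega>. \<bar>g \<omega>\<bar>)" by (rule integral_abs_bound)
    also have "\<dots> \<le> expectation (e n k)"
      using e by (intro integral_mono_AE integrable_abs[OF g] e_int[OF k Q])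
        (auto elim!: eventually_mono simp: g_def k Q)
    finally show ?thesis .
  qed
  show ?thesis using dev e tail
  proof eventually_elim
    case (elim \<omega>)
    note e\<omega> = elim(3)
    obtain K where K: "\<forall>\<^sub>F n in sequentially. (\<Sum>k\<in>A n. e n k \<omega>) \<le> K * rate n" using elim(4) by blast
    have "\<forall>\<^sub>F n in sequentially. \<forall>p q. short n p q \<longrightarrow>
        \<bar>\<Sum>k\<in>A n. r n k p q \<omega>\<bar> \<le> (C1 + C2 + C3 + K) * rate n"
      using elim(1,2) K mean Q_pos
    proof eventually_elim
      case (elim n)
      show ?case
      proof (intro allI impI)
        fix p q assume pq: "short n p q"
        have "\<bar>(\<Sum>k\<in>A n. expectation (\<xi> n k p q)) - (\<Sum>k\<in>A n. expectation (\<eta> n k p q))\<bar>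
            \<le> (\<Sum>k\<in>A n. expectation (e n k))"
          unfolding sum_subtractf[symmetric] using elim
          by (intro order_trans[OF sum_abs] sum_mono each) auto
        moreover have "\<bar>(\<Sum>k\<in>A n. r n k p q \<omega>) - ((\<Sum>k\<in>A n. \<xi> n k p q \<omega>) - (\<Sum>k\<in>A n. \<eta> n k p q \<omega>))\<bar>
            \<le> (\<Sum>k\<in>A n. e n k \<omega>)"
          unfolding sum_subtractf[symmetric] using e\<omega> elim
          by (intro order_trans[OF sum_abs] sum_mono) auto
        moreover have "\<bar>(\<Sum>k\<in>A n. \<xi> n k p q \<omega>) - (\<Sum>k\<in>A n. expectation (\<xi> n k p q))\<bar> \<le> C1 * rate n"
          "\<bar>(\<Sum>k\<in>A n. \<eta> n k p q \<omega>) - (\<Sum>k\<in>A n. expectation (\<eta> n k p q))\<bar> \<le> C2 * rate n"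
          using elim(1,2) pq by auto
        ultimately show "\<bar>\<Sum>k\<in>A n. r n k p q \<omega>\<bar> \<le> (C1 + C2 + C3 + K) * rate n"
          using elim(3,4) unfolding distrib_right by linarith
      qed
    qed
    then show ?case by blast
  qed
qed

text \<open>The function \<psi> is kept general: its instances are the positive and negative parts
  of an error, and the constant 1, which yields the design mass.\<close>

lemma error_deviation:
  assumes [measurable]: "\<psi> \<in> borel_measurable borel" and nonneg: "\<And>u. 0 \<le> \<psi> u"
    and sq: "\<And>i j. integrable M (\<lambda>\<omega>. (\<psi> (U i j \<omega>))\<^sup>2)"
    and V: "\<And>i j. expectation (\<lambda>\<omega>. (\<psi> (U i j \<omega>))\<^sup>2) \<le> V"
  defines "\<xi> \<equiv> \<lambda>n (i, j) p q \<omega>. wt n i * (min (\<psi> (U i j \<omega>)) (Q n * real (m n i)) * hit p q i j \<omega>)"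
  shows "\<exists>C. AE \<omega> in M. \<forall>\<^sub>F n in sequentially. \<forall>p q. short n p q \<longrightarrow>
      \<bar>(\<Sum>k\<in>pairs n. \<xi> n k p q \<omega>) - (\<Sum>k\<in>pairs n. expectation (\<xi> n k p q))\<bar> \<le> C * rate n"
proof -
  define L where "L = 2 + 2 * (b - a)"
  have L: "0 < L" using interval by (simp add: L_def)
  have V0: "0 \<le> V" by (rule order_trans[OF _ V[of 0 0]]) simp
  define C where "C = V * MT * L + (1 + V) * MT"
  have C0: "0 \<le> C" "V * MT * L \<le> C" "(1 + V) * MT \<le> C"
    using V0 MT_pos L interval by (auto simp: C_def)
  have psi_int: "integrable M (\<lambda>\<omega>. \<psi> (U i j \<omega>))" for i j
    by (rule square_integrable_imp_integrable[OF _ sq]) measurable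
  have psi_exp: "expectation (\<lambda>\<omega>. \<psi> (U i j \<omega>)) \<le> 1 + V" for i j
  proof -
    have "expectation (\<lambda>\<omega>. \<psi> (U i j \<omega>)) \<le> expectation (\<lambda>\<omega>. 1 + (\<psi> (U i j \<omega>))\<^sup>2)"
    proof (intro integral_mono psi_int)
      have "x \<le> 1 + x\<^sup>2" for x :: real using zero_le_power2[of "x - 1/2"] by (simp add: power2_eq_square algebra_simps)
      then show "\<psi> (U i j \<omega>) \<le> 1 + (\<psi> (U i j \<omega>))\<^sup>2" for \<omega> .
    qed (use sq in auto)
    also have "\<dots> \<le> 1 + V" using V[of i j] sq by (simp add: prob_space)
    finally show ?thesis .
  qed
  have blockU: "(\<lambda>\<omega>. g (\<psi> (U i j \<omega>))) \<in> borel_measurable (block {Err i j})"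
    if "g \<in> borel_measurable borel" for g :: "real \<Rightarrow> real" and i j
  proof -
    have "(\<lambda>u. g (\<psi> u)) \<in> borel_measurable borel" using that by measurable
    from measurable_compose[OF block_U this, of i j "{Err i j}"] show ?thesis by simp
  qed
  have bounds: "0 \<le> \<xi> n k p q \<omega> \<and> \<xi> n k p q \<omega> \<le> Q n / real n"
    if k: "k \<in> pairs n" and Qn: "0 < Q n" for n k p q \<omega>
  proof -
    obtain i j where k: "k = (i, j)" "i < n" using k by (auto simp: pairs_def)
    have "wt n i * (min (\<psi> (U i j \<omega>)) (Q n * real (m n i)) * hit p q i j \<omega>)
        \<le> wt n i * ((Q n * real (m n i)) * 1)"
      using Qn by (intro mult_left_mono mult_mono) (auto simp: indicator_def)
    also have "\<dots> = Q n * (real (m n i) * wt n i)" by simp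
    also have "\<dots> = Q n / real n" using wt_m[OF k(2)] by simp
    finally show ?thesis using Qn nonneg by (simp add: \<xi>_def k)
  qed
  have meas: "\<xi> n k p q \<in> borel_measurable (block (case k of (i, j) \<Rightarrow> {Err i j, Time i j}))" for n k p q
  proof -
    obtain i j where k: "k = (i, j)" by fastforce
    have [measurable]: "U i j \<in> borel_measurable (block {Err i j, Time i j})"
      "Tc i j \<in> borel_measurable (block {Err i j, Time i j})"
      by (auto intro: block_U block_Tc)
    show ?thesis unfolding \<xi>_def k by simp
  qed
  have int: "integrable M (\<xi> n k p q)" if "k \<in> pairs n" "0 < Q n" for n k p q
    using bounds[OF that] measurable_from_block[OF meas] by (intro integrable_const_bound[where B="Q n / real n"]) auto
  show ?thesis
  proof (rule clipped_deviation[OF C0(1) finite_pairs _ meas])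
    show "disjoint_family_on (\<lambda>(i, j). {Err i j, Time i j}) (pairs n)" for n
      by (auto simp: disjoint_family_on_def)
    show "\<xi> n k p q \<omega> \<le> \<xi> n k p' q' \<omega>" if "0 < Q n" "p' \<le> p" "q \<le> q'" for n k p q p' q' \<omega>
      using that nonneg by (cases k) (auto simp: \<xi>_def indicator_def intro!: mult_left_mono)
  next
    fix n and p q :: real assume Qn: "0 < Q n" and n: "0 < n" and len: "max 0 (q - p) \<le> (2 + 2 * (b - a)) * h n"
    define P where "P = MT * max 0 (q - p)"
    have P: "P \<le> MT * (L * h n)" unfolding P_def L_def using len MT_pos by (intro mult_left_mono) auto
    have "(\<Sum>k\<in>pairs n. expectation (\<lambda>\<omega>. (\<xi> n k p q \<omega>)\<^sup>2)) \<le> (\<Sum>(i, j)\<in>pairs n. (wt n i)\<^sup>2 * (V * P))"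
    proof (rule sum_mono)
      fix k assume "k \<in> pairs n"
      obtain i j where k: "k = (i, j)" by fastforce
      have sqb: "(\<lambda>\<omega>. (\<psi> (U i j \<omega>))\<^sup>2) \<in> borel_measurable (block {Err i j})"
        by (rule blockU[of "\<lambda>x. x\<^sup>2" i j]) measurable
      note prod = expectation_mult_indicator_Tc[OF sqb _ sq, of i j p q]
      have "expectation (\<lambda>\<omega>. (\<xi> n k p q \<omega>)\<^sup>2)
          \<le> expectation (\<lambda>\<omega>. (wt n i)\<^sup>2 * ((\<psi> (U i j \<omega>))\<^sup>2 * hit p q i j \<omega>))"
      proof (rule integral_mono')
        show "(\<xi> n k p q \<omega>)\<^sup>2 \<le> (wt n i)\<^sup>2 * ((\<psi> (U i j \<omega>))\<^sup>2 * hit p q i j \<omega>)" for \<omega>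
        proof -
          have "0 \<le> Q n * real (m n i)" using Qn by simp
          then have "(min (\<psi> (U i j \<omega>)) (Q n * real (m n i)))\<^sup>2 \<le> (\<psi> (U i j \<omega>))\<^sup>2"
            using nonneg[of "U i j \<omega>"] by (intro power_mono) auto
          then show ?thesis unfolding \<xi>_def k
            by (auto simp: power_mult_distrib indicator_def intro!: mult_left_mono)
        qed
      qed (use prod in auto)
      also have "\<dots> = (wt n i)\<^sup>2 * (expectation (\<lambda>\<omega>. (\<psi> (U i j \<omega>))\<^sup>2) * prob {\<omega>\<in>space M. Tc i j \<omega> \<in> {p..q}})"
        using prod by simp
      also have "\<dots> \<le> (wt n i)\<^sup>2 * (V * P)"
        unfolding P_def using V prob_Tc_le V0 by (intro mult_left_mono mult_mono) auto
      finally show "expectation (\<lambda>\<omega>. (\<xi> n k p q \<omega>)\<^sup>2) \<le> (case k of (i, j) \<Rightarrow> (wt n i)\<^sup>2 * (V * P))"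
        by (simp add: k)
    qed
    also have "\<dots> = (\<kappa> n / real n) * (V * P)"
      using sum_wt_squared[of n] by (simp add: case_prod_unfold flip: sum_distrib_right)
    also have "\<dots> \<le> (\<kappa> n / real n) * (V * (MT * (L * h n)))"
      using \<kappa>_bounds(1)[of n] V0 P by (intro mult_left_mono) auto
    \<comment> \<open>Pairs are independent, so only the summand h * \<kappa> of \<beta>
      arises.\<close>
    also have "\<dots> = (V * MT * L) * ((h n * \<kappa> n) / real n)" by simp
    also have "\<dots> \<le> C * (\<beta> n / real n)"
      using C0 h_pos[of n] \<kappa>_bounds(1)[of n] by (intro mult_mono divide_right_mono) (auto simp: \<beta>_def)
    finally show "(\<Sum>k\<in>pairs n. expectation (\<lambda>\<omega>. (\<xi> n k p q \<omega>)\<^sup>2)) \<le> C * (\<beta> n / real n)" .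
  next
    fix n and p q p' q' :: real assume Qn: "0 < Q n" and n: "0 < n" and pq: "p' \<le> p" "q \<le> q'"
    have "(\<Sum>k\<in>pairs n. expectation (\<xi> n k p' q') - expectation (\<xi> n k p q)) \<le> (\<Sum>(i, j)\<in>pairs n. wt n i * ((1 + V) * (MT * ((p - p') + (q' - q)))))"
    proof (rule sum_mono)
      fix k assume kp: "k \<in> pairs n"
      obtain i j where k: "k = (i, j)" by fastforce
      have psib: "(\<lambda>\<omega>. \<psi> (U i j \<omega>)) \<in> borel_measurable (block {Err i j})"
        using blockU[of "\<lambda>x. x" i j] by simp
      note prod = expectation_mult_indicator_Tc[OF psib _ psi_int, of i j]
      have "expectation (\<xi> n k p' q') - expectation (\<xi> n k p q) = expectation (\<lambda>\<omega>. \<xi> n k p' q' \<omega> - \<xi> n k p q \<omega>)"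
        using int[OF kp Qn] by simp
      also have "\<dots> \<le> expectation (\<lambda>\<omega>. wt n i *
          (\<psi> (U i j \<omega>) * hit p' p i j \<omega> + \<psi> (U i j \<omega>) * hit q q' i j \<omega>))"
      proof (rule integral_mono)
        show "\<xi> n k p' q' \<omega> - \<xi> n k p q \<omega> \<le> wt n i *
          (\<psi> (U i j \<omega>) * hit p' p i j \<omega> + \<psi> (U i j \<omega>) * hit q q' i j \<omega>)" for \<omega>
        proof -
          define x where "x = min (\<psi> (U i j \<omega>)) (Q n * real (m n i))"
          have x: "0 \<le> x" "x \<le> \<psi> (U i j \<omega>)" using nonneg Qn by (auto simp: x_def)
          let ?I = "\<lambda>p q. hit p q i j \<omega>"
          \<comment> \<open>Enlarging the interval adds at most the two end pieces, whose expected
            contribution is proportional to their lengths.\<close>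
          have "x * (?I p' q' - ?I p q) \<le> x * (?I p' p + ?I q q')"
            using x indicator_interval_diff_le[OF pq(1,2)] by (intro mult_left_mono) auto
          also have "\<dots> \<le> \<psi> (U i j \<omega>) * (?I p' p + ?I q q')"
            using x by (intro mult_right_mono) auto
          finally have "wt n i * (x * (?I p' q' - ?I p q)) \<le> wt n i * (\<psi> (U i j \<omega>) * (?I p' p + ?I q q'))"
            by (intro mult_left_mono) auto
          then show ?thesis unfolding \<xi>_def k x_def by (simp add: algebra_simps)
        qed
      qed (use int[OF kp Qn] prod in auto)
      also have "\<dots> = wt n i * (expectation (\<lambda>\<omega>. \<psi> (U i j \<omega>)) *
          (prob {\<omega>\<in>space M. Tc i j \<omega> \<in> {p'..p}} + prob {\<omega>\<in>space M. Tc i j \<omega> \<in> {q..q'}}))"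
        using prod by (simp add: algebra_simps)
      also have "\<dots> \<le> wt n i * ((1 + V) * (MT * ((p - p') + (q' - q))))"
        using prob_Tc_le[of i j p' p] prob_Tc_le[of i j q q'] psi_exp[of i j] pq V0
        by (intro mult_left_mono mult_mono) (auto simp: algebra_simps)
      finally show "expectation (\<xi> n k p' q') - expectation (\<xi> n k p q)
          \<le> (case k of (i, j) \<Rightarrow> wt n i * ((1 + V) * (MT * ((p - p') + (q' - q)))))" by (simp add: k)
    qed
    also have "\<dots> = (1 + V) * (MT * ((p - p') + (q' - q)))"
      using sum_wt[OF n] by (simp add: case_prod_unfold flip: sum_distrib_right)
    also have "\<dots> = ((1 + V) * MT) * ((p - p') + (q' - q))" by simp
    also have "\<dots> \<le> C * ((p - p') + (q' - q))" using C0(3) pq by (intro mult_right_mono) auto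
    finally show "(\<Sum>k\<in>pairs n. expectation (\<xi> n k p' q') - expectation (\<xi> n k p q)) \<le> C * ((p - p') + (q' - q))" .
  next
    show "0 \<le> \<xi> n k p q \<omega> \<and> \<xi> n k p q \<omega> \<le> Q n / real n" if "k \<in> pairs n" "0 < Q n" for n k p q \<omega>
      by (rule bounds[OF that])
  qed
qed

end

section \<open>Uniform deviations of the trajectories\<close>

context regular_sampling
begin

section \<open>Envelopes of the trajectories\<close>

abbreviation \<mu> :: "real \<Rightarrow> real" where "\<mu> \<equiv> mean_fun M X"

definition env :: "(real \<Rightarrow> real) \<Rightarrow> ennreal" where
  "env x = (SUP t\<in>{a..b}. ennreal \<bar>x t\<bar>)"

text \<open>Dominates the centred path at all times simultaneously, so it depends on the path alone
  and is independent of the observation times.\<close>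

definition Z :: "nat \<Rightarrow> 'w \<Rightarrow> real" where
  "Z i \<omega> = enn2real (env (Xs i \<omega>)) + (SUP t\<in>{a..b}. \<bar>\<mu> t\<bar>)"

lemma env_measurable [measurable]: "env \<in> borel_measurable S"
  using sup_measurable by (simp add: env_def[abs_def])

lemma \<mu>_continuous: "continuous_on {a..b} \<mu>"
  by (rule condition_C3_taylor(2)[OF interval C3])

lemma \<mu>_bdd: "bdd_above ((\<lambda>t. \<bar>\<mu> t\<bar>) ` {a..b})"
  by (intro bounded_imp_bdd_above compact_imp_bounded compact_continuous_image continuous_intros \<mu>_continuous) auto

lemma \<mu>_le: "t \<in> {a..b} \<Longrightarrow> \<bar>\<mu> t\<bar> \<le> (SUP t\<in>{a..b}. \<bar>\<mu> t\<bar>)"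
  by (rule cSUP_upper[OF _ \<mu>_bdd])

lemma Z_nonneg: "0 \<le> Z i \<omega>"
  using order_trans[OF abs_ge_zero \<mu>_le[of a]] interval by (simp add: Z_def)

lemma block_Z: "Z i \<in> borel_measurable (block {Path i})"
proof -
  have [measurable]: "(\<lambda>\<omega>. env (Xs i \<omega>)) \<in> borel_measurable (block {Path i})"
    by (rule measurable_compose[OF block_Xs env_measurable]) simp
  show ?thesis unfolding Z_def[abs_def] by measurable
qed

lemma Z_measurable [measurable]: "Z i \<in> borel_measurable M"
  by (rule measurable_from_block[OF block_Z])

lemma expectation_Xs: "f \<in> borel_measurable S \<Longrightarrow> expectation (\<lambda>\<omega>. f (Xs i \<omega>)) = expectation (\<lambda>\<omega>. f (X \<omega>))"
  for f :: "(real \<Rightarrow> real) \<Rightarrow> real"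
  using integral_distr[OF Xs_measurable[of i], of f] integral_distr[OF X_measurable, of f] Xs_copies[of i] by simp

text \<open>Both conclusions come from one measurable function below the integrand of the moment
  condition: the l-th power of the envelope where it is finite, and infinity elsewhere.\<close>

lemma env_X_moment:
  "(\<integral>\<^sup>+\<omega>. ennreal (enn2real (env (X \<omega>)) powr l) \<partial>M) < \<infinity>"
  "AE \<omega> in M. env (X \<omega>) < \<infinity>"
proof -
  let ?P = "\<lambda>\<omega>. SUP t\<in>{a..b}. ennreal (\<bar>X \<omega> t\<bar> powr l)"
  \<comment> \<open>\<open>enn2real\<close> sends infinity to 0, so the first term alone would
    tolerate infinite envelopes; the second makes a finite integral exclude them almost
    surely.\<close>
  have le: "ennreal (enn2real (env (X \<omega>)) powr l) + (if env (X \<omega>) = \<infinity> then \<infinity> else 0) \<le> ?P \<omega>" for \<omega>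
  proof (cases "?P \<omega> = \<infinity>")
    case False
    then obtain c where c: "?P \<omega> = ennreal c" "0 \<le> c" by (cases "?P \<omega>") auto
    have "\<bar>X \<omega> t\<bar> \<le> c powr (1 / l)" if "t \<in> {a..b}" for t
    proof -
      have "ennreal (\<bar>X \<omega> t\<bar> powr l) \<le> ennreal c"
        unfolding c(1)[symmetric] using that by (rule SUP_upper)
      then have "\<bar>X \<omega> t\<bar> powr l \<le> c" using c by simp
      then have "(\<bar>X \<omega> t\<bar> powr l) powr (1 / l) \<le> c powr (1 / l)"
        using l_gt_2 by (intro powr_mono2) auto
      then show ?thesis using l_gt_2 by (simp add: powr_powr)
    qed
    then have "env (X \<omega>) \<le> ennreal (c powr (1 / l))"
      unfolding env_def by (intro SUP_least ennreal_leI)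
    then have fin: "env (X \<omega>) \<noteq> \<infinity>" and "enn2real (env (X \<omega>)) \<le> c powr (1 / l)"
      by (auto simp: top_unique intro: enn2real_leI)
    then have "enn2real (env (X \<omega>)) powr l \<le> (c powr (1 / l)) powr l"
      using l_gt_2 by (intro powr_mono2) auto
    also have "\<dots> = c" using l_gt_2 c by (simp add: powr_powr)
    finally show ?thesis using fin c by (simp add: ennreal_leI)
  next
    case True
    then show ?thesis by (simp only: top_greatest infinity_ennreal_def)
  qed
  have "(\<integral>\<^sup>+\<omega>. ennreal (enn2real (env (X \<omega>)) powr l) + (if env (X \<omega>) = \<infinity> then \<infinity> else 0) \<partial>M)
      \<le> (\<integral>\<^sup>+\<omega>. ?P \<omega> \<partial>M)" by (intro nn_integral_mono le)
  also have "\<dots> < \<infinity>" by (rule X_moment)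
  finally have fin: "(\<integral>\<^sup>+\<omega>. ennreal (enn2real (env (X \<omega>)) powr l) + (if env (X \<omega>) = \<infinity> then \<infinity> else 0) \<partial>M) < \<infinity>" .
  have Xm[measurable]: "X \<in> measurable M S" by (rule X_measurable)
  have "(\<integral>\<^sup>+\<omega>. ennreal (enn2real (env (X \<omega>)) powr l) \<partial>M)
      \<le> (\<integral>\<^sup>+\<omega>. ennreal (enn2real (env (X \<omega>)) powr l) + (if env (X \<omega>) = \<infinity> then \<infinity> else 0) \<partial>M)"
    by (intro nn_integral_mono) simp
  then show "(\<integral>\<^sup>+\<omega>. ennreal (enn2real (env (X \<omega>)) powr l) \<partial>M) < \<infinity>" using fin by (rule le_less_trans)
  have "(\<lambda>\<omega>. ennreal (enn2real (env (X \<omega>)) powr l) + (if env (X \<omega>) = \<infinity> then \<infinity> else 0)) \<in> borel_measurable M"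
    by measurable
  from nn_integral_PInf_AE[OF this] fin
  have "AE \<omega> in M. ennreal (enn2real (env (X \<omega>)) powr l) + (if env (X \<omega>) = \<infinity> then \<infinity> else 0) \<noteq> \<infinity>" by auto
  then show "AE \<omega> in M. env (X \<omega>) < \<infinity>" by eventually_elim (auto simp: less_top split: if_splits)
qed

lemma Xs_le_env: "AE \<omega> in M. \<forall>i. \<forall>t\<in>{a..b}. \<bar>Xs i \<omega> t\<bar> \<le> enn2real (env (Xs i \<omega>))"
proof -
  have "AE \<omega> in M. env (Xs i \<omega>) < \<infinity>" for i
  proof -
    have set: "{x \<in> space S. env x < \<infinity>} \<in> sets S" by measurable
    have "AE x in distr M S X. env x < \<infinity>"
      using env_X_moment(2) AE_distr_iff[OF X_measurable set] by simp
    then have "AE x in distr M S (Xs i). env x < \<infinity>" unfolding Xs_copies .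
    then show ?thesis using AE_distr_iff[OF Xs_measurable set] by simp
  qed
  then have "AE \<omega> in M. \<forall>i. env (Xs i \<omega>) < \<infinity>" by (simp add: AE_all_countable)
  then show ?thesis
  proof eventually_elim
    case (elim \<omega>)
    show ?case
    proof (intro allI ballI)
      fix i t assume "t \<in> {a..b}"
      then have "ennreal \<bar>Xs i \<omega> t\<bar> \<le> env (Xs i \<omega>)" unfolding env_def by (rule SUP_upper)
      then have "enn2real (ennreal \<bar>Xs i \<omega> t\<bar>) \<le> enn2real (env (Xs i \<omega>))"
        using elim by (intro enn2real_mono) auto
      then show "\<bar>Xs i \<omega> t\<bar> \<le> enn2real (env (Xs i \<omega>))" by simp
    qed
  qed
qed

lemma Xs_le_Z: "AE \<omega> in M. \<forall>i. \<forall>t\<in>{a..b}. \<bar>Xs i \<omega> t - \<mu> t\<bar> \<le> Z i \<omega>"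
  using Xs_le_env
proof eventually_elim
  case (elim \<omega>)
  show ?case
  proof (intro allI ballI)
    fix i t assume t: "t \<in> {a..b}"
    then have "\<bar>Xs i \<omega> t\<bar> \<le> enn2real (env (Xs i \<omega>))" using elim by blast
    then show "\<bar>Xs i \<omega> t - \<mu> t\<bar> \<le> Z i \<omega>" using \<mu>_le[OF t] unfolding Z_def by linarith
  qed
qed

lemma Z_powr_integrable: "integrable M (\<lambda>\<omega>. Z i \<omega> powr l)"
proof -
  define B where "B = (SUP t\<in>{a..b}. \<bar>\<mu> t\<bar>)"
  have B0: "0 \<le> B" using order_trans[OF abs_ge_zero \<mu>_le[of a]] interval by (simp add: B_def)
  have m: "(\<lambda>x. ennreal (enn2real (env x) powr l)) \<in> borel_measurable S" by measurable
  have "(\<integral>\<^sup>+\<omega>. ennreal (enn2real (env (Xs i \<omega>)) powr l) \<partial>M)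
      = (\<integral>\<^sup>+x. ennreal (enn2real (env x) powr l) \<partial>distr M S (Xs i))"
    by (rule nn_integral_distr[symmetric]) (use m in auto)
  also have "\<dots> = (\<integral>\<^sup>+x. ennreal (enn2real (env x) powr l) \<partial>distr M S X)" by (simp add: Xs_copies)
  also have "\<dots> = (\<integral>\<^sup>+\<omega>. ennreal (enn2real (env (X \<omega>)) powr l) \<partial>M)"
    by (rule nn_integral_distr[OF X_measurable]) (use m in auto)
  finally have int: "integrable M (\<lambda>\<omega>. enn2real (env (Xs i \<omega>)) powr l)"
    using env_X_moment(1) by (intro integrableI_bounded) auto
  show ?thesis
  proof (rule Bochner_Integration.integrable_bound)
    show "integrable M (\<lambda>\<omega>. 2 powr l * (enn2real (env (Xs i \<omega>)) powr l + B powr l))"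
      using int by auto
    show "AE \<omega> in M. norm (Z i \<omega> powr l) \<le> norm (2 powr l * (enn2real (env (Xs i \<omega>)) powr l + B powr l))"
    proof (rule AE_I2)
      fix \<omega>
      define e where "e = enn2real (env (Xs i \<omega>))"
      have e0: "0 \<le> e" by (simp add: e_def)
      have "(e + B) powr l \<le> (2 * max e B) powr l" using B0 e0 l_gt_2 by (intro powr_mono2) auto
      also have "\<dots> = 2 powr l * (max e B) powr l" using B0 e0 by (simp add: powr_mult)
      also have "\<dots> \<le> 2 powr l * (e powr l + B powr l)"
        by (intro mult_left_mono) (auto simp: max_def)
      finally show "norm (Z i \<omega> powr l) \<le> norm (2 powr l * (enn2real (env (Xs i \<omega>)) powr l + B powr l))"
        by (simp add: Z_def e_def B_def)
    qed
  qed simp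
qed

lemma powr_dominates:
  assumes "0 \<le> x" "0 < s" "s \<le> l"
  shows "x powr s \<le> 1 + x powr l"
proof (cases "x \<le> 1")
  case True
  then have "x powr s \<le> 1" using powr_mono2[of s x 1] assms by simp
  then show ?thesis by (simp add: add_increasing2)
next
  case False
  then have "x powr s \<le> x powr l" using assms by (intro powr_mono) auto
  then show ?thesis by simp
qed

lemma Z_integrable: "integrable M (Z i)" "integrable M (\<lambda>\<omega>. (Z i \<omega>)\<^sup>2)"
proof -
  have dom: "integrable M (\<lambda>\<omega>. 1 + Z i \<omega> powr l)" using Z_powr_integrable by auto
  show "integrable M (Z i)"
    by (rule Bochner_Integration.integrable_bound[OF dom])
      (use powr_dominates[of "Z i _" 1] Z_nonneg l_gt_2 in auto)
  show "integrable M (\<lambda>\<omega>. (Z i \<omega>)\<^sup>2)"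
  proof (rule Bochner_Integration.integrable_bound[OF dom])
    show "AE \<omega> in M. norm ((Z i \<omega>)\<^sup>2) \<le> norm (1 + Z i \<omega> powr l)"
    proof (rule AE_I2)
      fix \<omega>
      have "(Z i \<omega>)\<^sup>2 = Z i \<omega> powr 2" using Z_nonneg[of i \<omega>] by (cases "Z i \<omega> = 0") auto
      then show "norm ((Z i \<omega>)\<^sup>2) \<le> norm (1 + Z i \<omega> powr l)"
        using powr_dominates[of "Z i \<omega>" 2] Z_nonneg[of i \<omega>] l_gt_2 by simp
    qed
  qed simp
qed

lemma distr_Z_powr: "distr M borel (\<lambda>\<omega>. Z i \<omega> powr l) = distr M borel (\<lambda>\<omega>. Z 0 \<omega> powr l)"
proof -
  define f where "f x = (enn2real (env x) + (SUP t\<in>{a..b}. \<bar>\<mu> t\<bar>)) powr l" for x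
  have f: "f \<in> borel_measurable S" unfolding f_def[abs_def] by measurable
  have "distr M borel (\<lambda>\<omega>. Z i \<omega> powr l) = distr (distr M S (Xs i)) borel f" for i
    by (subst distr_distr[OF f]) (auto simp: f_def Z_def comp_def)
  then show ?thesis by (simp add: Xs_copies)
qed

lemma expectation_Z: "g \<in> borel_measurable borel \<Longrightarrow> expectation (\<lambda>\<omega>. g (Z i \<omega>)) = expectation (\<lambda>\<omega>. g (Z 0 \<omega>))"
  for g :: "real \<Rightarrow> real"
  unfolding Z_def
  using expectation_Xs[of "\<lambda>x. g (enn2real (env x) + (SUP t\<in>{a..b}. \<bar>\<mu> t\<bar>))"] by simp

section \<open>Residuals of the trajectories at the observation times\<close>

lemma \<mu>_Tc_block: "(\<lambda>\<omega>. \<mu> (Tc i j \<omega>)) \<in> borel_measurable (block {Time i j})"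
proof -
  have "\<mu> \<in> borel_measurable (restrict_space borel {a..b})"
    by (rule borel_measurable_continuous_on_restrict[OF \<mu>_continuous])
  moreover have "Tc i j \<in> block {Time i j} \<rightarrow>\<^sub>M restrict_space borel {a..b}"
    using Tc_range by (intro measurable_restrict_space2 block_Tc) auto
  ultimately show ?thesis by (rule measurable_compose[rotated])
qed

lemma \<mu>_Tc_block': "Time i j \<in> B \<Longrightarrow> (\<lambda>\<omega>. \<mu> (Tc i j \<omega>)) \<in> borel_measurable (block B)"
proof -
  assume "Time i j \<in> B"
  then have "subalgebra (block B) (block {Time i j})"
    by (auto simp: subalgebra_def sets_block intro!: sigma_sets_mono')
  then show ?thesis using \<mu>_Tc_block by (rule measurable_from_subalg)
qed

lemma \<mu>_Tc_measurable [measurable]: "(\<lambda>\<omega>. \<mu> (Tc i j \<omega>)) \<in> borel_measurable M"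
  by (rule measurable_from_block[OF \<mu>_Tc_block])

definition resid :: "nat \<Rightarrow> nat \<Rightarrow> 'w \<Rightarrow> real" where
  "resid i j \<omega> = Xs i \<omega> (Tc i j \<omega>) - \<mu> (Tc i j \<omega>)"

lemma resid_measurable [measurable]: "resid i j \<in> borel_measurable M"
  unfolding resid_def[abs_def] by measurable

lemma resid_block: "Path i \<in> B \<Longrightarrow> Time i j \<in> B \<Longrightarrow> resid i j \<in> borel_measurable (block B)"
  unfolding resid_def[abs_def] by (intro borel_measurable_diff block_eval \<mu>_Tc_block')

lemma resid_le_Z: "AE \<omega> in M. \<forall>i j. \<bar>resid i j \<omega>\<bar> \<le> Z i \<omega>"
  using Xs_le_Z by eventually_elim (use Tc_range in \<open>auto simp: resid_def\<close>)

text \<open>The hits of one subject share a trajectory, so their squared number matters. Its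
  diagonal gives k * P, and the square of the mean gives (k * P)^2, the origin of the term h^2 in
  \<beta>.\<close>

lemma row_count_second_moment:
  assumes P: "P = MT * max 0 (q - p)"
  shows "integrable M (\<lambda>\<omega>. (\<Sum>j<k. hit p q i j \<omega>)\<^sup>2 :: real)"
    and "expectation (\<lambda>\<omega>. (\<Sum>j<k. hit p q i j \<omega>)\<^sup>2) \<le> real k * P + (real k * P)\<^sup>2"
proof -
  let ?I = "\<lambda>j \<omega>. hit p q i j \<omega>"
  have ind: "indep_vars (\<lambda>_. borel) ?I {..<k}"
    by (rule indep_blocks[where I="\<lambda>j. {Time i j}"])
      (auto simp: disjoint_family_on_def intro!: measurable_compose[OF block_Tc])
  have sq: "(?I j \<omega>)\<^sup>2 = ?I j \<omega>" for j \<omega> by (simp add: indicator_def)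
  have pos: "\<And>j \<omega>. 0 \<le> ?I j \<omega>" by simp
  have si: "\<And>j. j \<in> {..<k} \<Longrightarrow> integrable M (\<lambda>\<omega>. (?I j \<omega>)\<^sup>2)" unfolding sq by simp
  note v = variance_sum_le[OF finite_lessThan ind pos si]
  show int: "integrable M (\<lambda>\<omega>. (\<Sum>j<k. ?I j \<omega>)\<^sup>2)" by (rule v(1))
  have e: "expectation (?I j) \<le> P" for j unfolding P expectation_indicator_Tc by (rule prob_Tc_le)
  have S: "expectation (\<lambda>\<omega>. \<Sum>j<k. ?I j \<omega>) \<le> real k * P"
    using sum_mono[of "{..<k}" "\<lambda>j. expectation (?I j)" "\<lambda>_. P"] e by simp
  have S0: "0 \<le> expectation (\<lambda>\<omega>. \<Sum>j<k. ?I j \<omega>)" by (intro Bochner_Integration.integral_nonneg sum_nonneg) simp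
  have "variance (\<lambda>\<omega>. \<Sum>j<k. ?I j \<omega>) = expectation (\<lambda>\<omega>. (\<Sum>j<k. ?I j \<omega>)\<^sup>2) - (expectation (\<lambda>\<omega>. \<Sum>j<k. ?I j \<omega>))\<^sup>2"
    using int by (intro variance_eq) auto
  moreover have "(\<Sum>j<k. expectation (\<lambda>\<omega>. (?I j \<omega>)\<^sup>2)) \<le> real k * P"
    using sum_mono[of "{..<k}" "\<lambda>j. expectation (?I j)" "\<lambda>_. P"] e by (simp add: sq)
  moreover have "(expectation (\<lambda>\<omega>. \<Sum>j<k. ?I j \<omega>))\<^sup>2 \<le> (real k * P)\<^sup>2"
    using S S0 by (rule power_mono)
  ultimately show "expectation (\<lambda>\<omega>. (\<Sum>j<k. ?I j \<omega>)\<^sup>2) \<le> real k * P + (real k * P)\<^sup>2"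
    using v(2) by linarith
qed


text \<open>The independent unit is a whole subject. All its m_i observations may fall in the window
  with residuals of the same size, but their weights add up to 1 / n; clipping each at Q thus keeps
  the unit below Q / n.\<close>

lemma path_deviation:
  assumes c: "\<bar>c\<bar> = 1"
  defines "\<xi> \<equiv> \<lambda>n i p q \<omega>. wt n i * (\<Sum>j<m n i. min (max (c * resid i j \<omega>) 0) (Q n) * hit p q i j \<omega>)"
  shows "\<exists>C. AE \<omega> in M. \<forall>\<^sub>F n in sequentially. \<forall>p q. short n p q \<longrightarrow>
      \<bar>(\<Sum>i<n. \<xi> n i p q \<omega>) - (\<Sum>i<n. expectation (\<xi> n i p q))\<bar> \<le> C * rate n"
proof -
  define L where "L = 2 + 2 * (b - a)"
  have L: "0 < L" using interval by (simp add: L_def)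
  define V where "V = expectation (\<lambda>\<omega>. (Z 0 \<omega>)\<^sup>2)"
  define E1 where "E1 = expectation (Z 0)"
  have V: "expectation (\<lambda>\<omega>. (Z i \<omega>)\<^sup>2) = V" for i unfolding V_def by (rule expectation_Z) measurable
  have E1: "expectation (Z i) = E1" for i unfolding E1_def using expectation_Z[of "\<lambda>x. x" i] by simp
  have V0: "0 \<le> V" unfolding V_def by simp
  have E0: "0 \<le> E1" unfolding E1_def by (intro Bochner_Integration.integral_nonneg Z_nonneg)
  define C where "C = V * (MT * L + (MT * L)\<^sup>2) + E1 * MT"
  have C0: "0 \<le> C" "V * (MT * L + (MT * L)\<^sup>2) \<le> C" "E1 * MT \<le> C"
    using V0 E0 MT_pos L interval by (auto simp: C_def)
  define \<phi> where "\<phi> i j \<omega> = max (c * resid i j \<omega>) 0" for i j \<omega>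
  have [measurable]: "\<phi> i j \<in> borel_measurable M" for i j unfolding \<phi>_def[abs_def] by measurable
  have phi0: "0 \<le> \<phi> i j \<omega>" for i j \<omega> by (simp add: \<phi>_def)
  have phiZ: "AE \<omega> in M. \<forall>i j. \<phi> i j \<omega> \<le> Z i \<omega>"
    using resid_le_Z
  proof eventually_elim
    case (elim \<omega>)
    have "c * resid i j \<omega> \<le> \<bar>resid i j \<omega>\<bar>" for i j using c by (metis abs_ge_self abs_mult mult_1)
    then show ?case using elim Z_nonneg unfolding \<phi>_def by (meson max.boundedI order_trans)
  qed
  have xi: "\<xi> n i p q \<omega> = wt n i * (\<Sum>j<m n i. min (\<phi> i j \<omega>) (Q n) * hit p q i j \<omega>)" for n i p q \<omega>
    by (simp add: \<xi>_def \<phi>_def)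
  have bounds: "0 \<le> \<xi> n i p q \<omega> \<and> \<xi> n i p q \<omega> \<le> Q n / real n"
    if i: "i \<in> {..<n}" and Qn: "0 < Q n" for n i p q \<omega>
  proof -
    have "\<xi> n i p q \<omega> \<le> wt n i * (\<Sum>j<m n i. Q n * 1)"
      unfolding xi using Qn by (intro mult_left_mono sum_mono mult_mono) (auto simp: indicator_def)
    also have "\<dots> = Q n * (real (m n i) * wt n i)" by simp
    also have "\<dots> = Q n / real n" using wt_m[of i n] i by simp
    finally show ?thesis using Qn phi0 unfolding xi by (auto intro!: mult_nonneg_nonneg sum_nonneg)
  qed
  have meas: "\<xi> n i p q \<in> borel_measurable (block (insert (Path i) (range (Time i))))" for n i p q
  proof -
    have [measurable]: "resid i j \<in> borel_measurable (block (insert (Path i) (range (Time i))))"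
      "Tc i j \<in> borel_measurable (block (insert (Path i) (range (Time i))))" for j
      by (auto intro: resid_block block_Tc)
    show ?thesis unfolding \<xi>_def by measurable
  qed
  have int: "integrable M (\<xi> n i p q)" if "i \<in> {..<n}" "0 < Q n" for n i p q
    using bounds[OF that] measurable_from_block[OF meas] by (intro integrable_const_bound[where B="Q n / real n"]) auto
  show ?thesis
  proof (rule clipped_deviation[OF C0(1) finite_lessThan _ meas])
    show "disjoint_family_on (\<lambda>i. insert (Path i) (range (Time i))) {..<n}" for n
      by (auto simp: disjoint_family_on_def)
    show "\<xi> n i p q \<omega> \<le> \<xi> n i p' q' \<omega>" if "0 < Q n" "p' \<le> p" "q \<le> q'" for n i p q p' q' \<omega>
      unfolding xi using that phi0 by (intro mult_left_mono sum_mono) (auto simp: indicator_def)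
  next
    fix n and p q :: real assume Qn: "0 < Q n" and n: "0 < n" and len: "max 0 (q - p) \<le> (2 + 2 * (b - a)) * h n"
    define P where "P = MT * max 0 (q - p)"
    have P: "P \<le> MT * L * h n" unfolding P_def L_def using len MT_pos by (simp add: mult.assoc)
    have P0: "0 \<le> P" using MT_pos by (simp add: P_def)
    have "(\<Sum>i<n. expectation (\<lambda>\<omega>. (\<xi> n i p q \<omega>)\<^sup>2))
        \<le> (\<Sum>i<n. V * (1 / (real n)\<^sup>2 * (P * (1 / real (m n i)) + P\<^sup>2)))"
    proof (rule sum_mono)
      fix i assume i: "i \<in> {..<n}"
      let ?N = "\<lambda>\<omega>. \<Sum>j<m n i. hit p q i j \<omega>"
      note cnt = row_count_second_moment[OF P_def, of i "m n i"]
      have [measurable]: "Tc i j \<in> borel_measurable (block (range (Time i)))" for j by (auto intro: block_Tc)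
      have Nb: "(\<lambda>\<omega>. (?N \<omega>)\<^sup>2) \<in> borel_measurable (block (range (Time i)))" by measurable
      have Zb: "(\<lambda>\<omega>. (Z i \<omega>)\<^sup>2) \<in> borel_measurable (block {Path i})" using block_Z[of i] by measurable
      \<comment> \<open>The envelope depends on the path and the count on the times; this is what
        the domination of residuals by \<open>Z\<close> was for.\<close>
      have ind: "indep_var borel (\<lambda>\<omega>. (Z i \<omega>)\<^sup>2) borel (\<lambda>\<omega>. (?N \<omega>)\<^sup>2)"
        by (rule indep_blocks2[OF _ Zb Nb]) auto
      have prod: "integrable M (\<lambda>\<omega>. (Z i \<omega>)\<^sup>2 * (?N \<omega>)\<^sup>2)"
        "expectation (\<lambda>\<omega>. (Z i \<omega>)\<^sup>2 * (?N \<omega>)\<^sup>2) = V * expectation (\<lambda>\<omega>. (?N \<omega>)\<^sup>2)"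
        using indep_var_integrable[OF ind Z_integrable(2) cnt(1)]
          indep_var_lebesgue_integral[OF ind Z_integrable(2) cnt(1)] by (auto simp: V)
      have "expectation (\<lambda>\<omega>. (\<xi> n i p q \<omega>)\<^sup>2) \<le> expectation (\<lambda>\<omega>. (wt n i)\<^sup>2 * ((Z i \<omega>)\<^sup>2 * (?N \<omega>)\<^sup>2))"
      proof (rule integral_mono_AE')
        show "AE \<omega> in M. (\<xi> n i p q \<omega>)\<^sup>2 \<le> (wt n i)\<^sup>2 * ((Z i \<omega>)\<^sup>2 * (?N \<omega>)\<^sup>2)"
          using phiZ
        proof eventually_elim
          case (elim \<omega>)
          have "\<xi> n i p q \<omega> \<le> wt n i * (\<Sum>j<m n i. Z i \<omega> * hit p q i j \<omega>)"
            unfolding xi using elim by (intro mult_left_mono sum_mono mult_right_mono) (auto simp: min_le_iff_disj)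
          also have "\<dots> = wt n i * (Z i \<omega> * ?N \<omega>)" by (simp add: sum_distrib_left)
          finally have "(\<xi> n i p q \<omega>)\<^sup>2 \<le> (wt n i * (Z i \<omega> * ?N \<omega>))\<^sup>2"
            using phi0 Qn unfolding xi by (intro power_mono) (auto intro!: mult_nonneg_nonneg sum_nonneg)
          then show ?case by (simp add: power_mult_distrib)
        qed
      qed (use prod in auto)
      also have "\<dots> = (wt n i)\<^sup>2 * (V * expectation (\<lambda>\<omega>. (?N \<omega>)\<^sup>2))" using prod by simp
      also have "\<dots> \<le> (wt n i)\<^sup>2 * (V * (real (m n i) * P + (real (m n i) * P)\<^sup>2))"
        using cnt(2) V0 by (intro mult_left_mono) auto
      also have "\<dots> = V * (1 / (real n)\<^sup>2 * (P * (1 / real (m n i)) + P\<^sup>2))"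
        using m_pos[of i n] i n by (simp add: wt_def field_simps power2_eq_square)
      finally show "expectation (\<lambda>\<omega>. (\<xi> n i p q \<omega>)\<^sup>2) \<le> V * (1 / (real n)\<^sup>2 * (P * (1 / real (m n i)) + P\<^sup>2))" .
    qed
    also have "\<dots> = V * (1 / (real n)\<^sup>2 * (P * (\<Sum>i<n. 1 / real (m n i)) + real n * P\<^sup>2))"
      unfolding sum_distrib_left[symmetric] sum.distrib by simp
    \<comment> \<open>As P is of order h, the two terms match the two summands of \<beta>.\<close>
    also have "\<dots> = V * ((P * \<kappa> n + P\<^sup>2) / real n)"
      using n by (simp add: \<kappa>_def power2_eq_square field_simps)
    also have "\<dots> \<le> V * (((MT * L * h n) * \<kappa> n + (MT * L * h n)\<^sup>2) / real n)"
      using V0 P P0 \<kappa>_bounds(1)[of n] by (intro mult_left_mono divide_right_mono add_mono mult_right_mono power_mono) auto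
    also have "\<dots> \<le> V * (((MT * L + (MT * L)\<^sup>2) * \<beta> n) / real n)"
    proof (intro mult_left_mono divide_right_mono V0)
      have "0 \<le> MT * L * (h n)\<^sup>2" "0 \<le> (MT * L)\<^sup>2 * (h n * \<kappa> n)"
        using MT_pos L h_pos[of n] \<kappa>_bounds(1)[of n] by auto
      then show "(MT * L * h n) * \<kappa> n + (MT * L * h n)\<^sup>2 \<le> (MT * L + (MT * L)\<^sup>2) * \<beta> n"
        unfolding \<beta>_def power_mult_distrib by (simp add: algebra_simps)
    qed simp
    also have "\<dots> = (V * (MT * L + (MT * L)\<^sup>2)) * (\<beta> n / real n)" by simp
    also have "\<dots> \<le> C * (\<beta> n / real n)"
      using C0 \<beta>_pos[of n] by (intro mult_right_mono) auto
    finally show "(\<Sum>i<n. expectation (\<lambda>\<omega>. (\<xi> n i p q \<omega>)\<^sup>2)) \<le> C * (\<beta> n / real n)" .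
  next
    fix n and p q p' q' :: real assume Qn: "0 < Q n" and n: "0 < n" and pq: "p' \<le> p" "q \<le> q'"
    define D where "D = MT * ((p - p') + (q' - q))"
    have "(\<Sum>i<n. expectation (\<xi> n i p' q') - expectation (\<xi> n i p q)) \<le> (\<Sum>i<n. 1 / real n * (E1 * D))"
    proof (rule sum_mono)
      fix i assume i: "i \<in> {..<n}"
      let ?I = "\<lambda>j p q \<omega>. hit p q i j \<omega>"
      note prod = expectation_mult_indicator_Tc[OF block_Z _ Z_integrable(1), of i _ i]
      have "expectation (\<xi> n i p' q') - expectation (\<xi> n i p q) = expectation (\<lambda>\<omega>. \<xi> n i p' q' \<omega> - \<xi> n i p q \<omega>)"
        using int[OF i Qn] by simp
      also have "\<dots> \<le> expectation (\<lambda>\<omega>. wt n i * (\<Sum>j<m n i. Z i \<omega> * ?I j p' p \<omega> + Z i \<omega> * ?I j q q' \<omega>))"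
      proof (rule integral_mono_AE)
        show "AE \<omega> in M. \<xi> n i p' q' \<omega> - \<xi> n i p q \<omega>
            \<le> wt n i * (\<Sum>j<m n i. Z i \<omega> * ?I j p' p \<omega> + Z i \<omega> * ?I j q q' \<omega>)"
          using phiZ
        proof eventually_elim
          case (elim \<omega>)
          have "\<xi> n i p' q' \<omega> - \<xi> n i p q \<omega>
              = wt n i * (\<Sum>j<m n i. min (\<phi> i j \<omega>) (Q n) * (?I j p' q' \<omega> - ?I j p q \<omega>))"
            unfolding xi by (simp add: sum_subtractf right_diff_distrib)
          also have "\<dots> \<le> wt n i * (\<Sum>j<m n i. Z i \<omega> * (?I j p' p \<omega> + ?I j q q' \<omega>))"
          proof (intro mult_left_mono sum_mono)
            fix j
            define x where "x = min (\<phi> i j \<omega>) (Q n)"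
            have x: "0 \<le> x" "x \<le> Z i \<omega>" using phi0 Qn elim by (auto simp: x_def min_le_iff_disj)
            have "x * (?I j p' q' \<omega> - ?I j p q \<omega>) \<le> x * (?I j p' p \<omega> + ?I j q q' \<omega>)"
              using x indicator_interval_diff_le[OF pq(1,2)] by (intro mult_left_mono) auto
            also have "\<dots> \<le> Z i \<omega> * (?I j p' p \<omega> + ?I j q q' \<omega>)"
              using x by (intro mult_right_mono) auto
            finally show "min (\<phi> i j \<omega>) (Q n) * (?I j p' q' \<omega> - ?I j p q \<omega>) \<le> Z i \<omega> * (?I j p' p \<omega> + ?I j q q' \<omega>)"
              by (simp add: x_def)
          qed simp
          finally show ?case by (simp add: distrib_left)
        qed
      qed (use int[OF i Qn] prod in auto)
      also have "\<dots> = wt n i * (\<Sum>j<m n i. E1 *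
          (prob {\<omega>\<in>space M. Tc i j \<omega> \<in> {p'..p}} + prob {\<omega>\<in>space M. Tc i j \<omega> \<in> {q..q'}}))"
        using prod by (simp add: E1 distrib_left)
      also have "\<dots> \<le> wt n i * (\<Sum>j<m n i. E1 * D)"
      proof (intro mult_left_mono sum_mono E0)
        fix j show "prob {\<omega>\<in>space M. Tc i j \<omega> \<in> {p'..p}} + prob {\<omega>\<in>space M. Tc i j \<omega> \<in> {q..q'}} \<le> D"
          using prob_Tc_le[of i j p' p] prob_Tc_le[of i j q q'] pq by (simp add: D_def algebra_simps)
      qed simp
      also have "\<dots> = (real (m n i) * wt n i) * (E1 * D)" by simp
      also have "\<dots> = 1 / real n * (E1 * D)" using wt_m[of i n] i by simp
      finally show "expectation (\<xi> n i p' q') - expectation (\<xi> n i p q) \<le> 1 / real n * (E1 * D)" .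
    qed
    also have "\<dots> = E1 * D" using n by simp
    also have "\<dots> = (E1 * MT) * ((p - p') + (q' - q))" by (simp add: D_def)
    also have "\<dots> \<le> C * ((p - p') + (q' - q))" using C0(3) pq by (intro mult_right_mono) auto
    finally show "(\<Sum>i<n. expectation (\<xi> n i p' q') - expectation (\<xi> n i p q)) \<le> C * ((p - p') + (q' - q))" .
  next
    show "0 \<le> \<xi> n i p q \<omega> \<and> \<xi> n i p q \<omega> \<le> Q n / real n" if "i \<in> {..<n}" "0 < Q n" for n i p q \<omega>
      by (rule bounds[OF that])
  qed
qed

end

text \<open>Clipping at q changes nothing unless z > q, and then z = z^l * z^(1 - l) is at most z^l
  * q^(1 - l).\<close>

lemma clipping_error_le:
  fixes x z q l :: real
  assumes "\<bar>x\<bar> \<le> z" "0 < q" "1 < l"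
  shows "\<bar>x - (min (max x 0) q - min (max (- x) 0) q)\<bar> \<le> z powr l * q powr (1 - l)"
proof (cases "\<bar>x\<bar> \<le> q")
  case True
  then have "x - (min (max x 0) q - min (max (- x) 0) q) = 0" by (auto simp: min_def max_def)
  then show ?thesis by simp
next
  case False
  then have z: "q < z" using assms by simp
  have "\<bar>x - (min (max x 0) q - min (max (- x) 0) q)\<bar> \<le> z"
    using assms False by (auto simp: min_def max_def abs_if split: if_splits)
  also have "z = z powr l * z powr (1 - l)" using z assms by (simp flip: powr_add)
  also have "\<dots> \<le> z powr l * q powr (1 - l)"
    using z assms by (intro mult_left_mono powr_mono2') auto
  finally show ?thesis .
qed

context regular_sampling
begin

section \<open>Centring of the residuals\<close>

lemma eval_at_measurable: "t \<in> {a..b} \<Longrightarrow> (\<lambda>x. x t) \<in> borel_measurable S"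
proof -
  assume t: "t \<in> {a..b}"
  have "(\<lambda>x. (t, x)) \<in> S \<rightarrow>\<^sub>M restrict_space borel {a..b} \<Otimes>\<^sub>M S"
    by (rule measurable_Pair1') (use t in \<open>simp add: space_restrict_space\<close>)
  from measurable_compose[OF this eval_measurable] show ?thesis by simp
qed

text \<open>Prepares Fubini's theorem. The product form is checked on rectangles through their
  indicators, which are real functions on disjoint blocks.\<close>

lemma distr_time_path:
  "distr M (restrict_space borel {a..b} \<Otimes>\<^sub>M S) (\<lambda>\<omega>. (Tc i j \<omega>, Xs i \<omega>))
     = distr M (restrict_space borel {a..b}) (Tc i j) \<Otimes>\<^sub>M distr M S (Xs i)"
proof -
  let ?R = "restrict_space borel {a..b} :: real measure"
  have Tm[measurable]: "Tc i j \<in> M \<rightarrow>\<^sub>M ?R"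
    using Tc_range by (intro measurable_restrict_space2) auto
  interpret t: prob_space "distr M ?R (Tc i j)" by (rule prob_space_distr) measurable
  interpret x: prob_space "distr M S (Xs i)" by (rule prob_space_distr) measurable
  have blocks: "Tc i j -` A \<inter> space M \<in> sets (block {Time i j})" "Xs i -` B \<inter> space M \<in> sets (block {Path i})"
    if "A \<in> sets ?R" "B \<in> sets S" for A B
  proof -
    have "Tc i j \<in> block {Time i j} \<rightarrow>\<^sub>M ?R"
      using Tc_range by (intro measurable_restrict_space2 block_Tc) auto
    from measurable_sets[OF this that(1)] show "Tc i j -` A \<inter> space M \<in> sets (block {Time i j})" by simp
    have "Xs i \<in> block {Path i} \<rightarrow>\<^sub>M S" by (rule block_Xs) simp
    from measurable_sets[OF this that(2)] show "Xs i -` B \<inter> space M \<in> sets (block {Path i})" by simp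
  qed
  have "distr M ?R (Tc i j) \<Otimes>\<^sub>M distr M S (Xs i) = distr M (?R \<Otimes>\<^sub>M S) (\<lambda>\<omega>. (Tc i j \<omega>, Xs i \<omega>))"
  proof (rule pair_measure_eqI)
    show "sigma_finite_measure (distr M ?R (Tc i j))" ..
    show "sigma_finite_measure (distr M S (Xs i))" ..
    fix A B assume A: "A \<in> sets (distr M ?R (Tc i j))" and B: "B \<in> sets (distr M S (Xs i))"
    then have AB: "A \<in> sets ?R" "B \<in> sets S" by auto
    let ?f = "indicator (Tc i j -` A \<inter> space M) :: 'w \<Rightarrow> real"
    let ?g = "indicator (Xs i -` B \<inter> space M) :: 'w \<Rightarrow> real"
    have ind: "indep_var borel ?f borel ?g"
      by (rule indep_blocks2[of "{Time i j}" "{Path i}"]) (use blocks[OF AB] in auto)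
    have sets: "Tc i j -` A \<inter> space M \<in> sets M" "Xs i -` B \<inter> space M \<in> sets M"
      using measurable_sets[OF Tm AB(1)] measurable_sets[OF Xs_measurable AB(2)] by auto
    have "prob (Tc i j -` A \<inter> space M \<inter> (Xs i -` B \<inter> space M)) = expectation (\<lambda>\<omega>. ?f \<omega> * ?g \<omega>)"
      using sets by (simp flip: indicator_inter_arith)
    also have "\<dots> = prob (Tc i j -` A \<inter> space M) * prob (Xs i -` B \<inter> space M)"
      using indep_var_lebesgue_integral[OF ind] sets by (simp add: integrable_real_indicator emeasure_eq_measure)
    finally have prod: "prob (Tc i j -` A \<inter> space M \<inter> (Xs i -` B \<inter> space M))
        = prob (Tc i j -` A \<inter> space M) * prob (Xs i -` B \<inter> space M)" .
    have "emeasure (distr M (?R \<Otimes>\<^sub>M S) (\<lambda>\<omega>. (Tc i j \<omega>, Xs i \<omega>))) (A \<times> B)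
        = emeasure M ((\<lambda>\<omega>. (Tc i j \<omega>, Xs i \<omega>)) -` (A \<times> B) \<inter> space M)"
      using AB by (intro emeasure_distr) auto
    also have "(\<lambda>\<omega>. (Tc i j \<omega>, Xs i \<omega>)) -` (A \<times> B) \<inter> space M
        = Tc i j -` A \<inter> space M \<inter> (Xs i -` B \<inter> space M)" by auto
    finally show "emeasure (distr M ?R (Tc i j)) A * emeasure (distr M S (Xs i)) B
        = emeasure (distr M (?R \<Otimes>\<^sub>M S) (\<lambda>\<omega>. (Tc i j \<omega>, Xs i \<omega>))) (A \<times> B)"
      using AB prod by (simp add: emeasure_distr emeasure_eq_measure flip: ennreal_mult'')
  qed simp
  then show ?thesis by simp
qed

lemma \<mu>_eq_expectation: "t \<in> {a..b} \<Longrightarrow> \<mu> t = (\<integral>x. x t \<partial>distr M S (Xs i))"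
  using integral_distr[OF X_measurable eval_at_measurable] by (simp add: Xs_copies mean_fun_def)

lemma resid_integrable: "integrable M (\<lambda>\<omega>. resid i j \<omega> * hit p q i j \<omega>)"
proof (rule Bochner_Integration.integrable_bound[OF Z_integrable(1)])
  show "AE \<omega> in M. norm (resid i j \<omega> * hit p q i j \<omega>) \<le> norm (Z i \<omega>)"
    using resid_le_Z by eventually_elim (auto simp: indicator_def abs_mult Z_nonneg)
qed measurable

text \<open>By Fubini the path is integrated first at a fixed time t, which gives \<mu> t; the
  indicator depends on the time only.\<close>

lemma resid_mean_zero: "expectation (\<lambda>\<omega>. resid i j \<omega> * hit p q i j \<omega>) = 0"
proof -
  let ?R = "restrict_space borel {a..b} :: real measure"
  let ?T = "distr M ?R (Tc i j)" and ?X = "distr M S (Xs i)"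
  let ?f = "\<lambda>(t, x). x t * indicator {p..q} t :: real"
  have Tm[measurable]: "Tc i j \<in> M \<rightarrow>\<^sub>M ?R"
    using Tc_range by (intro measurable_restrict_space2) auto
  interpret t: prob_space ?T by (rule prob_space_distr) measurable
  interpret x: prob_space ?X by (rule prob_space_distr) measurable
  interpret tx: pair_prob_space ?T ?X ..
  have fm: "?f \<in> borel_measurable (?R \<Otimes>\<^sub>M S)"
  proof -
    have "(\<lambda>z. (case z of (t, x) \<Rightarrow> x t) * indicator {p..q} (fst z) :: real) \<in> borel_measurable (?R \<Otimes>\<^sub>M S)"
    proof (intro borel_measurable_times eval_measurable)
      have "(\<lambda>z. fst z) \<in> ?R \<Otimes>\<^sub>M S \<rightarrow>\<^sub>M ?R" by measurable
      moreover have "(indicator {p..q} :: real \<Rightarrow> real) \<in> borel_measurable ?R"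
        by (rule measurable_restrict_space1) measurable
      ultimately show "(\<lambda>z. indicator {p..q} (fst z) :: real) \<in> borel_measurable (?R \<Otimes>\<^sub>M S)"
        by (rule measurable_compose)
    qed
    then show ?thesis by (simp add: case_prod_unfold)
  qed
  have pm: "(\<lambda>\<omega>. (Tc i j \<omega>, Xs i \<omega>)) \<in> M \<rightarrow>\<^sub>M ?R \<Otimes>\<^sub>M S" by measurable
  have muint: "integrable M (\<lambda>\<omega>. \<mu> (Tc i j \<omega>) * hit p q i j \<omega>)"
  proof (rule integrable_const_bound)
    have "\<bar>\<mu> (Tc i j \<omega>)\<bar> \<le> (SUP t\<in>{a..b}. \<bar>\<mu> t\<bar>)" for \<omega> using Tc_range by (intro \<mu>_le) auto
    then show "AE \<omega> in M. norm (\<mu> (Tc i j \<omega>) * hit p q i j \<omega>) \<le> (SUP t\<in>{a..b}. \<bar>\<mu> t\<bar>)"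
      by (intro AE_I2) (auto simp: abs_mult indicator_def intro: order_trans[OF abs_ge_zero])
  qed measurable
  have fint: "integrable M (\<lambda>\<omega>. Xs i \<omega> (Tc i j \<omega>) * hit p q i j \<omega>)"
  proof -
    have "integrable M (\<lambda>\<omega>. resid i j \<omega> * hit p q i j \<omega> + \<mu> (Tc i j \<omega>) * hit p q i j \<omega>)"
      using resid_integrable muint by (rule Bochner_Integration.integrable_add)
    then show ?thesis by (simp add: resid_def algebra_simps)
  qed
  have "integrable (distr M (?R \<Otimes>\<^sub>M S) (\<lambda>\<omega>. (Tc i j \<omega>, Xs i \<omega>))) ?f"
    using fint by (subst integrable_distr_eq[OF pm fm]) simp
  then have tint: "integrable (?T \<Otimes>\<^sub>M ?X) ?f" by (simp only: distr_time_path)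
  have "expectation (\<lambda>\<omega>. Xs i \<omega> (Tc i j \<omega>) * hit p q i j \<omega>)
      = integral\<^sup>L (distr M (?R \<Otimes>\<^sub>M S) (\<lambda>\<omega>. (Tc i j \<omega>, Xs i \<omega>))) ?f"
    by (subst integral_distr[OF pm fm]) simp
  also have "\<dots> = integral\<^sup>L (?T \<Otimes>\<^sub>M ?X) ?f" by (simp only: distr_time_path)
  also have "\<dots> = (\<integral>t. (\<integral>x. ?f (t, x) \<partial>?X) \<partial>?T)" by (rule tx.integral_fst'[OF tint, symmetric])
  also have "\<dots> = (\<integral>t. \<mu> t * indicator {p..q} t \<partial>?T)"
  proof (rule Bochner_Integration.integral_cong)
    fix t assume "t \<in> space ?T"
    then have "t \<in> {a..b}" by (simp add: space_restrict_space)
    then show "(\<integral>x. ?f (t, x) \<partial>?X) = \<mu> t * indicator {p..q} t" using \<mu>_eq_expectation by simp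
  qed simp
  also have "\<dots> = expectation (\<lambda>\<omega>. \<mu> (Tc i j \<omega>) * hit p q i j \<omega>)"
  proof (rule integral_distr[OF Tm])
    have "\<mu> \<in> borel_measurable ?R" by (rule borel_measurable_continuous_on_restrict[OF \<mu>_continuous])
    moreover have "(indicator {p..q} :: real \<Rightarrow> real) \<in> borel_measurable ?R"
      by (rule measurable_restrict_space1) measurable
    ultimately show "(\<lambda>t. \<mu> t * indicator {p..q} t) \<in> borel_measurable ?R" by (rule borel_measurable_times)
  qed
  finally show ?thesis using fint muint by (simp add: resid_def left_diff_distrib)
qed

text \<open>The clipping error of subject i is at most Z_i^l * Q^(1 - l) / n. The strong law bounds
  the average of the Z_i^l, and Q^(1 - l) is at most the rate.\<close>

lemma path_noise_bound:
  "AE \<omega> in M. \<exists>C. \<forall>\<^sub>F n in sequentially. \<forall>p q. short n p q \<longrightarrow>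
      \<bar>\<Sum>i<n. wt n i * (\<Sum>j<m n i. resid i j \<omega> * hit p q i j \<omega>)\<bar> \<le> C * rate n"
proof -
  define \<xi> where "\<xi> c n i p q \<omega> = wt n i * (\<Sum>j<m n i. min (max (c * resid i j \<omega>) 0) (Q n) * hit p q i j \<omega>)"
    for c n i p q \<omega>
  have dev: "\<exists>C. AE \<omega> in M. \<forall>\<^sub>F n in sequentially. \<forall>p q. short n p q \<longrightarrow>
      \<bar>(\<Sum>i<n. \<xi> c n i p q \<omega>) - (\<Sum>i<n. expectation (\<xi> c n i p q))\<bar> \<le> C * rate n" if "\<bar>c\<bar> = 1" for c
    unfolding \<xi>_def by (rule path_deviation[OF that])
  obtain C1 C2 where dev12: "AE \<omega> in M. \<forall>\<^sub>F n in sequentially. \<forall>p q. short n p q \<longrightarrow>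
      \<bar>(\<Sum>i<n. \<xi> 1 n i p q \<omega>) - (\<Sum>i<n. expectation (\<xi> 1 n i p q))\<bar> \<le> C1 * rate n"
      "AE \<omega> in M. \<forall>\<^sub>F n in sequentially. \<forall>p q. short n p q \<longrightarrow>
      \<bar>(\<Sum>i<n. \<xi> (-1) n i p q \<omega>) - (\<Sum>i<n. expectation (\<xi> (-1) n i p q))\<bar> \<le> C2 * rate n"
    using dev[of 1] dev[of "-1"] by auto
  have [measurable]: "\<xi> c n i p q \<in> borel_measurable M" for c n i p q
    unfolding \<xi>_def[abs_def] by measurable
  define EZ where "EZ = expectation (\<lambda>\<omega>. Z 0 \<omega> powr l)"
  have EZ: "expectation (\<lambda>\<omega>. Z i \<omega> powr l) = EZ" for i unfolding EZ_def by (rule expectation_Z) measurable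
  have EZ0: "0 \<le> EZ" unfolding EZ_def by simp
  have slln: "AE \<omega> in M. \<exists>C. \<forall>n. (\<Sum>i<n. Z i \<omega> powr l) \<le> C * real n"
  proof (rule iid_averages_bounded)
    show "indep_vars (\<lambda>_. borel) (\<lambda>i \<omega>. Z i \<omega> powr l) UNIV"
    proof (rule indep_blocks[where I="\<lambda>i. {Path i}"])
      fix i show "(\<lambda>\<omega>. Z i \<omega> powr l) \<in> borel_measurable (block {Path i})"
        using block_Z[of i] by measurable
    qed (auto simp: disjoint_family_on_def)
  qed (auto simp: Z_powr_integrable intro: distr_Z_powr)
  \<comment> \<open>The weights of one subject add up to 1 / n, so this dominates its clipping error
    whatever its count is.\<close>
  define e where "e n i \<omega> = (1 / real n) * (Z i \<omega> powr l * Q n powr (1 - l))" for n i \<omega>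
  have e_int: "integrable M (e n i)" for n i
    unfolding e_def by (intro integrable_mult_right integrable_mult_left Z_powr_integrable)
  have clip: "\<bar>wt n i * (\<Sum>j<m n i. resid i j \<omega> * hit p q i j \<omega>) - (\<xi> 1 n i p q \<omega> - \<xi> (-1) n i p q \<omega>)\<bar> \<le> e n i \<omega>"
    if "\<forall>i j. \<bar>resid i j \<omega>\<bar> \<le> Z i \<omega>" "0 < Q n" "i < n" for n i p q \<omega>
  proof -
    define d where "d j = resid i j \<omega> - (min (max (resid i j \<omega>) 0) (Q n) - min (max (- resid i j \<omega>) 0) (Q n))" for j
    have split: "wt n i * (\<Sum>j<m n i. resid i j \<omega> * hit p q i j \<omega>) - (\<xi> 1 n i p q \<omega> - \<xi> (-1) n i p q \<omega>)
        = wt n i * (\<Sum>j<m n i. d j * hit p q i j \<omega>)"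
      unfolding \<xi>_def d_def by (simp only: left_diff_distrib sum_subtractf right_diff_distrib) simp
    have "\<bar>wt n i * (\<Sum>j<m n i. d j * hit p q i j \<omega>)\<bar> \<le> wt n i * (\<Sum>j<m n i. Z i \<omega> powr l * Q n powr (1 - l))"
      unfolding abs_mult abs_of_nonneg[OF wt_nonneg]
    proof (intro mult_left_mono wt_nonneg order_trans[OF sum_abs] sum_mono)
      fix j
      have "\<bar>d j\<bar> \<le> Z i \<omega> powr l * Q n powr (1 - l)"
        unfolding d_def using that l_gt_2 by (intro clipping_error_le) auto
      then show "\<bar>d j * hit p q i j \<omega>\<bar> \<le> Z i \<omega> powr l * Q n powr (1 - l)"
        by (auto simp: abs_mult indicator_def)
    qed
    also have "\<dots> = (real (m n i) * wt n i) * (Z i \<omega> powr l * Q n powr (1 - l))"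
      by (simp only: sum_constant card_lessThan mult_ac)
    also have "\<dots> = e n i \<omega>" by (simp only: wt_m[OF that(3)] e_def)
    finally show ?thesis unfolding split .
  qed
  show ?thesis
  proof (rule noise_bound_from_clipped_parts[OF dev12 _ _ _ e_int])
    fix n i and p q :: real assume i: "i \<in> {..<n}" and Qn: "0 < Q n"
    have "norm (\<xi> c n i p q \<omega>) \<le> wt n i * (\<Sum>j<m n i. Q n)" for c \<omega>
      unfolding \<xi>_def real_norm_def abs_mult abs_of_nonneg[OF wt_nonneg]
      using Qn by (intro mult_left_mono order_trans[OF sum_abs] sum_mono) (auto simp: indicator_def)
    then have "integrable M (\<xi> c n i p q)" for c
      by (intro integrable_const_bound[where B="wt n i * (\<Sum>j<m n i. Q n)"] AE_I2) auto
    then show "integrable M (\<xi> 1 n i p q) \<and> integrable M (\<xi> (-1) n i p q)" by blast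
  next
    fix n i and p q :: real
    show "integrable M (\<lambda>\<omega>. wt n i * (\<Sum>j<m n i. resid i j \<omega> * hit p q i j \<omega>)) \<and>
        expectation (\<lambda>\<omega>. wt n i * (\<Sum>j<m n i. resid i j \<omega> * hit p q i j \<omega>)) = 0"
      using resid_integrable resid_mean_zero
      by (simp add: Bochner_Integration.integral_sum Bochner_Integration.integrable_sum del: sum_mult_indicator)
  next
    show "AE \<omega> in M. \<forall>n i p q. i \<in> {..<n} \<longrightarrow> 0 < Q n \<longrightarrow>
        \<bar>wt n i * (\<Sum>j<m n i. resid i j \<omega> * hit p q i j \<omega>) - (\<xi> 1 n i p q \<omega> - \<xi> (-1) n i p q \<omega>)\<bar> \<le> e n i \<omega>"
      using resid_le_Z
    proof eventually_elim
      case (elim \<omega>)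
      show ?case by (intro allI impI clip[OF elim]) simp_all
    qed
  next
    show "\<forall>\<^sub>F n in sequentially. (\<Sum>i<n. expectation (e n i)) \<le> EZ * rate n"
      using Q_powr eventually_gt_at_top[of 0]
    proof eventually_elim
      case (elim n)
      have "(\<Sum>i<n. expectation (e n i)) = EZ * Q n powr (1 - l)"
        unfolding e_def using elim Z_powr_integrable by (simp add: EZ)
      also have "\<dots> \<le> EZ * rate n" using elim EZ0 by (intro mult_left_mono) auto
      finally show ?case .
    qed
  next
    show "AE \<omega> in M. \<exists>C. \<forall>\<^sub>F n in sequentially. (\<Sum>i<n. e n i \<omega>) \<le> C * rate n"
      using slln
    proof eventually_elim
      case (elim \<omega>)
      then obtain K where K: "\<And>n. (\<Sum>i<n. Z i \<omega> powr l) \<le> K * real n" by blast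
      have K0: "0 \<le> K" using order_trans[OF _ K[of 1], of 0] by simp
      have "\<forall>\<^sub>F n in sequentially. (\<Sum>i<n. e n i \<omega>) \<le> K * rate n"
        using Q_powr eventually_gt_at_top[of 0]
      proof eventually_elim
        case (elim n)
        have "(\<Sum>i<n. e n i \<omega>) = (1 / real n) * ((\<Sum>i<n. Z i \<omega> powr l) * Q n powr (1 - l))"
          unfolding e_def by (simp only: sum_distrib_left sum_distrib_right)
        also have "\<dots> \<le> (1 / real n) * ((K * real n) * Q n powr (1 - l))"
          by (intro mult_left_mono mult_right_mono K) auto
        also have "\<dots> = K * Q n powr (1 - l)" using elim by simp
        also have "\<dots> \<le> K * rate n" using elim K0 by (intro mult_left_mono) auto
        finally show ?case .
      qed
      then show ?case by blast
    qed
  qed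
qed

end

section \<open>The noise and the design in short intervals\<close>

context regular_sampling
begin

text \<open>The level has the factor m_i because a single error carries the weight 1 / (n * m_i):
  after clipping its contribution is still at most Q / n.\<close>

definition clip_error :: "nat \<Rightarrow> nat \<Rightarrow> nat \<Rightarrow> 'w \<Rightarrow> real" where
  "clip_error n i j \<omega> = U i j \<omega>
     - (min (max (U i j \<omega>) 0) (Q n * real (m n i)) - min (max (- U i j \<omega>) 0) (Q n * real (m n i)))"

text \<open>The exponent 1 - l is negative, so replacing the level Q * m_i by Q weakens the bound to
  one that is free of the counts.\<close>

lemma clip_error_le:
  assumes "0 < Q n" "i < n"
  shows "\<bar>clip_error n i j \<omega>\<bar> \<le> \<bar>U i j \<omega>\<bar> powr l * Q n powr (1 - l)"
proof -
  have m1: "1 \<le> real (m n i)" using m_ge_2[OF assms(2)] by simp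
  have "Q n * 1 \<le> Q n * real (m n i)" using m1 assms(1) by (intro mult_left_mono) auto
  then have Qm: "0 < Q n * real (m n i)" "Q n \<le> Q n * real (m n i)" using assms(1) by auto
  have "\<bar>clip_error n i j \<omega>\<bar> \<le> \<bar>U i j \<omega>\<bar> powr l * (Q n * real (m n i)) powr (1 - l)"
    unfolding clip_error_def using Qm l_gt_2 by (intro clipping_error_le) auto
  also have "\<dots> \<le> \<bar>U i j \<omega>\<bar> powr l * Q n powr (1 - l)"
    using Qm assms(1) l_gt_2 by (intro mult_left_mono powr_mono2') auto
  finally show ?thesis .
qed

lemma expectation_U: "g \<in> borel_measurable borel \<Longrightarrow> expectation (\<lambda>\<omega>. g (U i j \<omega>)) = expectation (\<lambda>\<omega>. g (U 0 0 \<omega>))"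
  for g :: "real \<Rightarrow> real"
  using integral_distr[OF U_measurable[of i j], of g] integral_distr[OF U_measurable[of 0 0], of g]
    U_identical[of i j 0 0] by simp

lemma U_second_moment: "expectation (\<lambda>\<omega>. (U i j \<omega>)\<^sup>2) = \<sigma>\<^sup>2"
  using U_variance[of i j] by (simp add: U_mean)

lemma clip_error_measurable [measurable]: "clip_error n i j \<in> borel_measurable M"
  unfolding clip_error_def[abs_def] by measurable

text \<open>The almost sure bound on what clipping removes is left as the hypothesis
  \<open>tail\<close>, since bounded and growing counts require different arguments for it. The
  corresponding bound in expectation holds for all counts.\<close>

lemma error_noise_bound:
  assumes tail: "AE \<omega> in M. \<exists>C. \<forall>\<^sub>F n in sequentially.
      (\<Sum>(i, j)\<in>pairs n. wt n i * \<bar>clip_error n i j \<omega>\<bar>) \<le> C * rate n"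
  shows "AE \<omega> in M. \<exists>C. \<forall>\<^sub>F n in sequentially. \<forall>p q. short n p q \<longrightarrow>
      \<bar>\<Sum>(i, j)\<in>pairs n. wt n i * (U i j \<omega> * hit p q i j \<omega>)\<bar> \<le> C * rate n"
proof -
  define \<xi> where "\<xi> c n = (\<lambda>(i, j) p q \<omega>. wt n i * (min (max (c * U i j \<omega>) 0) (Q n * real (m n i)) * hit p q i j \<omega>))"
    for c :: real and n
  define r where "r n = (\<lambda>(i, j) p q \<omega>. wt n i * (U i j \<omega> * hit p q i j \<omega>))" for n
  define e where "e n = (\<lambda>(i, j) \<omega>. wt n i * \<bar>clip_error n i j \<omega>\<bar>)" for n
  have dev: "\<exists>C. AE \<omega> in M. \<forall>\<^sub>F n in sequentially. \<forall>p q. short n p q \<longrightarrow>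
      \<bar>(\<Sum>k\<in>pairs n. \<xi> c n k p q \<omega>) - (\<Sum>k\<in>pairs n. expectation (\<xi> c n k p q))\<bar> \<le> C * rate n"
    if c: "\<bar>c\<bar> = 1" for c
    unfolding \<xi>_def
  proof (rule error_deviation[of "\<lambda>u. max (c * u) 0" "\<sigma>\<^sup>2"])
    have le: "(max (c * u) 0)\<^sup>2 \<le> u\<^sup>2" for u
    proof -
      have "\<bar>max (c * u) 0\<bar> \<le> \<bar>c * u\<bar>" by (auto simp: max_def)
      also have "\<dots> = \<bar>u\<bar>" using c by (simp add: abs_mult)
      finally show ?thesis by (rule abs_le_square_iff[THEN iffD1])
    qed
    show sq: "integrable M (\<lambda>\<omega>. (max (c * U i j \<omega>) 0)\<^sup>2)" for i j
      by (rule Bochner_Integration.integrable_bound[OF U_square_integrable[of i j]]) (auto simp: le)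
    show "expectation (\<lambda>\<omega>. (max (c * U i j \<omega>) 0)\<^sup>2) \<le> \<sigma>\<^sup>2" for i j
      unfolding U_second_moment[of i j, symmetric]
      by (intro integral_mono sq U_square_integrable le)
  qed auto
  obtain C1 C2 where dev12: "AE \<omega> in M. \<forall>\<^sub>F n in sequentially. \<forall>p q. short n p q \<longrightarrow>
      \<bar>(\<Sum>k\<in>pairs n. \<xi> 1 n k p q \<omega>) - (\<Sum>k\<in>pairs n. expectation (\<xi> 1 n k p q))\<bar> \<le> C1 * rate n"
      "AE \<omega> in M. \<forall>\<^sub>F n in sequentially. \<forall>p q. short n p q \<longrightarrow>
      \<bar>(\<Sum>k\<in>pairs n. \<xi> (-1) n k p q \<omega>) - (\<Sum>k\<in>pairs n. expectation (\<xi> (-1) n k p q))\<bar> \<le> C2 * rate n"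
    using dev[of 1] dev[of "-1"] by auto
  define EU where "EU = expectation (\<lambda>\<omega>. \<bar>U 0 0 \<omega>\<bar> powr l)"
  have EU: "expectation (\<lambda>\<omega>. \<bar>U i j \<omega>\<bar> powr l) = EU" for i j
    unfolding EU_def using expectation_U[of "\<lambda>u. \<bar>u\<bar> powr l" i j] by simp
  have EU0: "0 \<le> EU" unfolding EU_def by simp
  have e_le: "integrable M (e n (i, j)) \<and> expectation (e n (i, j)) \<le> wt n i * (EU * Q n powr (1 - l))"
    if "i < n" "0 < Q n" for n i j
  proof -
    have dom: "integrable M (\<lambda>\<omega>. wt n i * (\<bar>U i j \<omega>\<bar> powr l * Q n powr (1 - l)))"
      by (intro integrable_mult_right integrable_mult_left U_moment)
    have le: "e n (i, j) \<omega> \<le> wt n i * (\<bar>U i j \<omega>\<bar> powr l * Q n powr (1 - l))" for \<omega>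
      unfolding e_def split_conv by (intro mult_left_mono clip_error_le that) auto
    have int: "integrable M (e n (i, j))"
      by (rule Bochner_Integration.integrable_bound[OF dom])
        (use le in \<open>auto simp: e_def abs_mult\<close>)
    have "expectation (e n (i, j)) \<le> expectation (\<lambda>\<omega>. wt n i * (\<bar>U i j \<omega>\<bar> powr l * Q n powr (1 - l)))"
      by (intro integral_mono int dom le)
    also have "\<dots> = wt n i * (EU * Q n powr (1 - l))" using U_moment by (simp add: EU)
    finally show ?thesis using int by blast
  qed
  have "AE \<omega> in M. \<exists>C. \<forall>\<^sub>F n in sequentially. \<forall>p q. short n p q \<longrightarrow>
      \<bar>\<Sum>k\<in>pairs n. r n k p q \<omega>\<bar> \<le> C * rate n"
  proof (rule noise_bound_from_clipped_parts[OF dev12])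
    fix n k and p q :: real assume k: "k \<in> pairs n" and Qn: "0 < Q n"
    obtain i j where ij: "k = (i, j)" "i < n" using k by (auto simp: pairs_def)
    show "integrable M (e n k)" using e_le ij Qn by simp
    have "0 \<le> Q n * real (m n i)" using Qn by simp
    then have "norm (\<xi> c n k p q \<omega>) \<le> wt n i * (Q n * real (m n i))" for c \<omega>
      unfolding \<xi>_def ij real_norm_def split_conv abs_mult abs_of_nonneg[OF wt_nonneg]
      by (intro mult_left_mono) (auto simp: indicator_def)
    moreover have "\<xi> c n k p q \<in> borel_measurable M" for c unfolding \<xi>_def ij by simp
    ultimately have "integrable M (\<xi> c n k p q)" for c
      by (intro integrable_const_bound[where B="wt n i * (Q n * real (m n i))"] AE_I2) auto
    then show "integrable M (\<xi> 1 n k p q) \<and> integrable M (\<xi> (-1) n k p q)" by blast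
  next
    fix n and k :: "nat \<times> nat" and p q :: real
    obtain i j where ij: "k = (i, j)" by fastforce
    show "integrable M (r n k p q) \<and> expectation (r n k p q) = 0"
      using expectation_mult_indicator_Tc[OF block_U _ U_integrable, of i j "{Err i j}" i j p q]
      by (simp add: r_def ij U_mean)
  next
    have "\<bar>r n k p q \<omega> - (\<xi> 1 n k p q \<omega> - \<xi> (-1) n k p q \<omega>)\<bar> \<le> e n k \<omega>" for n k p q \<omega>
    proof -
      obtain i j where ij: "k = (i, j)" by fastforce
      have "r n k p q \<omega> - (\<xi> 1 n k p q \<omega> - \<xi> (-1) n k p q \<omega>) = wt n i * (clip_error n i j \<omega> * hit p q i j \<omega>)"
        by (simp add: r_def \<xi>_def ij clip_error_def algebra_simps)
      then show ?thesis by (auto simp: e_def ij abs_mult indicator_def)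
    qed
    then show "AE \<omega> in M. \<forall>n k p q. k \<in> pairs n \<longrightarrow> 0 < Q n \<longrightarrow>
        \<bar>r n k p q \<omega> - (\<xi> 1 n k p q \<omega> - \<xi> (-1) n k p q \<omega>)\<bar> \<le> e n k \<omega>" by simp
  next
    show "\<forall>\<^sub>F n in sequentially. (\<Sum>k\<in>pairs n. expectation (e n k)) \<le> EU * rate n"
      using Q_pos Q_powr eventually_gt_at_top[of 0]
    proof eventually_elim
      case (elim n)
      have "(\<Sum>k\<in>pairs n. expectation (e n k)) \<le> (\<Sum>(i, j)\<in>pairs n. wt n i * (EU * Q n powr (1 - l)))"
        using e_le elim(1) by (intro sum_mono) (auto simp: pairs_def)
      also have "\<dots> = EU * Q n powr (1 - l)"
        using sum_wt[OF elim(3)] by (simp add: case_prod_unfold flip: sum_distrib_right)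
      also have "\<dots> \<le> EU * rate n" using elim EU0 by (intro mult_left_mono) auto
      finally show ?case .
    qed
  next
    show "AE \<omega> in M. \<exists>C. \<forall>\<^sub>F n in sequentially. (\<Sum>k\<in>pairs n. e n k \<omega>) \<le> C * rate n"
      using tail by (simp add: e_def case_prod_unfold)
  qed
  then show ?thesis by (simp add: r_def case_prod_unfold)
qed

text \<open>For a fixed position j the errors of successive subjects form one sequence that does not
  change with n, so the strong law applies to each of the B columns. The weights are bounded by 1 /
  n at the cost of a factor depending on B.\<close>

lemma error_tail_bounded_counts:
  assumes B: "\<And>n i. i < n \<Longrightarrow> m n i \<le> B"
  shows "AE \<omega> in M. \<exists>C. \<forall>\<^sub>F n in sequentially.
      (\<Sum>(i, j)\<in>pairs n. wt n i * \<bar>clip_error n i j \<omega>\<bar>) \<le> C * rate n"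
proof -
  have "AE \<omega> in M. \<exists>C. \<forall>n. (\<Sum>i<n. \<bar>U i j \<omega>\<bar> powr l) \<le> C * real n" for j
  proof (rule iid_averages_bounded)
    show "indep_vars (\<lambda>_. borel) (\<lambda>i \<omega>. \<bar>U i j \<omega>\<bar> powr l) UNIV"
    proof (rule indep_blocks[where I="\<lambda>i. {Err i j}"])
      fix i
      have [measurable]: "U i j \<in> borel_measurable (block {Err i j})" by (rule block_U) simp
      show "(\<lambda>\<omega>. \<bar>U i j \<omega>\<bar> powr l) \<in> borel_measurable (block {Err i j})" by measurable
    qed (auto simp: disjoint_family_on_def)
    show "distr M borel (\<lambda>\<omega>. \<bar>U i j \<omega>\<bar> powr l) = distr M borel (\<lambda>\<omega>. \<bar>U 0 j \<omega>\<bar> powr l)" for i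
    proof -
      have "distr M borel (\<lambda>\<omega>. \<bar>U i j \<omega>\<bar> powr l) = distr (distr M borel (U i j)) borel (\<lambda>u. \<bar>u\<bar> powr l)" for i
        by (subst distr_distr) (auto simp: comp_def)
      then show ?thesis using U_identical[of i j 0 j] by simp
    qed
  qed (auto simp: U_moment)
  then have "AE \<omega> in M. \<forall>j. \<exists>C. \<forall>n. (\<Sum>i<n. \<bar>U i j \<omega>\<bar> powr l) \<le> C * real n"
    by (simp add: AE_all_countable)
  then show ?thesis
  proof eventually_elim
    case (elim \<omega>)
    then obtain C where C: "\<And>j n. (\<Sum>i<n. \<bar>U i j \<omega>\<bar> powr l) \<le> C j * real n" by metis
    have C0: "0 \<le> C j" for j using order_trans[OF _ C[of j 1], of 0] by simp
    define K where "K = (\<Sum>j<B. C j)"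
    have K0: "0 \<le> K" unfolding K_def by (intro sum_nonneg C0)
    have "\<forall>\<^sub>F n in sequentially. (\<Sum>(i, j)\<in>pairs n. wt n i * \<bar>clip_error n i j \<omega>\<bar>) \<le> K * rate n"
      using Q_pos Q_powr eventually_gt_at_top[of 0]
    proof eventually_elim
      case (elim n)
      let ?u = "\<lambda>i j. \<bar>U i j \<omega>\<bar> powr l * Q n powr (1 - l)"
      have "(\<Sum>(i, j)\<in>pairs n. wt n i * \<bar>clip_error n i j \<omega>\<bar>) \<le> (\<Sum>i<n. \<Sum>j<B. 1 / real n * ?u i j)"
        unfolding sum_pairs
      proof (rule sum_mono)
        fix i assume i: "i \<in> {..<n}"
        have "wt n i \<le> 1 / real n"
        proof -
          have "1 * wt n i \<le> real (m n i) * wt n i" using m_ge_2[of i n] i by (intro mult_right_mono) auto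
          then show ?thesis using wt_m[of i n] i by simp
        qed
        then have "(\<Sum>j<m n i. wt n i * \<bar>clip_error n i j \<omega>\<bar>) \<le> (\<Sum>j<m n i. 1 / real n * ?u i j)"
          using clip_error_le[of n i _ \<omega>] elim i by (intro sum_mono mult_mono) auto
        also have "\<dots> \<le> (\<Sum>j<B. 1 / real n * ?u i j)"
          using B[of i n] i by (intro sum_mono2) auto
        finally show "(\<Sum>j<m n i. wt n i * \<bar>clip_error n i j \<omega>\<bar>) \<le> (\<Sum>j<B. 1 / real n * ?u i j)" .
      qed
      also have "\<dots> = (\<Sum>j<B. 1 / real n * ((\<Sum>i<n. \<bar>U i j \<omega>\<bar> powr l) * Q n powr (1 - l)))"
        by (subst sum.swap) (simp only: sum_distrib_left sum_distrib_right)
      also have "\<dots> \<le> (\<Sum>j<B. 1 / real n * ((C j * real n) * Q n powr (1 - l)))"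
        by (intro sum_mono mult_left_mono mult_right_mono C) auto
      also have "\<dots> = K * Q n powr (1 - l)" using elim by (simp add: K_def sum_distrib_right)
      also have "\<dots> \<le> K * rate n" using elim K0 by (intro mult_left_mono) auto
      finally show ?case .
    qed
    then show ?case by blast
  qed
qed

text \<open>The expected mass of an interval lies between mT and MT times its length, because the
  weights sum to 1.\<close>

lemma mass_deviation:
  "AE \<omega> in M. \<exists>C. \<forall>\<^sub>F n in sequentially. \<forall>p q. short n p q \<longrightarrow>
     mT * (q - p) - C * rate n \<le> (\<Sum>(i, j)\<in>pairs n. wt n i * hit p q i j \<omega>) \<and>
     (\<Sum>(i, j)\<in>pairs n. wt n i * hit p q i j \<omega>) \<le> MT * (q - p) + C * rate n"
proof -
  \<comment> \<open>Once Q is at least 1 the clip at Q * m_i leaves the constant 1 untouched, and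
    these are the plain weights.\<close>
  define \<xi> where "\<xi> n = (\<lambda>(i, j) p q \<omega>. wt n i * (min 1 (Q n * real (m n i)) * hit p q i j \<omega>))" for n
  have "\<exists>C. AE \<omega> in M. \<forall>\<^sub>F n in sequentially. \<forall>p q. short n p q \<longrightarrow>
      \<bar>(\<Sum>k\<in>pairs n. \<xi> n k p q \<omega>) - (\<Sum>k\<in>pairs n. expectation (\<xi> n k p q))\<bar> \<le> C * rate n"
    unfolding \<xi>_def by (rule error_deviation[of "\<lambda>_. 1" 1]) (auto simp: prob_space)
  then obtain C where C: "AE \<omega> in M. \<forall>\<^sub>F n in sequentially. \<forall>p q. short n p q \<longrightarrow>
      \<bar>(\<Sum>k\<in>pairs n. \<xi> n k p q \<omega>) - (\<Sum>k\<in>pairs n. expectation (\<xi> n k p q))\<bar> \<le> C * rate n" by blast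
  have Q1: "\<forall>\<^sub>F n in sequentially. 1 \<le> Q n" using Q_at_top by (simp add: filterlim_at_top)
  show ?thesis using C
  proof eventually_elim
    case (elim \<omega>)
    have "\<forall>\<^sub>F n in sequentially. \<forall>p q. short n p q \<longrightarrow>
     mT * (q - p) - C * rate n \<le> (\<Sum>(i, j)\<in>pairs n. wt n i * hit p q i j \<omega>) \<and>
     (\<Sum>(i, j)\<in>pairs n. wt n i * hit p q i j \<omega>) \<le> MT * (q - p) + C * rate n"
      using elim Q1 eventually_gt_at_top[of 0]
    proof eventually_elim
      case (elim n)
      have xi: "\<xi> n k p q = (\<lambda>\<omega>. case k of (i, j) \<Rightarrow> wt n i * hit p q i j \<omega>)" if kp: "k \<in> pairs n" for k p q
      proof -
        obtain i j where k: "k = (i, j)" "i < n" using kp by (auto simp: pairs_def)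
        have "1 * 1 \<le> Q n * real (m n i)" using elim m_ge_2[OF k(2)] by (intro mult_mono) auto
        then show ?thesis by (auto simp: \<xi>_def k min_def)
      qed
      show ?case
      proof (intro allI impI)
        fix p q assume pq: "short n p q"
        have sum: "(\<Sum>k\<in>pairs n. \<xi> n k p q \<omega>) = (\<Sum>(i, j)\<in>pairs n. wt n i * hit p q i j \<omega>)"
          using xi by (intro sum.cong) auto
        have E: "expectation (\<xi> n k p q) = (case k of (i, j) \<Rightarrow> wt n i * prob {\<omega>\<in>space M. Tc i j \<omega> \<in> {p..q}})"
          if "k \<in> pairs n" for k
          unfolding xi[OF that] by (cases k) (simp only: split_conv integral_mult_right_zero expectation_indicator_Tc)
        have "(\<Sum>k\<in>pairs n. expectation (\<xi> n k p q)) \<le> (\<Sum>(i, j)\<in>pairs n. wt n i * (MT * (q - p)))"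
        proof (rule sum_mono)
          fix k assume k: "k \<in> pairs n"
          obtain i j where "k = (i, j)" by fastforce
          then show "expectation (\<xi> n k p q) \<le> (case k of (i, j) \<Rightarrow> wt n i * (MT * (q - p)))"
            unfolding E[OF k] using prob_Tc_le[of i j p q] pq by (auto intro!: mult_left_mono)
        qed
        also have "\<dots> = MT * (q - p)" using sum_wt[OF elim(3)] by (simp add: case_prod_unfold flip: sum_distrib_right)
        finally have up: "(\<Sum>k\<in>pairs n. expectation (\<xi> n k p q)) \<le> MT * (q - p)" .
        have "mT * (q - p) = (\<Sum>(i, j)\<in>pairs n. wt n i * (mT * (q - p)))"
          using sum_wt[OF elim(3)] by (simp add: case_prod_unfold flip: sum_distrib_right)
        also have "\<dots> \<le> (\<Sum>k\<in>pairs n. expectation (\<xi> n k p q))"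
        proof (rule sum_mono)
          fix k assume k: "k \<in> pairs n"
          obtain i j where "k = (i, j)" by fastforce
          then show "(case k of (i, j) \<Rightarrow> wt n i * (mT * (q - p))) \<le> expectation (\<xi> n k p q)"
            unfolding E[OF k] using prob_Tc_ge[of p q i j] pq by (auto intro!: mult_left_mono)
        qed
        finally have low: "mT * (q - p) \<le> (\<Sum>k\<in>pairs n. expectation (\<xi> n k p q))" .
        have "\<bar>(\<Sum>k\<in>pairs n. \<xi> n k p q \<omega>) - (\<Sum>k\<in>pairs n. expectation (\<xi> n k p q))\<bar> \<le> C * rate n"
          using elim(1) pq by blast
        then show "mT * (q - p) - C * rate n \<le> (\<Sum>(i, j)\<in>pairs n. wt n i * hit p q i j \<omega>) \<and>
            (\<Sum>(i, j)\<in>pairs n. wt n i * hit p q i j \<omega>) \<le> MT * (q - p) + C * rate n"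
          using up low unfolding sum by linarith
      qed
    qed
    then show ?case by blast
  qed
qed


text \<open>The expected sum of the weighted moments converges, so one random constant controls all errors at
  once; in part (b) the growth of the counts beats it.\<close>

lemma U_moment_envelope:
  "AE \<omega> in M. \<exists>C. \<forall>i j. \<bar>U i j \<omega>\<bar> powr l \<le> C * (real (Suc j) powr (3/2) * real (Suc i) powr (17/16))"
proof -
  \<comment> \<open>Both exponents exceed 1, for summability. The first stays 1/2 below 2, and that
    square root of the count is at least of order (n / ln n)^(1/8) in part (b); the second stays
    below 1 + 1/8, so this gain beats it.\<close>
  define \<tau> where "\<tau> i j = real (Suc j) powr (3/2) * real (Suc i) powr (17/16)" for i j
  have \<tau>0: "0 < \<tau> i j" for i j by (simp add: \<tau>_def)
  define EU where "EU = expectation (\<lambda>\<omega>. \<bar>U 0 0 \<omega>\<bar> powr l)"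
  have EU: "expectation (\<lambda>\<omega>. \<bar>U i j \<omega>\<bar> powr l) = EU" for i j
    unfolding EU_def using expectation_U[of "\<lambda>u. \<bar>u\<bar> powr l" i j] by simp
  have EU0: "0 \<le> EU" unfolding EU_def by simp
  have sumj: "summable (\<lambda>j. real (Suc j) powr (-(3/2)))"
    using summable_real_powr_iff[of "-(3/2)"] by (subst summable_Suc_iff[of "\<lambda>j. real j powr (-(3/2))"]) simp
  have sumi: "summable (\<lambda>i. real (Suc i) powr (-(17/16)))"
    using summable_real_powr_iff[of "-(17/16)"] by (subst summable_Suc_iff[of "\<lambda>j. real j powr (-(17/16))"]) simp
  let ?t = "\<lambda>i j \<omega>. ennreal (\<bar>U i j \<omega>\<bar> powr l / \<tau> i j)"
  have "(\<integral>\<^sup>+\<omega>. (\<Sum>i. \<Sum>j. ?t i j \<omega>) \<partial>M) = (\<Sum>i. \<Sum>j. \<integral>\<^sup>+\<omega>. ?t i j \<omega> \<partial>M)"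
    by (simp add: nn_integral_suminf)
  also have "\<dots> = (\<Sum>i. \<Sum>j. ennreal (EU * real (Suc i) powr (-(17/16)) * real (Suc j) powr (-(3/2))))"
  proof (intro suminf_cong)
    fix i j
    have "(\<integral>\<^sup>+\<omega>. ?t i j \<omega> \<partial>M) = ennreal (expectation (\<lambda>\<omega>. \<bar>U i j \<omega>\<bar> powr l / \<tau> i j))"
      using U_moment \<tau>0[of i j] by (intro nn_integral_eq_integral) auto
    also have "expectation (\<lambda>\<omega>. \<bar>U i j \<omega>\<bar> powr l / \<tau> i j) = EU / \<tau> i j" by (simp add: EU)
    also have "\<dots> = EU * real (Suc i) powr (-(17/16)) * real (Suc j) powr (-(3/2))"
      unfolding \<tau>_def powr_minus by (simp add: field_simps)
    finally show "(\<integral>\<^sup>+\<omega>. ?t i j \<omega> \<partial>M) = ennreal (EU * real (Suc i) powr (-(17/16)) * real (Suc j) powr (-(3/2)))" .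
  qed
  also have "\<dots> = (\<Sum>i. ennreal (EU * real (Suc i) powr (-(17/16)) * (\<Sum>j. real (Suc j) powr (-(3/2)))))"
  proof (intro suminf_cong)
    fix i
    have "(\<lambda>j. EU * real (Suc i) powr (-(17/16)) * real (Suc j) powr (-(3/2))) sums
        (EU * real (Suc i) powr (-(17/16)) * (\<Sum>j. real (Suc j) powr (-(3/2))))"
      by (intro sums_mult summable_sums sumj)
    then show "(\<Sum>j. ennreal (EU * real (Suc i) powr (-(17/16)) * real (Suc j) powr (-(3/2))))
        = ennreal (EU * real (Suc i) powr (-(17/16)) * (\<Sum>j. real (Suc j) powr (-(3/2))))"
      using EU0 by (intro suminf_ennreal_eq) auto
  qed
  also have "\<dots> = ennreal (EU * (\<Sum>i. real (Suc i) powr (-(17/16))) * (\<Sum>j. real (Suc j) powr (-(3/2))))"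
    using EU0 sumj by (intro suminf_ennreal_eq sums_mult2 sums_mult summable_sums sumi)
      (auto intro!: mult_nonneg_nonneg suminf_nonneg)
  finally have "(\<integral>\<^sup>+\<omega>. (\<Sum>i. \<Sum>j. ?t i j \<omega>) \<partial>M) \<noteq> \<infinity>" by simp
  then have "AE \<omega> in M. (\<Sum>i. \<Sum>j. ?t i j \<omega>) \<noteq> \<infinity>"
    by (intro nn_integral_PInf_AE) auto
  then show ?thesis
  proof eventually_elim
    case (elim \<omega>)
    define W where "W = (\<Sum>i. \<Sum>j. ?t i j \<omega>)"
    have term_le: "f i \<le> suminf f" for f :: "nat \<Rightarrow> ennreal" and i
      using sum_le_suminf[of f "{i}"] by simp
    have "\<bar>U i j \<omega>\<bar> powr l \<le> enn2real W * \<tau> i j" for i j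
    proof -
      have "?t i j \<omega> \<le> (\<Sum>j. ?t i j \<omega>)" by (rule term_le)
      also have "\<dots> \<le> W" unfolding W_def by (rule term_le)
      finally have "enn2real (?t i j \<omega>) \<le> enn2real W"
        using elim by (intro enn2real_mono) (auto simp: W_def less_top)
      then show ?thesis using \<tau>0[of i j] by (simp add: field_simps)
    qed
    then show ?case unfolding \<tau>_def by blast
  qed
qed

text \<open>For large n no error reaches its level at all. With L = n / ln n and \<nu> = m_i, the
  envelope is at most a constant times \<nu>^(3/2) * n^(17/16), eventually below \<nu>^(3/2) *
  c^(1/2) * L^(9/8). As c * L^(1/4) is at most \<nu>, this is at most L * \<nu>^2, hence at most L *
  \<nu>^l and (Q * \<nu>)^l.\<close>

lemma error_tail_large_counts:
  assumes c: "0 < c"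
    and counts: "\<forall>\<^sub>F n in sequentially. \<forall>i<n. c * (real n / ln (real n)) powr (1/4) \<le> real (m n i)"
  shows "AE \<omega> in M. \<exists>C. \<forall>\<^sub>F n in sequentially.
      (\<Sum>(i, j)\<in>pairs n. wt n i * \<bar>clip_error n i j \<omega>\<bar>) \<le> C * rate n"
  using U_moment_envelope
proof eventually_elim
  case (elim \<omega>)
  then obtain K where K: "\<And>i j. \<bar>U i j \<omega>\<bar> powr l \<le> K * (real (Suc j) powr (3/2) * real (Suc i) powr (17/16))"
    by blast
  \<comment> \<open>The inequality 17/16 < 9/8 leaves room for the logarithm and for the random
    constant.\<close>
  have "\<forall>\<^sub>F n in sequentially. \<bar>K\<bar> * real n powr (17/16) \<le> c powr (1/2) * (real n / ln (real n)) powr (9/8)"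
  proof -
    have "((\<lambda>n. \<bar>K\<bar> * real n powr (17/16) / (real n / ln (real n)) powr (9/8)) \<longlongrightarrow> 0) sequentially"
      by real_asymp
    moreover have "0 < c powr (1/2)" using c by simp
    ultimately have "\<forall>\<^sub>F n in sequentially. \<bar>K\<bar> * real n powr (17/16) / (real n / ln (real n)) powr (9/8) < c powr (1/2)"
      by (rule order_tendstoD(2))
    then show ?thesis using log_ratio_le_1 eventually_gt_at_top[of 0]
      by eventually_elim (simp add: divide_less_eq less_imp_le)
  qed
  then have "\<forall>\<^sub>F n in sequentially. (\<Sum>(i, j)\<in>pairs n. wt n i * \<bar>clip_error n i j \<omega>\<bar>) \<le> 0 * rate n"
    using counts Q_pos Q_powr log_ratio_le_1 eventually_gt_at_top[of 0]
  proof eventually_elim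
    case (elim n)
    define L where "L = real n / ln (real n)"
    have L: "0 < L" using elim by (simp add: L_def)
    have "clip_error n i j \<omega> = 0" if ij: "(i, j) \<in> pairs n" for i j
    proof -
      have i: "i < n" and j: "j < m n i" using ij by (auto simp: pairs_def)
      define \<nu> where "\<nu> = real (m n i)"
      have \<nu>: "1 \<le> \<nu>" "real (Suc j) \<le> \<nu>" "c * L powr (1/4) \<le> \<nu>"
        using m_ge_2[OF i] j elim(2) i by (auto simp: \<nu>_def L_def)
      have "\<bar>U i j \<omega>\<bar> powr l \<le> \<bar>K\<bar> * (real (Suc j) powr (3/2) * real (Suc i) powr (17/16))"
        by (rule order_trans[OF K]) (auto intro!: mult_right_mono)
      also have "\<dots> \<le> \<bar>K\<bar> * (\<nu> powr (3/2) * real n powr (17/16))"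
        using \<nu> i by (intro mult_left_mono mult_mono powr_mono2) auto
      also have "\<dots> = \<nu> powr (3/2) * (\<bar>K\<bar> * real n powr (17/16))" by simp
      also have "\<dots> \<le> \<nu> powr (3/2) * (c powr (1/2) * L powr (9/8))"
        using elim(1) by (intro mult_left_mono) (auto simp: L_def)
      also have "\<dots> = L * (\<nu> powr (3/2) * (c * L powr (1/4)) powr (1/2))"
      proof -
        have "L powr (9/8) = L powr 1 * L powr (1/8)" by (simp only: powr_add[symmetric]) simp
        then show ?thesis using c L by (simp add: powr_mult powr_powr)
      qed
      also have "\<dots> \<le> L * (\<nu> powr (3/2) * \<nu> powr (1/2))"
        using \<nu> c L by (intro mult_left_mono powr_mono2) auto
      also have "\<dots> = L * \<nu> powr 2" by (simp only: powr_add[symmetric]) simp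
      also have "\<dots> \<le> L * \<nu> powr l" using \<nu> L l_gt_2 by (intro mult_left_mono powr_mono) auto
      also have "\<dots> \<le> Q n powr l * \<nu> powr l" using elim by (intro mult_right_mono) (auto simp: L_def)
      also have "\<dots> = (Q n * \<nu>) powr l" using elim \<nu> by (simp add: powr_mult)
      finally have "\<bar>U i j \<omega>\<bar> powr l \<le> (Q n * \<nu>) powr l" .
      then have "\<not> Q n * \<nu> < \<bar>U i j \<omega>\<bar>"
        using powr_less_mono2[of l "Q n * \<nu>" "\<bar>U i j \<omega>\<bar>"] elim(3) \<nu>(1) l_gt_2 by auto
      then have "\<bar>U i j \<omega>\<bar> \<le> Q n * \<nu>" by simp
      then show ?thesis by (auto simp: clip_error_def \<nu>_def min_def max_def)
    qed
    then have "(\<Sum>(i, j)\<in>pairs n. wt n i * \<bar>clip_error n i j \<omega>\<bar>) = 0"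
      by (intro sum.neutral) auto
    then show ?case by simp
  qed
  then show ?case by blast
qed

end

section \<open>The rates\<close>

context regular_sampling
begin

text \<open>At least two observations per subject give \<kappa> \<le> 1/2, so h + \<kappa> is at
  most 1 as soon as h < 1/2.\<close>

lemma \<beta>_le_h: "\<forall>\<^sub>F n in sequentially. \<beta> n \<le> h n"
proof -
  have "\<forall>\<^sub>F n in sequentially. h n < 1 / 2" using order_tendstoD(2)[OF h_tendsto_0, of "1/2"] by simp
  then show ?thesis
  proof eventually_elim
    case (elim n)
    have "\<beta> n = h n * (h n + \<kappa> n)" by (simp add: \<beta>_def power2_eq_square algebra_simps)
    also have "\<dots> \<le> h n * 1" using elim \<kappa>_bounds(2)[of n] h_pos[of n] by (intro mult_left_mono) auto
    finally show ?case by simp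
  qed
qed

lemma rate_div_h_le: "\<forall>\<^sub>F n in sequentially. rate n / h n \<le> (ln (real n) / (real n * h n)) powr (1 / 2)"
  using \<beta>_le_h log_ratio_le_1 eventually_gt_at_top[of 0]
proof eventually_elim
  case (elim n)
  have "rate n \<le> sqrt (h n * ln (real n) / real n)"
    unfolding rate_def using elim by (intro real_sqrt_le_mono divide_right_mono mult_right_mono) auto
  then have "rate n / h n \<le> sqrt (h n * ln (real n) / real n) / h n"
    using h_pos[of n] by (intro divide_right_mono) auto
  also have "\<dots> = sqrt (h n * ln (real n) / real n) / sqrt ((h n)\<^sup>2)" using h_pos[of n] by simp
  also have "\<dots> = sqrt (ln (real n) / (real n * h n))"
    unfolding real_sqrt_divide[symmetric] using h_pos[of n] by (simp add: power2_eq_square field_simps)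
  also have "\<dots> = (ln (real n) / (real n * h n)) powr (1 / 2)"
    using elim h_pos[of n] by (simp add: powr_half_sqrt)
  finally show ?case .
qed

text \<open>Needed for the denominator of the fit: the fluctuation of the design mass must be small
  against the mass of a window, which is of order h. Since \<beta> is at most h, ln n / (n * h) is
  below the quantity that tends to 0 in (C5).\<close>

lemma rate_div_h_tendsto_0: "(\<lambda>n. rate n / h n) \<longlonglongrightarrow> 0"
proof (rule tendsto_sandwich[where f="\<lambda>_. 0" and h="\<lambda>n. (ln (real n) / (real n * h n)) powr (1 / 2)"])
  have "(\<lambda>n. ln (real n) / (real n * h n)) \<longlonglongrightarrow> 0"
  proof (rule tendsto_sandwich)
    show "\<forall>\<^sub>F n in sequentially. 0 \<le> ln (real n) / (real n * h n)"
      using log_ratio_le_1 by eventually_elim (use h_pos in \<open>simp add: less_imp_le\<close>)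
    show "\<forall>\<^sub>F n in sequentially. ln (real n) / (real n * h n)
        \<le> inverse ((h n)\<^sup>2 + h n / gamma_m m n 1) * (ln (real n) / real n) powr (1 - 2 / l)"
      using \<beta>_le_h log_ratio_le_1 eventually_gt_at_top[of 0]
    proof eventually_elim
      case (elim n)
      have "ln (real n) / real n \<le> (ln (real n) / real n) powr (1 - 2 / l)"
        using powr_mono'[of "1 - 2 / l" 1 "ln (real n) / real n"] elim l_gt_2 by simp
      then have "inverse (h n) * (ln (real n) / real n) \<le> inverse (\<beta> n) * (ln (real n) / real n) powr (1 - 2 / l)"
        using elim \<beta>_pos[of n] h_pos[of n] by (intro mult_mono le_imp_inverse_le) auto
      moreover have "ln (real n) / (real n * h n) = inverse (h n) * (ln (real n) / real n)"
        by (simp add: divide_inverse mult_ac)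
      ultimately show ?case unfolding \<beta>_eq by simp
    qed
  qed (use h_lower in auto)
  then show "(\<lambda>n. (ln (real n) / (real n * h n)) powr (1 / 2)) \<longlonglongrightarrow> 0"
    by (rule tendsto_zero_powrI[where b="1/2"])
      (use log_ratio_le_1 h_pos in \<open>auto elim!: eventually_mono simp: less_imp_le\<close>)
  show "\<forall>\<^sub>F n in sequentially. 0 \<le> rate n / h n"
    using rate_pos by eventually_elim (use h_pos in \<open>simp add: less_imp_le\<close>)
qed (use rate_div_h_le in auto)

text \<open>Brings the loss into the form of the deterministic bound: one sum over pairs, with both
  averaging factors merged into the weight and the times clamped.\<close>

lemma local_linear_loss_pairs:
  assumes "\<And>i j. Tc i j \<omega> = T i j \<omega>"
  shows "local_linear_loss K (h n) n (m n) (\<lambda>i j. T i j \<omega>) (\<lambda>i j. observation Xs T U i j \<omega>) t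
    = (\<lambda>(a0, a1). \<Sum>k\<in>pairs n. (case k of (i, j) \<Rightarrow> wt n i) * ((1 / h n) * K (((case k of (i, j) \<Rightarrow> Tc i j \<omega>) - t) / h n)) *
        ((case k of (i, j) \<Rightarrow> observation Xs T U i j \<omega>) - a0 - a1 * ((case k of (i, j) \<Rightarrow> Tc i j \<omega>) - t))\<^sup>2)"
proof (rule ext, clarify)
  fix a0 a1
  have "(\<Sum>k\<in>pairs n. (case k of (i, j) \<Rightarrow> wt n i) * ((1 / h n) * K (((case k of (i, j) \<Rightarrow> Tc i j \<omega>) - t) / h n)) *
        ((case k of (i, j) \<Rightarrow> observation Xs T U i j \<omega>) - a0 - a1 * ((case k of (i, j) \<Rightarrow> Tc i j \<omega>) - t))\<^sup>2)
      = (\<Sum>(i, j)\<in>pairs n. wt n i * ((1 / h n) * K ((T i j \<omega> - t) / h n)) *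
        (observation Xs T U i j \<omega> - a0 - a1 * (T i j \<omega> - t))\<^sup>2)"
    by (intro sum.cong) (auto simp: assms)
  also have "\<dots> = local_linear_loss K (h n) n (m n) (\<lambda>i j. T i j \<omega>) (\<lambda>i j. observation Xs T U i j \<omega>) t (a0, a1)"
    unfolding sum_pairs local_linear_loss_def split_conv scaled_kernel_def wt_def
    by (auto simp: sum_distrib_left mult_ac intro!: sum.cong)
  finally show "local_linear_loss K (h n) n (m n) (\<lambda>i j. T i j \<omega>) (\<lambda>i j. observation Xs T U i j \<omega>) t (a0, a1)
      = (\<Sum>k\<in>pairs n. (case k of (i, j) \<Rightarrow> wt n i) * ((1 / h n) * K (((case k of (i, j) \<Rightarrow> Tc i j \<omega>) - t) / h n)) *
        ((case k of (i, j) \<Rightarrow> observation Xs T U i j \<omega>) - a0 - a1 * ((case k of (i, j) \<Rightarrow> Tc i j \<omega>) - t))\<^sup>2)" ..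
qed

text \<open>On the almost sure event the deterministic bound applies with \<delta> and N multiples
  of \<open>rate n\<close> and with R the Taylor remainder, of order h^2. The events do not depend
  on t, so the bound is uniform.\<close>

lemma mu_hat_error_bound:
  assumes C2: "condition_C2 K"
    and tail: "AE \<omega> in M. \<exists>C. \<forall>\<^sub>F n in sequentially.
      (\<Sum>(i, j)\<in>pairs n. wt n i * \<bar>clip_error n i j \<omega>\<bar>) \<le> C * rate n"
  shows "AE \<omega> in M. \<exists>C\<ge>0. \<forall>\<^sub>F n in sequentially. \<forall>t\<in>{a..b}.
      \<bar>mu_hat K h m Xs T U n \<omega> t - \<mu> t\<bar> \<le> C * ((h n)\<^sup>2 + rate n / h n)"
proof -
  have K0: "\<And>x. 0 \<le> K x" and Ksupp: "\<And>x. x \<notin> {-1..1} \<Longrightarrow> K x = 0" and Ksym: "\<And>x. K (- x) = K x"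
    and bv: "bounded_variation_on K (-1) 1"
    using C2 by (auto simp: condition_C2_def)
  obtain B where B: "\<And>x N. incseq x \<Longrightarrow> range x \<subseteq> {-1..1} \<Longrightarrow> (\<Sum>k<N. \<bar>K (x (Suc k)) - K (x k)\<bar>) \<le> B"
    using bv unfolding bounded_variation_on_def by blast
  define G where "G = \<bar>K (-1)\<bar> + B"
  have KG: "\<And>v. v \<in> {-1..1} \<Longrightarrow> \<bar>K v\<bar> \<le> G"
    unfolding G_def by (rule bounded_variation_imp_bounded[OF B])
  have B0: "0 \<le> B" using B[of "\<lambda>_. 0" 0] by (simp add: incseq_const)
  have G0: "0 \<le> G" using B0 by (simp add: G_def)
  obtain p q c where bump: "0 \<le> p" "p < q" "q \<le> 1" "0 < c" "\<And>u. u \<in> {p..q} \<Longrightarrow> c \<le> K u"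
    using kernel_bounded_below_on_interval[OF C2] by blast
  define d where "d = (q - p) / 3"
  have d: "0 < d" "p + 3 * d = q" using bump(2) by (simp_all add: d_def diff_divide_distrib)
  obtain \<mu>' Ct where Ct: "0 \<le> Ct"
    "\<And>t x. t \<in> {a..b} \<Longrightarrow> x \<in> {a..b} \<Longrightarrow> \<bar>\<mu> x - \<mu> t - \<mu>' t * (x - t)\<bar> \<le> Ct * (x - t)\<^sup>2"
    using condition_C3_taylor(1)[OF interval C3] by blast
  define A where "A = 2 * (G * (2 * MT + 1)) * (G * (2 * MT + 1) + 3 * G + B) / (d\<^sup>2 * (c * mT * d / 2)\<^sup>2)"
  have A0: "0 \<le> A" using G0 B0 MT_pos by (simp add: A_def)
  show ?thesis using Tc_eq_T path_noise_bound error_noise_bound[OF tail] mass_deviation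
  proof eventually_elim
    case (elim \<omega>)
    have Tc: "Tc i j \<omega> = T i j \<omega>" for i j using elim(1) by blast
    obtain C1 where C1: "\<forall>\<^sub>F n in sequentially. \<forall>p q. short n p q \<longrightarrow>
      \<bar>\<Sum>i<n. wt n i * (\<Sum>j<m n i. resid i j \<omega> * hit p q i j \<omega>)\<bar> \<le> C1 * rate n" using elim(2) by blast
    obtain C2 where C2: "\<forall>\<^sub>F n in sequentially. \<forall>p q. short n p q \<longrightarrow>
      \<bar>\<Sum>(i, j)\<in>pairs n. wt n i * (U i j \<omega> * hit p q i j \<omega>)\<bar> \<le> C2 * rate n" using elim(3) by blast
    obtain C3 where C3: "\<forall>\<^sub>F n in sequentially. \<forall>p q. short n p q \<longrightarrow>
     mT * (q - p) - C3 * rate n \<le> (\<Sum>(i, j)\<in>pairs n. wt n i * hit p q i j \<omega>) \<and>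
     (\<Sum>(i, j)\<in>pairs n. wt n i * hit p q i j \<omega>) \<le> MT * (q - p) + C3 * rate n" using elim(4) by blast
    have lim: "(\<lambda>n. C3 * (rate n / h n)) \<longlonglongrightarrow> 0"
      using tendsto_mult_right_zero[OF rate_div_h_tendsto_0] by simp
    have "0 < min 1 (mT * d / 2)" using mT_pos d by simp
    from order_tendstoD(2)[OF lim this]
    \<comment> \<open>The two upper bounds on \<delta> that keep the window mass bounded above and
      the determinant away from 0.\<close>
    have small: "\<forall>\<^sub>F n in sequentially. C3 * rate n \<le> h n \<and> C3 * rate n \<le> mT * d / 2 * h n"
    proof eventually_elim
      case (elim n)
      then have "C3 * (rate n / h n) * h n \<le> 1 * h n" "C3 * (rate n / h n) * h n \<le> mT * d / 2 * h n"
        using h_pos[of n] by (intro mult_right_mono; simp)+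
      then show ?case using h_pos[of n] by simp
    qed
    have "\<forall>\<^sub>F n in sequentially. h n < (b - a) / 2"
      using order_tendstoD(2)[OF h_tendsto_0, of "(b - a) / 2"] interval by simp
    then have "\<forall>\<^sub>F n in sequentially. \<forall>t\<in>{a..b}.
      \<bar>mu_hat K h m Xs T U n \<omega> t - \<mu> t\<bar> \<le> A * (Ct + (\<bar>C1\<bar> + \<bar>C2\<bar>)) * ((h n)\<^sup>2 + rate n / h n)"
      using C1 C2 C3 small rate_pos
    proof eventually_elim
      case (elim n)
      show ?case
      proof
        fix t assume t: "t \<in> {a..b}"
        define N where "N = (\<bar>C1\<bar> + \<bar>C2\<bar>) * rate n"
        have "\<bar>mu_hat K h m Xs T U n \<omega> t - \<mu> t\<bar> \<le> A * (Ct * (h n)\<^sup>2 + N / h n)"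
          unfolding mu_hat_def local_linear_loss_pairs[OF Tc] A_def
        proof (rule local_linear_error_bound[where I="pairs n" and \<epsilon>="\<lambda>(i, j). resid i j \<omega> + U i j \<omega>"
              and ?\<mu>1.0="\<mu>' t" and \<delta>="C3 * rate n" and p=p and q=q])
          fix x z assume xz: "a \<le> x" "x \<le> z" "z \<le> b" "z - x \<le> 2 * h n"
          have eq: "(\<Sum>k\<in>pairs n. (case k of (i, j) \<Rightarrow> wt n i) * indicator {x..z} (case k of (i, j) \<Rightarrow> Tc i j \<omega>))
              = (\<Sum>(i, j)\<in>pairs n. wt n i * hit x z i j \<omega>)"
            by (intro sum.cong) auto
          show "mT * (z - x) - C3 * rate n
              \<le> (\<Sum>k\<in>pairs n. (case k of (i, j) \<Rightarrow> wt n i) * indicator {x..z} (case k of (i, j) \<Rightarrow> Tc i j \<omega>)) \<and>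
            (\<Sum>k\<in>pairs n. (case k of (i, j) \<Rightarrow> wt n i) * indicator {x..z} (case k of (i, j) \<Rightarrow> Tc i j \<omega>))
              \<le> MT * (z - x) + C3 * rate n"
            unfolding eq using elim(4) xz by blast
          have n1: "\<bar>\<Sum>i<n. wt n i * (\<Sum>j<m n i. resid i j \<omega> * hit x z i j \<omega>)\<bar> \<le> C1 * rate n"
            using elim(2) xz by blast
          have n2: "\<bar>\<Sum>(i, j)\<in>pairs n. wt n i * (U i j \<omega> * hit x z i j \<omega>)\<bar> \<le> C2 * rate n"
            using elim(3) xz by blast
          have "(\<Sum>k\<in>pairs n. (case k of (i, j) \<Rightarrow> wt n i) * (case k of (i, j) \<Rightarrow> resid i j \<omega> + U i j \<omega>) *
                indicator {x..z} (case k of (i, j) \<Rightarrow> Tc i j \<omega>))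
              = (\<Sum>(i, j)\<in>pairs n. wt n i * (resid i j \<omega> * hit x z i j \<omega>) + wt n i * (U i j \<omega> * hit x z i j \<omega>))"
            by (intro sum.cong) (auto simp: algebra_simps)
          also have "\<dots> = (\<Sum>(i, j)\<in>pairs n. wt n i * (resid i j \<omega> * hit x z i j \<omega>))
              + (\<Sum>(i, j)\<in>pairs n. wt n i * (U i j \<omega> * hit x z i j \<omega>))"
            unfolding case_prod_unfold by (rule sum.distrib)
          also have "(\<Sum>(i, j)\<in>pairs n. wt n i * (resid i j \<omega> * hit x z i j \<omega>))
              = (\<Sum>i<n. wt n i * (\<Sum>j<m n i. resid i j \<omega> * hit x z i j \<omega>))"
            unfolding sum_pairs by (simp only: sum_distrib_left)
          finally have eq2: "(\<Sum>k\<in>pairs n. (case k of (i, j) \<Rightarrow> wt n i) * (case k of (i, j) \<Rightarrow> resid i j \<omega> + U i j \<omega>) *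
                indicator {x..z} (case k of (i, j) \<Rightarrow> Tc i j \<omega>))
              = (\<Sum>i<n. wt n i * (\<Sum>j<m n i. resid i j \<omega> * hit x z i j \<omega>))
                + (\<Sum>(i, j)\<in>pairs n. wt n i * (U i j \<omega> * hit x z i j \<omega>))" .
          have "C1 * rate n \<le> \<bar>C1\<bar> * rate n" "C2 * rate n \<le> \<bar>C2\<bar> * rate n"
            using elim(6) by (auto intro: mult_right_mono)
          then show "\<bar>\<Sum>k\<in>pairs n. (case k of (i, j) \<Rightarrow> wt n i) * (case k of (i, j) \<Rightarrow> resid i j \<omega> + U i j \<omega>) *
                indicator {x..z} (case k of (i, j) \<Rightarrow> Tc i j \<omega>)\<bar> \<le> N"
            unfolding eq2 N_def distrib_right using n1 n2 by linarith
        next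
          fix k assume k: "k \<in> pairs n" and near: "\<bar>(case k of (i, j) \<Rightarrow> Tc i j \<omega>) - t\<bar> \<le> h n"
          obtain i j where ij: "k = (i, j)" by fastforce
          have "\<bar>\<mu> (Tc i j \<omega>) - \<mu> t - \<mu>' t * (Tc i j \<omega> - t)\<bar> \<le> Ct * (Tc i j \<omega> - t)\<^sup>2"
            using Ct(2)[OF t] Tc_range by simp
          also have "\<dots> \<le> Ct * (h n)\<^sup>2"
            using near Ct(1) h_pos[of n] unfolding ij by (intro mult_left_mono) (auto simp: abs_le_square_iff[symmetric])
          also have "\<mu> (Tc i j \<omega>) - \<mu> t - \<mu>' t * (Tc i j \<omega> - t)
              = observation Xs T U i j \<omega> - (\<mu> t + \<mu>' t * (Tc i j \<omega> - t)) - (resid i j \<omega> + U i j \<omega>)"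
            by (simp add: observation_def resid_def Tc)
          finally show "\<bar>(case k of (i, j) \<Rightarrow> observation Xs T U i j \<omega>)
              - (\<mu> t + \<mu>' t * ((case k of (i, j) \<Rightarrow> Tc i j \<omega>) - t)) - (case k of (i, j) \<Rightarrow> resid i j \<omega> + U i j \<omega>)\<bar>
              \<le> Ct * (h n)\<^sup>2" by (simp add: ij)
        next
          show "0 \<le> (case k of (i, j) \<Rightarrow> wt n i)" for k by (simp add: case_prod_unfold)
          show "(case k of (i, j) \<Rightarrow> Tc i j \<omega>) \<in> {a..b}" for k
            using Tc_range by (simp add: case_prod_unfold)
          show "2 * h n \<le> b - a" using elim(1) by simp
          show "C3 * rate n \<le> h n" "C3 * rate n \<le> mT * d / 2 * h n" using elim(5) by auto
          show "0 \<le> N" using elim(6) by (simp add: N_def)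
          show "0 \<le> Ct * (h n)\<^sup>2" using Ct(1) by simp
        qed (fact finite_pairs h_pos t K0 Ksupp Ksym B KG bump d mT_pos MT_pos)+
        also have "\<dots> \<le> A * ((Ct + (\<bar>C1\<bar> + \<bar>C2\<bar>)) * ((h n)\<^sup>2 + rate n / h n))"
        proof (rule mult_left_mono[OF _ A0])
          have "0 \<le> Ct * (rate n / h n)" "0 \<le> (\<bar>C1\<bar> + \<bar>C2\<bar>) * (h n)\<^sup>2"
            using Ct(1) h_pos[of n] elim(6) by auto
          moreover have "N / h n = (\<bar>C1\<bar> + \<bar>C2\<bar>) * (rate n / h n)" by (simp add: N_def)
          moreover have "(Ct + (\<bar>C1\<bar> + \<bar>C2\<bar>)) * ((h n)\<^sup>2 + rate n / h n)
              = Ct * (h n)\<^sup>2 + Ct * (rate n / h n) + (\<bar>C1\<bar> + \<bar>C2\<bar>) * (h n)\<^sup>2 + (\<bar>C1\<bar> + \<bar>C2\<bar>) * (rate n / h n)"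
            by (simp only: distrib_left distrib_right add_ac)
          ultimately show "Ct * (h n)\<^sup>2 + N / h n \<le> (Ct + (\<bar>C1\<bar> + \<bar>C2\<bar>)) * ((h n)\<^sup>2 + rate n / h n)"
            by linarith
        qed
        finally show "\<bar>mu_hat K h m Xs T U n \<omega> t - \<mu> t\<bar> \<le> A * (Ct + (\<bar>C1\<bar> + \<bar>C2\<bar>)) * ((h n)\<^sup>2 + rate n / h n)"
          by (simp add: mult.assoc)
      qed
    qed
    moreover have "0 \<le> A * (Ct + (\<bar>C1\<bar> + \<bar>C2\<bar>))" using A0 Ct(1) by simp
    ultimately show ?case by blast
  qed
qed

text \<open>Turns the pointwise uniform bound into a statement on the supremum, with the boundedness
  that gives the real supremum its meaning.\<close>

lemma mu_hat_rate:
  assumes C2: "condition_C2 K"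
    and tail: "AE \<omega> in M. \<exists>C. \<forall>\<^sub>F n in sequentially.
      (\<Sum>(i, j)\<in>pairs n. wt n i * \<bar>clip_error n i j \<omega>\<bar>) \<le> C * rate n"
    and r: "0 \<le> c" "\<forall>\<^sub>F n in sequentially. (h n)\<^sup>2 + rate n / h n \<le> c * r n"
  shows "as_uniform_rate M a b (\<lambda>n \<omega> t. mu_hat K h m Xs T U n \<omega> t - \<mu> t) r"
  unfolding as_uniform_rate_def
  using mu_hat_error_bound[OF C2 tail]
proof eventually_elim
  case (elim \<omega>)
  let ?D = "\<lambda>n t. mu_hat K h m Xs T U n \<omega> t - \<mu> t"
  obtain C where C: "0 \<le> C" "\<forall>\<^sub>F n in sequentially. \<forall>t\<in>{a..b}. \<bar>?D n t\<bar> \<le> C * ((h n)\<^sup>2 + rate n / h n)"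
    using elim by blast
  have bound: "\<forall>\<^sub>F n in sequentially. \<forall>t\<in>{a..b}. \<bar>?D n t\<bar> \<le> C * (c * r n)"
    using C(2) r(2)
  proof eventually_elim
    case (elim n)
    then show ?case using mult_left_mono[OF elim(2) C(1)] by force
  qed
  have bdd: "\<forall>\<^sub>F n in sequentially. bdd_above ((\<lambda>t. \<bar>?D n t\<bar>) ` {a..b})"
    using bound by eventually_elim (auto intro: bdd_aboveI2)
  have "(\<lambda>n. SUP t\<in>{a..b}. \<bar>?D n t\<bar>) \<in> O(r)"
  proof (rule bigoI[where c="C * c"])
    show "\<forall>\<^sub>F n in sequentially. norm (SUP t\<in>{a..b}. \<bar>?D n t\<bar>) \<le> C * c * norm (r n)"
      using bound bdd
    proof eventually_elim
      case (elim n)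
      have "(SUP t\<in>{a..b}. \<bar>?D n t\<bar>) \<le> C * (c * r n)"
        using elim interval by (intro cSUP_least) auto
      also have "\<dots> \<le> C * c * \<bar>r n\<bar>"
        using C(1) r(1) by (simp add: mult.assoc mult_left_mono)
      finally have up: "(SUP t\<in>{a..b}. \<bar>?D n t\<bar>) \<le> C * c * \<bar>r n\<bar>" .
      \<comment> \<open>The norm of the supremum also requires it to be nonnegative; its value at
        the end point \<open>a\<close> shows this.\<close>
      have "0 \<le> \<bar>?D n a\<bar>" by simp
      also have "\<dots> \<le> (SUP t\<in>{a..b}. \<bar>?D n t\<bar>)" using elim(2) interval by (intro cSUP_upper) auto
      finally show ?case using up by simp
    qed
  qed
  with bdd show ?case by blast
qed

section \<open>The two regimes of the counts\<close>

lemma bounded_counts_rate: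
  assumes C2: "condition_C2 K" and B: "\<And>n i. i < n \<Longrightarrow> m n i \<le> B"
  shows "as_uniform_rate M a b (\<lambda>n \<omega> t. mu_hat K h m Xs T U n \<omega> t - \<mu> t)
    (\<lambda>n. (h n)\<^sup>2 + (ln (real n) / (real n * h n)) powr (1 / 2))"
proof (rule mu_hat_rate[OF C2 error_tail_bounded_counts[OF B], of 1])
  show "\<forall>\<^sub>F n in sequentially. (h n)\<^sup>2 + rate n / h n \<le> 1 * ((h n)\<^sup>2 + (ln (real n) / (real n * h n)) powr (1 / 2))"
    using rate_div_h_le by eventually_elim simp
qed auto

text \<open>The lower bound on the counts makes \<kappa> at most c1 * h, so \<beta> is at most (1 +
  c1) * h^2 and \<open>rate / h\<close> is of order (ln n / n)^(1/2). The upper bound on h gives the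
  same order for the bias h^2.\<close>

lemma large_counts_rate:
  fixes Mn :: "nat \<Rightarrow> real"
  assumes C2: "condition_C2 K" and Mn_pos: "\<And>n. 0 < Mn n" and Mn_le: "\<And>n i. i < n \<Longrightarrow> Mn n \<le> real (m n i)"
    and Mn_O: "(\<lambda>n. inverse (Mn n)) \<in> O(h)" and h_O: "h \<in> O(\<lambda>n. (ln (real n) / real n) powr (1 / 4))"
  shows "as_uniform_rate M a b (\<lambda>n \<omega> t. mu_hat K h m Xs T U n \<omega> t - \<mu> t)
    (\<lambda>n. (ln (real n) / real n) powr (1 / 2))"
proof -
  obtain c1 where c1: "0 < c1" "\<forall>\<^sub>F n in sequentially. norm (inverse (Mn n)) \<le> c1 * norm (h n)"
    using landau_o.bigE[OF Mn_O] by blast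
  obtain c2 where c2: "0 < c2" "\<forall>\<^sub>F n in sequentially. norm (h n) \<le> c2 * norm ((ln (real n) / real n) powr (1 / 4))"
    using landau_o.bigE[OF h_O] by blast
  have M_h: "\<forall>\<^sub>F n in sequentially. inverse (Mn n) \<le> c1 * h n"
    using c1(2) by eventually_elim (use Mn_pos h_pos in \<open>simp add: less_imp_le\<close>)
  have h_le: "\<forall>\<^sub>F n in sequentially. h n \<le> c2 * (ln (real n) / real n) powr (1 / 4)"
    using c2(2) by eventually_elim (use h_pos in \<open>simp add: less_imp_le\<close>)
  \<comment> \<open>Chaining both order relations: m_i is at least Mn, which is at least 1 / (c1 *
    h), and h is at most c2 * (ln n / n)^(1/4). This is the growth that rules out large
    errors.\<close>
  have counts: "\<forall>\<^sub>F n in sequentially. \<forall>i<n. (1 / (c1 * c2)) * (real n / ln (real n)) powr (1/4) \<le> real (m n i)"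
    using M_h h_le log_ratio_le_1 eventually_gt_at_top[of 0]
  proof eventually_elim
    case (elim n)
    define L where "L = (ln (real n) / real n) powr (1/4)"
    have L: "0 < L" using elim by (simp add: L_def)
    have inv: "(real n / ln (real n)) powr (1/4) = 1 / L"
      using elim by (simp add: L_def powr_divide)
    have "inverse (Mn n) \<le> c1 * (c2 * L)"
      using elim(1) mult_left_mono[OF elim(2), of c1] c1(1) unfolding L_def by linarith
    then have "1 / (c1 * c2 * L) \<le> Mn n"
      using Mn_pos[of n] L c1(1) c2(1) by (simp add: field_simps)
    then show ?case unfolding inv using Mn_le[of _ n] by (auto intro: order_trans)
  qed
  have \<kappa>: "\<forall>\<^sub>F n in sequentially. \<kappa> n \<le> c1 * h n"
    using M_h eventually_gt_at_top[of 0]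
  proof eventually_elim
    case (elim n)
    have "(\<Sum>i<n. 1 / real (m n i)) \<le> (\<Sum>i<n. inverse (Mn n))"
      using Mn_pos[of n] Mn_le[of _ n] by (intro sum_mono) (auto simp: inverse_eq_divide intro!: divide_left_mono mult_pos_pos m_pos)
    then have "\<kappa> n \<le> (1 / real n) * (real n * inverse (Mn n))"
      unfolding \<kappa>_def by (intro mult_left_mono) auto
    then show ?case using elim by simp
  qed
  show ?thesis
  proof (rule mu_hat_rate[OF C2 error_tail_large_counts[OF _ counts], of "c2\<^sup>2 + sqrt (1 + c1)"])
    show "\<forall>\<^sub>F n in sequentially. (h n)\<^sup>2 + rate n / h n \<le> (c2\<^sup>2 + sqrt (1 + c1)) * (ln (real n) / real n) powr (1 / 2)"
      using \<kappa> h_le log_ratio_le_1 eventually_gt_at_top[of 0]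
    proof eventually_elim
      case (elim n)
      define x where "x = ln (real n) / real n"
      have x: "0 < x" using elim by (simp add: x_def)
      have "(h n)\<^sup>2 \<le> (c2 * x powr (1/4))\<^sup>2" using elim h_pos[of n] by (intro power_mono) (auto simp: x_def)
      also have "\<dots> = c2\<^sup>2 * x powr (1/2)" using x by (simp add: power_mult_distrib flip: powr_numeral) (simp add: powr_powr)
      finally have h2: "(h n)\<^sup>2 \<le> c2\<^sup>2 * x powr (1/2)" .
      have "\<beta> n \<le> (1 + c1) * (h n)\<^sup>2"
        unfolding \<beta>_def using mult_left_mono[OF elim(1), of "h n"] h_pos[of n] by (simp add: power2_eq_square algebra_simps)
      then have "rate n \<le> sqrt ((1 + c1) * (h n)\<^sup>2 * x)"
        unfolding rate_def x_def using elim by (intro real_sqrt_le_mono) (simp add: divide_right_mono mult_right_mono)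
      also have "\<dots> = sqrt (1 + c1) * x powr (1/2) * h n"
        using h_pos[of n] x by (simp add: real_sqrt_mult powr_half_sqrt)
      finally have "rate n / h n \<le> sqrt (1 + c1) * x powr (1/2)"
        using h_pos[of n] by (simp add: pos_divide_le_eq)
      then show ?case using h2 unfolding x_def[symmetric] distrib_right by linarith
    qed
  qed (use c1 c2 in auto)
qed

end

theorem corollary3p2:
  fixes M :: "'w measure" and a b :: real
    and S :: "(real \<Rightarrow> real) measure"
    and X :: "'w \<Rightarrow> real \<Rightarrow> real"
    and Xs :: "nat \<Rightarrow> 'w \<Rightarrow> real \<Rightarrow> real"
    and T U :: "nat \<Rightarrow> nat \<Rightarrow> 'w \<Rightarrow> real"
    and fT K :: "real \<Rightarrow> real" and \<sigma> :: real
    and m :: "nat \<Rightarrow> nat \<Rightarrow> nat" and h :: "nat \<Rightarrow> real"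
  assumes model: "sampling_model M a b S X Xs T U fT \<sigma> m"
    and h_pos: "\<And>n. 0 < h n"
    and C1: "condition_C1 a b fT"
    and C2: "condition_C2 K"
    and C3: "condition_C3 a b (mean_fun M X)"
    and C5: "condition_C5 M a b X U m h"
  shows "((\<exists>B::nat. \<forall>n. \<forall>i<n. m n i \<le> B) \<longrightarrow>
           as_uniform_rate M a b
             (\<lambda>n \<omega> t. mu_hat K h m Xs T U n \<omega> t - mean_fun M X t)
             (\<lambda>n. (h n)\<^sup>2 + (ln (real n) / (real n * h n)) powr (1 / 2))) \<and>
         ((\<exists>Mn :: nat \<Rightarrow> real.
             (\<forall>n. 0 < Mn n) \<and> (\<forall>n. \<forall>i<n. Mn n \<le> real (m n i)) \<and>
             (\<lambda>n. inverse (Mn n)) \<in> O(h) \<and>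
             h \<in> O(\<lambda>n. (ln (real n) / real n) powr (1 / 4))) \<longrightarrow>
           as_uniform_rate M a b
             (\<lambda>n \<omega> t. mu_hat K h m Xs T U n \<omega> t - mean_fun M X t)
             (\<lambda>n. (ln (real n) / real n) powr (1 / 2)))"
proof -
  obtain mT MT where T: "0 < mT" "\<forall>t\<in>{a..b}. mT \<le> fT t \<and> fT t \<le> MT"
    using C1 unfolding condition_C1_def by blast
  obtain l where l: "2 < l" "\<forall>i j. integrable M (\<lambda>\<omega>. \<bar>U i j \<omega>\<bar> powr l)"
    "(\<integral>\<^sup>+\<omega>. (SUP t\<in>{a..b}. ennreal (\<bar>X \<omega> t\<bar> powr l)) \<partial>M) < \<infinity>" "h \<longlonglongrightarrow> 0"
    "(\<lambda>n. inverse ((h n)\<^sup>2 + h n / gamma_m m n 1) * (ln (real n) / real n) powr (1 - 2 / l)) \<longlonglongrightarrow> 0"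
    using C5 unfolding condition_C5_def by blast
  interpret regular_sampling M a b S X Xs T U fT \<sigma> m h mT MT l
    by (intro regular_sampling.intro regular_sampling_axioms.intro model) (use h_pos C3 T l in auto)
  show ?thesis
  proof (intro conjI impI; elim exE conjE)
    fix B assume "\<forall>n. \<forall>i<n. m n i \<le> B"
    then show "as_uniform_rate M a b (\<lambda>n \<omega> t. mu_hat K h m Xs T U n \<omega> t - mean_fun M X t)
        (\<lambda>n. (h n)\<^sup>2 + (ln (real n) / (real n * h n)) powr (1 / 2))"
      by (intro bounded_counts_rate[OF C2]) auto
  next
    fix Mn :: "nat \<Rightarrow> real"
    assume "\<forall>n. 0 < Mn n" "\<forall>n. \<forall>i<n. Mn n \<le> real (m n i)" "(\<lambda>n. inverse (Mn n)) \<in> O(h)"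
      "h \<in> O(\<lambda>n. (ln (real n) / real n) powr (1 / 4))"
    then show "as_uniform_rate M a b (\<lambda>n \<omega> t. mu_hat K h m Xs T U n \<omega> t - mean_fun M X t)
        (\<lambda>n. (ln (real n) / real n) powr (1 / 2))"
      by (intro large_counts_rate[OF C2, of Mn]) auto
  qed
qed

end
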